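(* Let $n\ge 2$, let $\Omega\subset\mathbb{R}^{n-1}$ be open, let $q:\Omega\to\mathbb{R}$ be smooth, and let $S=\{(y',q(y')):y'\in\Omega\}\subset\mathbb{R}^n$ be connected. Let $A$ be a real symmetric (invertible) positive definite $n\times n$ matrix, and assume that the Hessian matrix $\operatorname{Hess}(q)$ is definite (either positive definite or negative definite) at every point of $\Omega$. Let $\mathcal{R}:\mathcal{E}'(\mathbb{R}^n\setminus S)\to\mathcal{D}'(\Omega\times(0,\infty))$ be the Radon transform $$\mathcal{R}f(y',t)=\int_{\mathbb{R}}\int_{\mathbb{R}^n}|\nabla_x\psi|\,f(x)\,e^{i\psi(y',t,x,\omega)}\,dx\,d\omega,\qquad \psi(y',t,x,\omega)=\omega\big(t-x_T^TAx_T\big),\quad x_T=x-(y',q(y')).$$ Then $\mathcal{R}$ is a Fourier integral operator associated to a two-sided fold canonical relation; that is, both projections $\pi_L$ and $\pi_R$ from its canonical relation $C$ have only fold singularities.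
   Context: Points of $\mathbb{R}^n$ are regarded as column vectors. The functions/distributions $f$ have support disjoint from $S$, and $t>0$ throughout. The integral defining $\mathcal{R}$ is understood as an oscillatory integral. A Fourier integral operator (FIO) with nondegenerate phase function $\varphi(u,v;\theta)$ and symbol amplitude $a$ is an operator $\mathcal{E}'(V)\to\mathcal{D}'(U)$ with kernel $\int e^{i\varphi}a\,d\theta$ (as usual, modulo smooth kernels); its canonical relation is $\{(u,d_u\varphi;v,-d_v\varphi): d_\theta\varphi=0\}$. Canonical relation of $\mathcal{R}$: $C=\{(y',t,d_{y'}\psi,\omega;\,x,-d_x\psi):\ \partial_\omega\psi=0\}\subset (T^*(\Omega\times(0,\infty))\setminus 0)\times(T^*(\mathbb{R}^n\setminus S)\setminus0)$. It is a smooth $2n$-dimensional manifold globally parametrized by $(y',x,\omega)$ with $y'\in\Omega$, $x\in\mathbb{R}^n\setminus S$, $\omega\in\mathbb{R}\setminus\{0\}$, and $t=x_T^TAx_T>0$. With $B$ the $(n-1)\times n$ matrix $B=(I_{n-1}\,|\,\nabla q(y'))$, the projections are $$\pi_L(y',x,\omega)=(y',\,x_T^TAx_T,\,2\omega BAx_T,\,\omega)\in T^*(\Omega\times(0,\infty)),\qquad \pi_R(y',x,\omega)=(x,\,2\omega Ax_T)\in T^*\mathbb{R}^n .$$ For a smooth map $f$ between manifolds of equal dimension (in local coordinates), let $S_1(f)=\{p:\det(df_p)=0,\ d(\det(df))_p\ne0\}$, a smooth hypersurface on which $df$ has corank $1$. $f$ has a fold singularity along $S_1(f)$ if $\ker(df_p)$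 is transversal to $T_pS_1(f)$ for all $p\in S_1(f)$. "Only fold singularities" means that every point where $\det(df)=0$ lies in $S_1(f)$ and the transversality condition holds there. A canonical relation is a two-sided fold if both $\pi_L$ and $\pi_R$ have (only) fold singularities. *)

theory Defs
  imports "HOL-Analysis.Analysis"
begin

section \<open>Smooth functions\<close>

primrec pderivs :: "'a::real_normed_vector list \<Rightarrow> ('a \<Rightarrow> 'b::real_normed_vector) \<Rightarrow> 'a \<Rightarrow> 'b" where
  "pderivs [] f = f"
| "pderivs (v # vs) f = (\<lambda>x. frechet_derivative (pderivs vs f) (at x) v)"

text \<open>As usual, a function is smooth on an arbitrary set if it is smooth on some open
  neighbourhood of it; for an open set this is smoothness on the set itself. If all iterated
  directional derivatives are (Frechet) differentiable, they are also continuous.\<close>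

definition smooth_on :: "'a::real_normed_vector set \<Rightarrow> ('a \<Rightarrow> 'b::real_normed_vector) \<Rightarrow> bool" where
  "smooth_on S f \<longleftrightarrow>
    (\<exists>T. open T \<and> S \<subseteq> T \<and> (\<forall>vs. \<forall>x\<in>T. pderivs vs f differentiable (at x)))"

text \<open>Covectors are identified with vectors through the inner product, so this is also the
  differential of a scalar function.\<close>

definition grad :: "('a::euclidean_space \<Rightarrow> real) \<Rightarrow> 'a \<Rightarrow> 'a" where
  "grad f x = (\<Sum>b\<in>Basis. frechet_derivative f (at x) b *\<^sub>R b)"

definition hessian :: "(real^'m \<Rightarrow> real) \<Rightarrow> real^'m \<Rightarrow> real^'m^'m" where
  "hessian q y = (\<chi> i j. pderivs [axis i 1, axis j 1] q y)"

definition pos_def :: "real^'m^'m \<Rightarrow> bool" where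
  "pos_def M \<longleftrightarrow> (\<forall>x. x \<noteq> 0 \<longrightarrow> 0 < x \<bullet> (M *v x))"

definition neg_def :: "real^'m^'m \<Rightarrow> bool" where
  "neg_def M \<longleftrightarrow> (\<forall>x. x \<noteq> 0 \<longrightarrow> x \<bullet> (M *v x) < 0)"


section \<open>Distributions\<close>

definition test_fun :: "'a::euclidean_space set \<Rightarrow> ('a \<Rightarrow> complex) \<Rightarrow> bool" where
  "test_fun U w \<longleftrightarrow> smooth_on UNIV w \<and> (\<exists>K. compact K \<and> K \<subseteq> U \<and> (\<forall>x. x \<notin> K \<longrightarrow> w x = 0))"

text \<open>The partial derivatives of order at most \<open>N\<close> are bounded by \<open>B\<close> on \<open>K\<close>.\<close>

definition derivs_bounded :: "nat \<Rightarrow> 'a::euclidean_space set \<Rightarrow> ('a \<Rightarrow> complex) \<Rightarrow> real \<Rightarrow> bool" where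
  "derivs_bounded N K g B \<longleftrightarrow>
    0 \<le> B \<and> (\<forall>vs. \<forall>x\<in>K. set vs \<subseteq> Basis \<and> length vs \<le> N \<longrightarrow> norm (pderivs vs g x) \<le> B)"

text \<open>The space \<open>\<D>'(U)\<close>. Only the values of \<open>u\<close> on test functions matter.\<close>

definition distribution ::
  "'a::euclidean_space set \<Rightarrow> (('a \<Rightarrow> complex) \<Rightarrow> complex) \<Rightarrow> bool" where
  "distribution U u \<longleftrightarrow>
    (\<forall>g h. test_fun U g \<and> test_fun U h \<longrightarrow> u (\<lambda>x. g x + h x) = u g + u h) \<and>
    (\<forall>c g. test_fun U g \<longrightarrow> u (\<lambda>x. c * g x) = c * u g) \<and>
    (\<forall>K. compact K \<and> K \<subseteq> U \<longrightarrow>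
      (\<exists>C N. \<forall>g B. test_fun U g \<and> (\<forall>x. x \<notin> K \<longrightarrow> g x = 0) \<and> derivs_bounded N K g B
        \<longrightarrow> norm (u g) \<le> C * B))"

text \<open>Continuity of a linear functional on \<open>C\<^sup>\<infinity>(W)\<close> for open \<open>W\<close>.\<close>

definition cont_functional ::
  "'a::euclidean_space set \<Rightarrow> (('a \<Rightarrow> complex) \<Rightarrow> complex) \<Rightarrow> bool" where
  "cont_functional W f \<longleftrightarrow>
    (\<forall>g h. smooth_on W g \<and> smooth_on W h \<longrightarrow> f (\<lambda>x. g x + h x) = f g + f h) \<and>
    (\<forall>c g. smooth_on W g \<longrightarrow> f (\<lambda>x. c * g x) = c * f g) \<and>
    (\<exists>C N L. compact L \<and> L \<subseteq> W \<and>
      (\<forall>g B. smooth_on W g \<and> derivs_bounded N L g B \<longrightarrow> norm (f g) \<le> C * B))"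

text \<open>The space \<open>\<E>'(V)\<close> of distributions whose support is a compact subset of \<open>V\<close>. A distribution
  with support in the compact set \<open>K\<close> is applied to any function that is smooth near \<open>K\<close> and
  depends only on the germ of that function at \<open>K\<close>. This formulation makes sense for every set
  \<open>V\<close>; the complement of a graph over an open set need not be open.\<close>

definition compact_distribution ::
  "'a::euclidean_space set \<Rightarrow> (('a \<Rightarrow> complex) \<Rightarrow> complex) \<Rightarrow> bool" where
  "compact_distribution V f \<longleftrightarrow>
    (\<exists>K. compact K \<and> K \<subseteq> V \<and> (\<forall>W. open W \<and> K \<subseteq> W \<longrightarrow> cont_functional W f))"


section \<open>Fourier integral operators\<close>

text \<open>Oscillatory integral over \<open>(u,\<theta>)\<close>, regularised by cutoffs in the frequency variable
  \<open>\<theta>\<close>.\<close>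

definition has_osc_integral ::
  "('u::euclidean_space \<times> 'k::euclidean_space \<Rightarrow> complex) \<Rightarrow> complex \<Rightarrow> bool" where
  "has_osc_integral F I \<longleftrightarrow>
    (\<forall>\<rho>. test_fun UNIV \<rho> \<and> \<rho> 0 = 1 \<longrightarrow>
      ((\<lambda>\<epsilon>::real. (LINT z|lborel. (\<rho> (\<epsilon> *\<^sub>R snd z) * F z))) \<longlongrightarrow> I) (at_right 0))"

definition osc_integral ::
  "('u::euclidean_space \<times> 'k::euclidean_space \<Rightarrow> complex) \<Rightarrow> complex" where
  "osc_integral F = (THE I. has_osc_integral F I)"

text \<open>The operator with Schwartz kernel \<open>\<integral> exp(i\<phi>(u,v,\<theta>)) a(u,v,\<theta>) d\<theta>\<close>. It acts on a compactly supported
  distribution \<open>f\<close> by duality: \<open>\<langle>T f, w\<rangle> = \<langle>f, T\<^sup>t w\<rangle>\<close>. If \<open>f\<close> is (integration against) a test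
  function, this is the oscillatory integral of \<open>exp(i\<phi>(u,v,\<theta>)) a(u,v,\<theta>) f(v) w(u)\<close> over \<open>(u,v,\<theta>)\<close>.\<close>

definition osc_operator ::
  "('u::euclidean_space \<times> 'v::euclidean_space \<times> 'k::euclidean_space \<Rightarrow> real) \<Rightarrow>
   ('u \<times> 'v \<times> 'k \<Rightarrow> complex) \<Rightarrow> (('v \<Rightarrow> complex) \<Rightarrow> complex) \<Rightarrow> (('u \<Rightarrow> complex) \<Rightarrow> complex)" where
  "osc_operator \<phi> a f w =
    f (\<lambda>v. osc_integral (\<lambda>(u, \<theta>). exp (\<i> * complex_of_real (\<phi> (u, v, \<theta>))) * a (u, v, \<theta>) * w u))"

definition kernel_operator ::
  "('u::euclidean_space \<times> 'v::euclidean_space \<Rightarrow> complex) \<Rightarrow>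
   (('v \<Rightarrow> complex) \<Rightarrow> complex) \<Rightarrow> (('u \<Rightarrow> complex) \<Rightarrow> complex)" where
  "kernel_operator k f w = f (\<lambda>v. LINT u|lborel. (k (u, v) * w u))"

text \<open>Nondegenerate (operator) phase functions. The last condition is linear independence of the
  family of differentials \<open>d(\<partial>\<phi>/\<partial>\<theta>\<^sub>j)\<close> where \<open>d\<^sub>\<theta>\<phi> = 0\<close>.\<close>

definition nondegenerate_phase ::
  "'u::euclidean_space set \<Rightarrow> 'v::euclidean_space set \<Rightarrow>
   ('u \<times> 'v \<times> 'k::euclidean_space \<Rightarrow> real) \<Rightarrow> bool" where
  "nondegenerate_phase U V \<phi> \<longleftrightarrow>
    smooth_on (U \<times> V \<times> (UNIV - {0})) \<phi> \<and>
    (\<forall>u\<in>U. \<forall>v\<in>V. \<forall>\<theta>. \<theta> \<noteq> 0 \<longrightarrow>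
      (\<forall>\<tau>>0. \<phi> (u, v, \<tau> *\<^sub>R \<theta>) = \<tau> * \<phi> (u, v, \<theta>)) \<and>
      (grad (\<lambda>u'. \<phi> (u', v, \<theta>)) u, grad (\<lambda>\<theta>'. \<phi> (u, v, \<theta>')) \<theta>) \<noteq> 0 \<and>
      (grad (\<lambda>v'. \<phi> (u, v', \<theta>)) v, grad (\<lambda>\<theta>'. \<phi> (u, v, \<theta>')) \<theta>) \<noteq> 0 \<and>
      (grad (\<lambda>\<theta>'. \<phi> (u, v, \<theta>')) \<theta> = 0 \<longrightarrow>
        (let D = (\<lambda>b. grad (\<lambda>z. frechet_derivative \<phi> (at z) (0, 0, b)) (u, v, \<theta>))
         in inj_on D Basis \<and> independent (D ` Basis))))"

text \<open>Symbols of order \<open>m\<close>, i.e. \<open>S\<^sup>m\<^sub>1\<^sub>,\<^sub>0\<close>.\<close>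

definition symbol_amplitude ::
  "'u::euclidean_space set \<Rightarrow> 'v::euclidean_space set \<Rightarrow> real \<Rightarrow>
   ('u \<times> 'v \<times> 'k::euclidean_space \<Rightarrow> complex) \<Rightarrow> bool" where
  "symbol_amplitude U V m a \<longleftrightarrow>
    smooth_on (U \<times> V \<times> UNIV) a \<and>
    (\<forall>K \<alpha> \<beta>. compact K \<and> K \<subseteq> U \<times> V \<longrightarrow>
      (\<exists>C. \<forall>(u, v)\<in>K. \<forall>\<theta>.
        norm (pderivs (map (\<lambda>(b, c). (b, c, 0)) \<alpha> @ map (\<lambda>d. (0, 0, d)) \<beta>) a (u, v, \<theta>))
          \<le> C * (1 + norm \<theta>) powr (m - real (length \<beta>))))"

definition fourier_integral_operator ::
  "'u::euclidean_space set \<Rightarrow> 'v::euclidean_space set \<Rightarrow>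
   ('u \<times> 'v \<times> 'k::euclidean_space \<Rightarrow> real) \<Rightarrow>
   ((('v \<Rightarrow> complex) \<Rightarrow> complex) \<Rightarrow> (('u \<Rightarrow> complex) \<Rightarrow> complex)) \<Rightarrow> bool" where
  "fourier_integral_operator U V \<phi> T \<longleftrightarrow>
    nondegenerate_phase U V \<phi> \<and>
    (\<forall>f. compact_distribution V f \<longrightarrow> distribution U (T f)) \<and>
    (\<exists>m a k. symbol_amplitude U V m a \<and> smooth_on (U \<times> V) k \<and>
      (\<forall>f w. compact_distribution V f \<and> test_fun U w \<longrightarrow>
        T f w = osc_operator \<phi> a f w + kernel_operator k f w))"

definition canonical_relation ::
  "'u::euclidean_space set \<Rightarrow> 'v::euclidean_space set \<Rightarrow>
   ('u \<times> 'v \<times> 'k::euclidean_space \<Rightarrow> real) \<Rightarrow> (('u \<times> 'u) \<times> ('v \<times> 'v)) set" where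
  "canonical_relation U V \<phi> =
    {((u, grad (\<lambda>u'. \<phi> (u', v, \<theta>)) u), (v, - grad (\<lambda>v'. \<phi> (u, v', \<theta>)) v)) | u v \<theta>.
      u \<in> U \<and> v \<in> V \<and> \<theta> \<noteq> 0 \<and> grad (\<lambda>\<theta>'. \<phi> (u, v, \<theta>')) \<theta> = 0}"


section \<open>Fold singularities\<close>

definition jac_det :: "(real^'k \<Rightarrow> real^'k) \<Rightarrow> real^'k \<Rightarrow> real" where
  "jac_det f p = det (jacobian f (at p))"

definition S1 :: "(real^'k) set \<Rightarrow> (real^'k \<Rightarrow> real^'k) \<Rightarrow> (real^'k) set" where
  "S1 W f = {p \<in> W. jac_det f p = 0 \<and> frechet_derivative (jac_det f) (at p) \<noteq> (\<lambda>_. 0)}"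

text \<open>At \<open>p \<in> S\<^sub>1(f)\<close> the tangent space of the hypersurface \<open>S\<^sub>1(f)\<close> is the kernel of
  \<open>d(det df)\<^sub>p\<close>, as \<open>det df\<close> is a regular defining function.\<close>

definition S1_tangent :: "(real^'k \<Rightarrow> real^'k) \<Rightarrow> real^'k \<Rightarrow> (real^'k) set" where
  "S1_tangent f p = {v. frechet_derivative (jac_det f) (at p) v = 0}"

definition only_folds_coord :: "(real^'k) set \<Rightarrow> (real^'k \<Rightarrow> real^'k) \<Rightarrow> bool" where
  "only_folds_coord W f \<longleftrightarrow> smooth_on W f \<and>
    (\<forall>p\<in>W. jac_det f p = 0 \<longrightarrow> p \<in> S1 W f \<and>
      {v + w | v w. frechet_derivative f (at p) v = 0 \<and> w \<in> S1_tangent f p} = UNIV)"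

text \<open>For maps into another Euclidean space of the same dimension, the target is given linear
  coordinates; the choice changes \<open>det df\<close> only by a nonzero constant factor.\<close>

definition only_folds :: "(real^'k) set \<Rightarrow> (real^'k \<Rightarrow> 'b::euclidean_space) \<Rightarrow> bool" where
  "only_folds W f \<longleftrightarrow> (\<exists>c. linear c \<and> bij c \<and> only_folds_coord W (c \<circ> f))"

text \<open>A global parametrization of a submanifold (an injective immersion that is a homeomorphism
  onto its image).\<close>

definition global_parametrization ::
  "(real^'k) set \<Rightarrow> (real^'k \<Rightarrow> 'c::euclidean_space) \<Rightarrow> 'c set \<Rightarrow> bool" where
  "global_parametrization W \<gamma> C \<longleftrightarrow>
    smooth_on W \<gamma> \<and> (\<forall>p\<in>W. inj (frechet_derivative \<gamma> (at p))) \<and> (\<exists>g. homeomorphism W C \<gamma> g)"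

text \<open>\<open>C\<close> is a two-sided fold, where the coordinates on \<open>C\<close> are given by \<open>\<gamma>\<close>.\<close>

definition two_sided_fold ::
  "(real^'k) set \<Rightarrow> (real^'k \<Rightarrow> 'a::euclidean_space \<times> 'b::euclidean_space) \<Rightarrow> ('a \<times> 'b) set \<Rightarrow> bool" where
  "two_sided_fold W \<gamma> C \<longleftrightarrow>
    global_parametrization W \<gamma> C \<and> only_folds W (fst \<circ> \<gamma>) \<and> only_folds W (snd \<circ> \<gamma>)"


section \<open>The Radon transform\<close>

text \<open>With \<open>n - 1 = CARD('m)\<close>, points of \<open>\<real>\<^sup>n\<close> have type \<^typ>\<open>real^('m option)\<close>; the index \<^term>\<open>None\<close> is the last
  coordinate. As \<^typ>\<open>'m\<close> is nonempty, \<open>n\<close> is an arbitrary integer \<open>\<ge> 2\<close>.\<close>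

definition graph_pt :: "(real^'m \<Rightarrow> real) \<Rightarrow> real^'m \<Rightarrow> real^('m option)" where
  "graph_pt q y = (\<chi> i. case i of Some j \<Rightarrow> y $ j | None \<Rightarrow> q y)"

definition xT :: "(real^'m \<Rightarrow> real) \<Rightarrow> real^'m \<Rightarrow> real^('m option) \<Rightarrow> real^('m option)" where
  "xT q y x = x - graph_pt q y"

definition radon_phase ::
  "real^('m::finite option)^('m option) \<Rightarrow> (real^'m \<Rightarrow> real) \<Rightarrow>
   ((real^'m) \<times> real) \<times> (real^('m option)) \<times> real \<Rightarrow> real" where
  "radon_phase A q = (\<lambda>((y, t), x, \<omega>). \<omega> * (t - xT q y x \<bullet> (A *v xT q y x)))"

definition radon ::
  "real^('m::finite option)^('m option) \<Rightarrow> (real^'m \<Rightarrow> real) \<Rightarrow>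
   ((real^('m option) \<Rightarrow> complex) \<Rightarrow> complex) \<Rightarrow> (((real^'m) \<times> real \<Rightarrow> complex) \<Rightarrow> complex)" where
  "radon A q = osc_operator (radon_phase A q)
    (\<lambda>((y, t), x, \<omega>). complex_of_real (norm (grad (\<lambda>x'. radon_phase A q ((y, t), x', \<omega>)) x)))"

text \<open>The matrix \<open>B = (I | \<nabla>q(y))\<close>.\<close>

definition B_mat :: "(real^'m::finite \<Rightarrow> real) \<Rightarrow> real^'m \<Rightarrow> real^('m option)^'m" where
  "B_mat q y = (\<chi> i j. case j of Some k \<Rightarrow> if i = k then 1 else 0 | None \<Rightarrow> grad q y $ i)"

text \<open>The parameters \<open>(y,x,\<omega>)\<close> as a single vector with \<open>2n\<close> components.\<close>

definition par_y :: "real^('m::finite + ('m option + unit)) \<Rightarrow> real^'m" where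
  "par_y p = (\<chi> i. p $ Inl i)"

definition par_x :: "real^('m::finite + ('m option + unit)) \<Rightarrow> real^('m option)" where
  "par_x p = (\<chi> i. p $ Inr (Inl i))"

definition par_\<omega> :: "real^('m::finite + ('m option + unit)) \<Rightarrow> real" where
  "par_\<omega> p = p $ Inr (Inr ())"

definition param_domain ::
  "(real^'m) set \<Rightarrow> (real^'m \<Rightarrow> real) \<Rightarrow> (real^('m::finite + ('m option + unit))) set" where
  "param_domain \<Omega> q = {p. par_y p \<in> \<Omega> \<and> par_x p \<notin> graph_pt q ` \<Omega> \<and> par_\<omega> p \<noteq> 0}"

definition \<pi>L ::
  "real^('m::finite option)^('m option) \<Rightarrow> (real^'m \<Rightarrow> real) \<Rightarrow>
   real^('m + ('m option + unit)) \<Rightarrow> ((real^'m) \<times> real) \<times> ((real^'m) \<times> real)" where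
  "\<pi>L A q p =
    (let y = par_y p; z = xT q y (par_x p); \<omega> = par_\<omega> p
     in ((y, z \<bullet> (A *v z)), ((2 * \<omega>) *\<^sub>R (B_mat q y *v (A *v z)), \<omega>)))"

definition \<pi>R ::
  "real^('m::finite option)^('m option) \<Rightarrow> (real^'m \<Rightarrow> real) \<Rightarrow>
   real^('m + ('m option + unit)) \<Rightarrow> (real^('m option)) \<times> (real^('m option))" where
  "\<pi>R A q p =
    (let z = xT q (par_y p) (par_x p) in (par_x p, (2 * par_\<omega> p) *\<^sub>R (A *v z)))"

end

theory Submission
  imports Defs "HOL-Probability.Sinc_Integral"
begin

text \<open>
  With \<open>Q (y, x) = x\<^sub>T \<bullet> A x\<^sub>T\<close> the phase is \<open>\<omega> (t - Q (y, x))\<close>, linear in the frequency \<open>\<omega>\<close> and in \<open>t\<close>.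

  \<^bold>\<open>Fourier integral operator.\<close> Let \<open>w\<close> be a test function in \<open>(y, t)\<close>. Integrating first over \<open>(y, t)\<close>
  at fixed frequency gives a function of \<open>\<omega>\<close> (\<open>slice\<close>) that is rapidly decreasing, by integration by
  parts in \<open>t\<close>. Hence the regularised oscillatory integral converges to an absolutely convergent
  integral over \<open>\<omega>\<close> (\<open>osc\<close>, lemma \<open>has_osc_integral_osc\<close>). A derivative in \<open>x\<close> produces a factor \<open>\<omega>\<close>,
  which integration by parts turns into a \<open>t\<close>-derivative of \<open>w\<close>. The functions \<open>osc\<close> are therefore
  closed under differentiation, so they are smooth in \<open>x\<close> away from the part of the graph that lies
  over the support of \<open>w\<close> (\<open>smooth_osc\<close>), with derivatives bounded by finitely many derivatives of \<open>w\<close>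
  (\<open>osc_derivs_bounded\<close>). By duality the operator maps \<open>\<E>'\<close> to \<open>\<D>'\<close> (\<open>distribution_radon\<close>). The amplitude
  \<open>2 \<bar>\<omega>\<bar> norm (A x\<^sub>T)\<close> fails to be a symbol only because \<open>\<bar>\<omega>\<bar>\<close> is not smooth at \<open>0\<close>. Changing \<open>\<bar>\<omega>\<bar>\<close> to a
  smooth function on the unit interval changes the operator by one with a smooth kernel
  (\<open>osc_compact_weight\<close>).

  \<^bold>\<open>Folds.\<close> In suitable linear coordinates the Jacobian determinants of both projections are products
  of a nowhere vanishing function and the same function \<open>tangency\<close>, which vanishes exactly if \<open>x\<close> lies
  in the tangent plane of the graph at the point over \<open>y\<close> (\<open>jac_det_\<pi>R\<close>, \<open>jac_det_\<pi>L\<close>). It remains to see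
  that the differential of \<open>tangency\<close> does not vanish on the kernels (\<open>only_folds_coordI\<close>). Write \<open>x'\<^sub>T\<close>
  for the first \<open>n - 1\<close> components of \<open>x\<^sub>T\<close>. The kernel of \<open>d\<pi>\<^sub>R\<close> contains a vector along which \<open>y\<close> moves
  with velocity \<open>x'\<^sub>T\<close>; there the derivative is \<open>- x'\<^sub>T \<bullet> Hess q x'\<^sub>T\<close>, and \<open>x'\<^sub>T\<close> is not zero because \<open>x\<close> is
  off the graph (\<open>\<pi>R_kernel\<close>). The kernel of \<open>d\<pi>\<^sub>L\<close> contains a vector along which only \<open>x\<close> moves, with
  velocity \<open>A\<^sup>-\<^sup>1 \<nu>\<close> for the normal vector \<open>\<nu> = (- \<nabla>q, 1)\<close>; there the derivative is \<open>\<nu> \<bullet> A\<^sup>-\<^sup>1 \<nu> > 0\<close>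
  (\<open>\<pi>L_kernel\<close>).
\<close>

section \<open>Calculus of smooth functions\<close>

lemma has_derivative_frechet:
  "f differentiable at x \<Longrightarrow> (f has_derivative frechet_derivative f (at x)) (at x)"
  by (simp add: frechet_derivative_works)

lemma has_derivative_cong_open:
  assumes "open S" "x \<in> S" "\<And>y. y \<in> S \<Longrightarrow> f y = g y"
  shows "(f has_derivative D) (at x) \<longleftrightarrow> (g has_derivative D) (at x)"
  using assms has_derivative_transform_within_open[of f D x UNIV S g]
    has_derivative_transform_within_open[of g D x UNIV S f] by auto

lemma frechet_derivative_cong_open:
  assumes "open S" "x \<in> S" "\<And>y. y \<in> S \<Longrightarrow> f y = g y"
  shows "frechet_derivative f (at x) = frechet_derivative g (at x)"
  unfolding frechet_derivative_def using has_derivative_cong_open[OF assms] by simp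

lemma differentiable_cong_open:
  assumes "open S" "x \<in> S" "\<And>y. y \<in> S \<Longrightarrow> f y = g y"
  shows "f differentiable (at x) \<longleftrightarrow> g differentiable (at x)"
  unfolding differentiable_def using has_derivative_cong_open[OF assms] by simp

lemma pderivs_append: "pderivs (us @ vs) f = pderivs us (pderivs vs f)"
  by (induction us) auto

lemma pderivs_cong_open:
  assumes "open S" "\<And>y. y \<in> S \<Longrightarrow> f y = g y"
  shows "x \<in> S \<Longrightarrow> pderivs vs f x = pderivs vs g x"
proof (induction vs arbitrary: x)
  case (Cons v vs)
  then show ?case
    using frechet_derivative_cong_open[OF assms(1) Cons.prems, of "pderivs vs f" "pderivs vs g"]
    by simp
qed (use assms in auto)

text \<open>Differentiability of finite order, by recursion from the inside: the derivative that is
  taken first is split off. Closure properties are then proved by induction on the order, where the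
  derivative of a product or of a composition is again a sum of products and compositions.\<close>

primrec diff_n :: "nat \<Rightarrow> 'a::real_normed_vector set \<Rightarrow> ('a \<Rightarrow> 'b::real_normed_vector) \<Rightarrow> bool" where
  "diff_n 0 S f = (\<forall>x\<in>S. f differentiable (at x))"
| "diff_n (Suc n) S f = ((\<forall>x\<in>S. f differentiable (at x)) \<and>
     (\<forall>v. diff_n n S (\<lambda>x. frechet_derivative f (at x) v)))"

lemma diff_n_iff_pderivs:
  "diff_n n S f \<longleftrightarrow> (\<forall>vs. length vs \<le> n \<longrightarrow> (\<forall>x\<in>S. pderivs vs f differentiable (at x)))"
proof (induction n arbitrary: f)
  case 0
  show ?case by simp
next
  case (Suc n)
  show ?case (is "?l \<longleftrightarrow> ?r")
  proof
    assume l: ?l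
    show ?r
    proof (intro allI impI ballI)
      fix vs :: "'a list" and x
      assume "length vs \<le> Suc n" "x \<in> S"
      then show "pderivs vs f differentiable (at x)"
        using l Suc.IH by (cases vs rule: rev_cases) (auto simp: pderivs_append)
    qed
  next
    assume r: ?r
    have "diff_n n S (\<lambda>x. frechet_derivative f (at x) v)" for v
      unfolding Suc.IH
    proof (intro allI impI ballI)
      fix vs :: "'a list" and x
      assume "length vs \<le> n" "x \<in> S"
      then show "pderivs vs (\<lambda>x. frechet_derivative f (at x) v) differentiable (at x)"
        using r[rule_format, of "vs @ [v]" x] by (simp add: pderivs_append)
    qed
    moreover have "\<forall>x\<in>S. f differentiable (at x)"
      using r[rule_format, of "[]"] by simp
    ultimately show ?l by simp
  qed
qed

lemma smooth_on_pderivs: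
  "open S \<Longrightarrow> smooth_on S f \<longleftrightarrow> (\<forall>vs. \<forall>x\<in>S. pderivs vs f differentiable (at x))"
  unfolding smooth_on_def by blast

lemma smooth_on_iff_diff_n: "open S \<Longrightarrow> smooth_on S f \<longleftrightarrow> (\<forall>n. diff_n n S f)"
  unfolding smooth_on_pderivs diff_n_iff_pderivs by blast

lemma smooth_on_subset: "smooth_on T f \<Longrightarrow> S \<subseteq> T \<Longrightarrow> smooth_on S f"
  unfolding smooth_on_def by blast

lemma smooth_on_open_nbhd:
  assumes "smooth_on S f" obtains T where "open T" "S \<subseteq> T" "smooth_on T f"
  using assms unfolding smooth_on_def by blast

lemma smooth_on_differentiable:
  assumes "smooth_on S f" "x \<in> S" shows "f differentiable (at x)"
proof -
  obtain T where "open T" "S \<subseteq> T" "\<forall>vs. \<forall>x\<in>T. pderivs vs f differentiable (at x)"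
    using assms(1) unfolding smooth_on_def by blast
  then show ?thesis using assms(2) pderivs.simps(1) by (metis subsetD)
qed

lemma smooth_on_has_derivative:
  "smooth_on S f \<Longrightarrow> x \<in> S \<Longrightarrow> (f has_derivative frechet_derivative f (at x)) (at x)"
  by (intro has_derivative_frechet smooth_on_differentiable)

lemma smooth_on_continuous_on: "smooth_on S f \<Longrightarrow> continuous_on S f"
  by (meson continuous_at_imp_continuous_on differentiable_imp_continuous_within
    smooth_on_differentiable)

lemma smooth_on_pderivs_smooth:
  assumes "open S" "smooth_on S f" shows "smooth_on S (pderivs vs f)"
  using assms unfolding smooth_on_pderivs[OF assms(1)] pderivs_append[symmetric] by blast

lemma smooth_on_frechet:
  assumes "open S" "smooth_on S f" shows "smooth_on S (\<lambda>x. frechet_derivative f (at x) v)"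
  using smooth_on_pderivs_smooth[OF assms, of "[v]"] by simp

lemma diff_n_cong:
  fixes f g :: "'a::real_normed_vector \<Rightarrow> 'b::real_normed_vector"
  assumes "open S" "\<And>y. y \<in> S \<Longrightarrow> f y = g y" "diff_n n S f"
  shows "diff_n n S g"
  unfolding diff_n_iff_pderivs
proof (intro allI impI ballI)
  fix vs :: "'a list" and x assume "length vs \<le> n" "x \<in> S"
  then have "pderivs vs f differentiable (at x)" using assms(3) by (simp add: diff_n_iff_pderivs)
  then show "pderivs vs g differentiable (at x)"
    using differentiable_cong_open[OF assms(1) \<open>x \<in> S\<close>, of "pderivs vs f" "pderivs vs g"]
      pderivs_cong_open[OF assms(1), of f g _ vs] assms(2) by blast
qed

lemma diff_n_SucD: "diff_n (Suc n) S f \<Longrightarrow> diff_n n S f"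
  unfolding diff_n_iff_pderivs by (meson le_Suc_eq)

lemma diff_n_SucI:
  assumes "open S" "\<And>x. x \<in> S \<Longrightarrow> (f has_derivative f' x) (at x)" "\<And>v. diff_n n S (\<lambda>x. f' x v)"
  shows "diff_n (Suc n) S f"
proof -
  have "f' x = frechet_derivative f (at x)" if "x \<in> S" for x
    using assms(2)[OF that] by (rule frechet_derivative_at)
  then have "diff_n n S (\<lambda>x. frechet_derivative f (at x) v)" for v
    using diff_n_cong[OF assms(1) _ assms(3)[of v]] by simp
  then show ?thesis using assms(2) by (auto simp: differentiable_def)
qed

lemma diff_n_Suc_has_derivative:
  "diff_n (Suc n) S f \<Longrightarrow> x \<in> S \<Longrightarrow> (f has_derivative frechet_derivative f (at x)) (at x)"
  by (simp add: frechet_derivative_works)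

lemma diff_n_const: "open S \<Longrightarrow> diff_n n S (\<lambda>x. c)"
  by (induction n arbitrary: c) (auto intro!: diff_n_SucI[where f'="\<lambda>x v. 0"] derivative_eq_intros
    simp del: diff_n.simps(2))

lemma diff_n_linear:
  assumes "open S" "bounded_linear L" "diff_n n S f" shows "diff_n n S (\<lambda>x. L (f x))"
  using assms(3)
proof (induction n arbitrary: f)
  case 0
  then show ?case using assms(2)
    by (auto simp: differentiable_def intro: bounded_linear.has_derivative)
next
  case (Suc n)
  show ?case
  proof (rule diff_n_SucI[OF assms(1)])
    show "((\<lambda>x. L (f x)) has_derivative (\<lambda>v. L (frechet_derivative f (at x) v))) (at x)"
      if "x \<in> S" for x
      using diff_n_Suc_has_derivative[OF Suc.prems that] assms(2)
      by (rule bounded_linear.has_derivative[rotated])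
  qed (use Suc in auto)
qed

lemma diff_n_add:
  assumes "open S" "diff_n n S f" "diff_n n S g" shows "diff_n n S (\<lambda>x. f x + g x)"
  using assms(2,3)
proof (induction n arbitrary: f g)
  case (Suc n)
  show ?case
  proof (rule diff_n_SucI[OF assms(1)])
    show "((\<lambda>x. f x + g x) has_derivative
      (\<lambda>v. frechet_derivative f (at x) v + frechet_derivative g (at x) v)) (at x)"
      if "x \<in> S" for x
      using diff_n_Suc_has_derivative[OF Suc.prems(1) that]
        diff_n_Suc_has_derivative[OF Suc.prems(2) that]
      by (rule has_derivative_add)
  qed (use Suc in auto)
qed auto

lemma diff_n_bilinear:
  assumes "open S" "bounded_bilinear B" "diff_n n S f" "diff_n n S g"
  shows "diff_n n S (\<lambda>x. B (f x) (g x))"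
  using assms(3,4)
proof (induction n arbitrary: f g)
  case 0
  then show ?case using bounded_bilinear.FDERIV[OF assms(2)]
    by (auto simp: differentiable_def) blast
next
  case (Suc n)
  show ?case
  proof (rule diff_n_SucI[OF assms(1)])
    show "((\<lambda>x. B (f x) (g x)) has_derivative
      (\<lambda>v. B (f x) (frechet_derivative g (at x) v) + B (frechet_derivative f (at x) v) (g x))) (at x)"
      if "x \<in> S" for x
      using diff_n_Suc_has_derivative[OF Suc.prems(1) that]
        diff_n_Suc_has_derivative[OF Suc.prems(2) that]
      by (rule bounded_bilinear.FDERIV[OF assms(2)])
    show "diff_n n S (\<lambda>x. B (f x) (frechet_derivative g (at x) v) + B (frechet_derivative f (at x)
      v) (g x))" for v
      using Suc.prems by (intro diff_n_add assms(1) Suc.IH) (auto dest: diff_n_SucD simp del: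
        diff_n.simps(2), auto)
  qed
qed

lemma diff_n_sum:
  assumes "open S" "\<And>i. i \<in> I \<Longrightarrow> diff_n n S (f i)"
  shows "diff_n n S (\<lambda>x. \<Sum>i\<in>I. f i x)"
proof (cases "finite I")
  case True
  then show ?thesis using assms(2)
    by (induction I) (auto intro!: diff_n_add diff_n_const assms(1))
qed (use assms(1) in \<open>auto intro: diff_n_const\<close>)

text \<open>The chain rule is expanded in a basis of the intermediate space: then each term is a product of a
  derivative of the inner function and a composition to which the induction hypothesis applies.\<close>

lemma diff_n_compose:
  fixes f :: "'a::real_normed_vector \<Rightarrow> 'b::euclidean_space"
  assumes "open S" "open T" "f ` S \<subseteq> T" "diff_n n S f" "diff_n n T g"
  shows "diff_n n S (\<lambda>x. g (f x))"
  using assms(4,5)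
proof (induction n arbitrary: g)
  case 0
  then show ?case using assms(3) differentiable_chain_at[of f _ g] by (auto simp: o_def)
next
  case (Suc n)
  have dg: "(g has_derivative frechet_derivative g (at (f x))) (at (f x))" if "x \<in> S" for x
    using diff_n_Suc_has_derivative[OF Suc.prems(2)] that assms(3) by blast
  show ?case
  proof (rule diff_n_SucI[OF assms(1)])
    show "((\<lambda>x. g (f x)) has_derivative
      (\<lambda>v. \<Sum>b\<in>Basis. (frechet_derivative f (at x) v \<bullet> b) *\<^sub>R frechet_derivative g (at (f x)) b)) (at x)"
      if x: "x \<in> S" for x
    proof -
      have "((g \<circ> f) has_derivative (frechet_derivative g (at (f x)) \<circ> frechet_derivative f (at x)))
        (at x)"
        using diff_n_Suc_has_derivative[OF Suc.prems(1) x] dg[OF x] by (rule diff_chain_at)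
      moreover have "frechet_derivative g (at (f x)) \<circ> frechet_derivative f (at x) =
          (\<lambda>v. \<Sum>b\<in>Basis. (frechet_derivative f (at x) v \<bullet> b) *\<^sub>R frechet_derivative g (at (f x)) b)"
      proof
        fix v
        define w where "w = frechet_derivative f (at x) v"
        have lin: "linear (frechet_derivative g (at (f x)))"
          using dg[OF x] has_derivative_linear by blast
        have "frechet_derivative g (at (f x)) (\<Sum>b\<in>Basis. (w \<bullet> b) *\<^sub>R b) =
            (\<Sum>b\<in>Basis. (w \<bullet> b) *\<^sub>R frechet_derivative g (at (f x)) b)"
          using lin by (simp add: linear_sum linear_scale)
        then show "(frechet_derivative g (at (f x)) \<circ> frechet_derivative f (at x)) v =
          (\<Sum>b\<in>Basis. (frechet_derivative f (at x) v \<bullet> b) *\<^sub>R frechet_derivative g (at (f x)) b)"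
          by (simp add: euclidean_representation w_def)
      qed
      ultimately show ?thesis by (simp add: o_def[of g f])
    qed
    have fS: "diff_n n S f" using Suc.prems(1) by (rule diff_n_SucD)
    show "diff_n n S (\<lambda>x. \<Sum>b\<in>Basis. (frechet_derivative f (at x) v \<bullet> b) *\<^sub>R
        frechet_derivative g (at (f x)) b)" for v
    proof (rule diff_n_sum[OF assms(1)], rule diff_n_bilinear[OF assms(1) bounded_bilinear_scaleR])
      fix b :: 'b assume "b \<in> Basis"
      show "diff_n n S (\<lambda>x. frechet_derivative f (at x) v \<bullet> b)"
        using Suc.prems by (intro diff_n_linear[OF assms(1) bounded_linear_inner_left]) auto
      show "diff_n n S (\<lambda>x. frechet_derivative g (at (f x)) b)"
        using Suc.prems by (intro Suc.IH[of "\<lambda>y. frechet_derivative g (at y) b"] fS) auto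
    qed
  qed
qed

lemma smooth_on_const: "smooth_on S (\<lambda>x. c)"
  using smooth_on_iff_diff_n[of UNIV "\<lambda>x. c"] diff_n_const smooth_on_subset by blast

lemma smooth_on_bounded_linear: "bounded_linear L \<Longrightarrow> smooth_on S L"
proof -
  assume L: "bounded_linear L"
  have "diff_n n UNIV L" for n
  proof (cases n)
    case 0
    then show ?thesis using L by (auto simp: bounded_linear_imp_differentiable)
  next
    case (Suc k)
    show ?thesis unfolding Suc
      by (rule diff_n_SucI[where f'="\<lambda>x. L"])
        (auto intro!: diff_n_const bounded_linear_imp_has_derivative L)
  qed
  then show ?thesis using smooth_on_iff_diff_n[of UNIV L] smooth_on_subset by blast
qed

text \<open>The next rules hold on every set, as two open neighbourhoods may be intersected.\<close>

lemma smooth_on_linear_comp: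
  assumes "bounded_linear L" "smooth_on S f" shows "smooth_on S (\<lambda>x. L (f x))"
proof -
  obtain T where T: "open T" "S \<subseteq> T" "smooth_on T f" using assms(2) by (rule smooth_on_open_nbhd)
  then have "smooth_on T (\<lambda>x. L (f x))"
    using diff_n_linear[OF T(1) assms(1)] by (simp add: smooth_on_iff_diff_n)
  then show ?thesis using T(2) smooth_on_subset by blast
qed

lemma smooth_on_nbhd2:
  assumes "smooth_on S f" "smooth_on S g"
  obtains T where "open T" "S \<subseteq> T" "smooth_on T f" "smooth_on T g"
proof -
  obtain T1 where "open T1" "S \<subseteq> T1" "smooth_on T1 f" using assms(1) by (rule smooth_on_open_nbhd)
  moreover obtain T2 where "open T2" "S \<subseteq> T2" "smooth_on T2 g" using assms(2) by
    (rule smooth_on_open_nbhd)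
  ultimately show ?thesis using that[of "T1 \<inter> T2"] by (meson Int_lower1 Int_lower2 le_inf_iff
    open_Int smooth_on_subset)
qed

lemma smooth_on_add:
  assumes "smooth_on S f" "smooth_on S g" shows "smooth_on S (\<lambda>x. f x + g x)"
proof -
  obtain T where T: "open T" "S \<subseteq> T" "smooth_on T f" "smooth_on T g"
    using assms by (rule smooth_on_nbhd2)
  have "smooth_on T (\<lambda>x. f x + g x)"
    using T(3,4) unfolding smooth_on_iff_diff_n[OF T(1)] by (auto intro: diff_n_add[OF T(1)])
  then show ?thesis using T(2) by (rule smooth_on_subset)
qed

lemma smooth_on_bilinear:
  assumes "bounded_bilinear B" "smooth_on S f" "smooth_on S g" shows "smooth_on S (\<lambda>x. B (f x) (g x))"
proof -
  obtain T where T: "open T" "S \<subseteq> T" "smooth_on T f" "smooth_on T g"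
    using assms(2,3) by (rule smooth_on_nbhd2)
  have "smooth_on T (\<lambda>x. B (f x) (g x))"
    using T(3,4) unfolding smooth_on_iff_diff_n[OF T(1)] by (auto intro: diff_n_bilinear[OF T(1)
      assms(1)])
  then show ?thesis using T(2) by (rule smooth_on_subset)
qed

lemma smooth_on_compose:
  fixes f :: "'a::real_normed_vector \<Rightarrow> 'b::euclidean_space"
  assumes "smooth_on S f" "smooth_on T g" "f ` S \<subseteq> T"
  shows "smooth_on S (\<lambda>x. g (f x))"
proof -
  obtain U where U: "open U" "S \<subseteq> U" "smooth_on U f" using assms(1) by (rule smooth_on_open_nbhd)
  obtain V where V: "open V" "T \<subseteq> V" "smooth_on V g" using assms(2) by (rule smooth_on_open_nbhd)
  have "continuous_on U f" using U(3) by (rule smooth_on_continuous_on)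
  then have o: "open (U \<inter> f -` V)"
    using U(1) V(1) by (simp add: continuous_open_preimage)
  have "smooth_on (U \<inter> f -` V) (\<lambda>x. g (f x))"
    unfolding smooth_on_iff_diff_n[OF o]
  proof
    fix n
    show "diff_n n (U \<inter> f -` V) (\<lambda>x. g (f x))"
      by (rule diff_n_compose[OF o V(1)])
        (use U V smooth_on_subset[OF U(3)] smooth_on_iff_diff_n[OF o, of f]
          smooth_on_iff_diff_n[OF V(1), of g] in auto)
  qed
  moreover have "S \<subseteq> U \<inter> f -` V" using U(2) V(2) assms(3) by blast
  ultimately show ?thesis using smooth_on_subset by blast
qed

lemma smooth_on_minus: "smooth_on S f \<Longrightarrow> smooth_on S (\<lambda>x. - f x)"
  by (rule smooth_on_linear_comp[OF bounded_linear_minus[OF bounded_linear_ident]])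

lemma smooth_on_diff: "smooth_on S f \<Longrightarrow> smooth_on S g \<Longrightarrow> smooth_on S (\<lambda>x. f x - g x)"
  using smooth_on_add[of S f "\<lambda>x. - g x"] smooth_on_minus[of S g] by simp

lemma smooth_on_sum:
  "(\<And>i. i \<in> I \<Longrightarrow> smooth_on S (f i)) \<Longrightarrow> smooth_on S (\<lambda>x. \<Sum>i\<in>I. f i x)"
  by (induction I rule: infinite_finite_induct) (auto intro: smooth_on_const smooth_on_add)

lemma smooth_on_mult:
  fixes f g :: "'a::real_normed_vector \<Rightarrow> 'b::real_normed_algebra"
  shows "smooth_on S f \<Longrightarrow> smooth_on S g \<Longrightarrow> smooth_on S (\<lambda>x. f x * g x)"
  by (rule smooth_on_bilinear[OF bounded_bilinear_mult])

lemma smooth_on_scaleR: "smooth_on S f \<Longrightarrow> smooth_on S g \<Longrightarrow> smooth_on S (\<lambda>x. f x *\<^sub>R g x)"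
  by (rule smooth_on_bilinear[OF bounded_bilinear_scaleR])

lemma smooth_on_inner: "smooth_on S f \<Longrightarrow> smooth_on S g \<Longrightarrow> smooth_on S (\<lambda>x. f x \<bullet> g x)"
  by (rule smooth_on_bilinear[OF bounded_bilinear_inner])

lemma smooth_on_Pair:
  assumes "smooth_on S f" "smooth_on S g" shows "smooth_on S (\<lambda>x. (f x, g x))"
proof -
  have "smooth_on S (\<lambda>x. (f x, 0) + (0, g x))"
    using assms by (intro smooth_on_add
      smooth_on_linear_comp[where L="\<lambda>u. (u, 0)"] smooth_on_linear_comp[where L="\<lambda>u. (0, u)"]
      bounded_linear_Pair bounded_linear_ident bounded_linear_zero)
  then show ?thesis by simp
qed

lemma smooth_on_id: "smooth_on S (\<lambda>x. x)"
  by (rule smooth_on_bounded_linear[OF bounded_linear_ident])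

lemma smooth_on_fst: "smooth_on S f \<Longrightarrow> smooth_on S (\<lambda>x. fst (f x))"
  by (rule smooth_on_linear_comp[OF bounded_linear_fst])

lemma smooth_on_snd: "smooth_on S f \<Longrightarrow> smooth_on S (\<lambda>x. snd (f x))"
  by (rule smooth_on_linear_comp[OF bounded_linear_snd])

lemma smooth_on_of_real: "smooth_on S f \<Longrightarrow> smooth_on S (\<lambda>x. complex_of_real (f x))"
  by (rule smooth_on_linear_comp[OF bounded_linear_of_real])

lemma has_derivative_of_field:
  "(f has_field_derivative d) (at x) \<Longrightarrow> (f has_derivative (\<lambda>v. v * d)) (at x)"
  by (simp add: has_field_derivative_def mult.commute[of d] mult_commute_abs)

lemma smooth_on_inverse: "smooth_on (- {0}) (inverse :: 'a::real_normed_field \<Rightarrow> 'a)"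
proof -
  have "diff_n n (- {0}) (inverse :: 'a \<Rightarrow> 'a)" for n
  proof (induction n)
    case 0
    then show ?case
      by (auto simp: differentiable_def intro: has_derivative_of_field DERIV_inverse)
  next
    case (Suc n)
    show ?case
    proof (rule diff_n_SucI[where f'="\<lambda>x v. (- v) * (inverse x * inverse x)"])
      show "(inverse has_derivative (\<lambda>v. - v * (inverse x * inverse x))) (at x)"
        if "x \<in> - {0}" for x :: 'a
        using has_derivative_of_field[OF DERIV_inverse[of x]] that by (simp add: power2_eq_square)
      show "diff_n n (- {0}) (\<lambda>x::'a. - v * (inverse x * inverse x))" for v
        by (intro diff_n_linear[OF _ bounded_linear_mult_right] diff_n_bilinear[OF _
          bounded_bilinear_mult] Suc) auto
    qed auto
  qed
  then show ?thesis by (simp add: smooth_on_iff_diff_n open_delete Compl_eq_Diff_UNIV)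
qed

lemma smooth_on_sqrt: "smooth_on {0<..} sqrt"
proof -
  have inv: "diff_n n (- {0}) (inverse :: real \<Rightarrow> real)" for n
    using smooth_on_inverse[where 'a=real] smooth_on_iff_diff_n[of "- {0::real}" inverse]
    by (simp add: open_Compl)
  have "diff_n n {0<..} sqrt" for n
  proof (induction n)
    case 0
    then show ?case
      by (auto simp: differentiable_def intro: has_derivative_of_field DERIV_real_sqrt)
  next
    case (Suc n)
    show ?case
    proof (rule diff_n_SucI[where f'="\<lambda>x v. (v / 2) * inverse (sqrt x)"])
      show "(sqrt has_derivative (\<lambda>v. v / 2 * inverse (sqrt x))) (at x)" if "x \<in> {0<..}" for x
        using has_derivative_of_field[OF DERIV_real_sqrt[of x]] that by (simp add: field_simps)
      show "diff_n n {0<..} (\<lambda>x. v / 2 * inverse (sqrt x))" for v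
        by (intro diff_n_linear[OF _ bounded_linear_mult_right] diff_n_compose[OF _ _ _ Suc inv])
          (auto simp: open_delete Compl_eq_Diff_UNIV)
    qed auto
  qed
  then show ?thesis by (simp add: smooth_on_iff_diff_n)
qed

lemma smooth_on_norm:
  fixes f :: "'a::real_normed_vector \<Rightarrow> 'b::real_inner"
  assumes "smooth_on S f" "\<And>x. x \<in> S \<Longrightarrow> f x \<noteq> 0"
  shows "smooth_on S (\<lambda>x. norm (f x))"
  unfolding norm_eq_sqrt_inner
  by (rule smooth_on_compose[OF smooth_on_inner[OF assms(1) assms(1)] smooth_on_sqrt])
    (use assms(2) in auto)

lemma pderivs_add:
  assumes "open S" "smooth_on S f" "smooth_on S g" "x \<in> S"
  shows "pderivs vs (\<lambda>x. f x + g x) x = pderivs vs f x + pderivs vs g x"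
  using assms(4)
proof (induction vs arbitrary: x)
  case (Cons v vs)
  have *: "((\<lambda>x. pderivs vs f x + pderivs vs g x) has_derivative
    (\<lambda>v. frechet_derivative (pderivs vs f) (at x) v + frechet_derivative (pderivs vs g) (at x) v))
      (at x)"
    using assms Cons.prems smooth_on_pderivs_smooth[OF assms(1)]
    by (intro has_derivative_add smooth_on_has_derivative) auto
  show ?case
    using frechet_derivative_cong_open[OF assms(1) Cons.prems Cons.IH] frechet_derivative_at[OF *]
    by (simp add: fun_eq_iff)
qed simp

lemma pderivs_linear:
  assumes "open S" "bounded_linear L" "smooth_on S f" "x \<in> S"
  shows "pderivs vs (\<lambda>x. L (f x)) x = L (pderivs vs f x)"
  using assms(4)
proof (induction vs arbitrary: x)
  case (Cons v vs)
  have *: "((\<lambda>x. L (pderivs vs f x)) has_derivative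
    (\<lambda>v. L (frechet_derivative (pderivs vs f) (at x) v))) (at x)"
    using assms Cons.prems smooth_on_pderivs_smooth[OF assms(1)]
    by (intro bounded_linear.has_derivative[OF assms(2)] smooth_on_has_derivative[of S]) auto
  have "frechet_derivative (pderivs vs (\<lambda>x. L (f x))) (at x) = frechet_derivative (\<lambda>x. L
    (pderivs vs f x)) (at x)"
    using Cons.IH by (rule frechet_derivative_cong_open[OF assms(1) Cons.prems])
  also have "\<dots> = (\<lambda>v. L (frechet_derivative (pderivs vs f) (at x) v))"
    using frechet_derivative_at[OF *] by (rule sym)
  finally show ?case by (simp only: pderivs.simps)
qed simp

text \<open>Bounding the finitely many partial derivatives bounds the operator norm of the derivative uniformly
  on a compact set.\<close>

lemma smooth_derivative_bounded_on_compact: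
  fixes f :: "'a::euclidean_space \<Rightarrow> 'b::real_normed_vector"
  assumes "open D" "smooth_on D f" "compact C" "C \<subseteq> D"
  shows "\<exists>B\<ge>0. \<forall>z\<in>C. \<forall>v. norm (frechet_derivative f (at z) v) \<le> B * norm v"
proof -
  have "\<exists>B. \<forall>z\<in>C. norm (frechet_derivative f (at z) b) \<le> B" for b
  proof -
    have "continuous_on C (\<lambda>z. frechet_derivative f (at z) b)"
      using smooth_on_continuous_on[OF smooth_on_frechet[OF assms(1,2)]] assms(4)
        continuous_on_subset by blast
    then have "bounded ((\<lambda>z. frechet_derivative f (at z) b) ` C)"
      using assms(3) by (metis compact_imp_bounded compact_continuous_image)
    then show ?thesis unfolding bounded_iff by blast
  qed
  then obtain B where B: "\<And>b z. z \<in> C \<Longrightarrow> norm (frechet_derivative f (at z) b) \<le> B b" by metis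
  define B' where "B' = (\<Sum>b\<in>Basis. \<bar>B b\<bar>)"
  have "norm (frechet_derivative f (at z) v) \<le> B' * norm v" if z: "z \<in> C" for z v
  proof -
    have lin: "linear (frechet_derivative f (at z))"
      using smooth_on_has_derivative[OF assms(2)] z assms(4) has_derivative_linear by blast
    have "frechet_derivative f (at z) (\<Sum>b\<in>Basis. (v \<bullet> b) *\<^sub>R b) =
        (\<Sum>b\<in>Basis. (v \<bullet> b) *\<^sub>R frechet_derivative f (at z) b)"
      using lin by (simp add: linear_sum linear_scale)
    then have "norm (frechet_derivative f (at z) v) =
        norm (\<Sum>b\<in>Basis. (v \<bullet> b) *\<^sub>R frechet_derivative f (at z) b)"
      by (simp add: euclidean_representation)
    also have "\<dots> \<le> (\<Sum>b\<in>Basis. \<bar>B b\<bar> * norm v)"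
    proof (rule sum_norm_le)
      fix b :: 'a assume b: "b \<in> Basis"
      have "norm ((v \<bullet> b) *\<^sub>R frechet_derivative f (at z) b) \<le> norm v * \<bar>B b\<bar>"
        using Basis_le_norm[OF b, of v] B[OF z, of b] by (auto intro!: mult_mono)
      then show "norm ((v \<bullet> b) *\<^sub>R frechet_derivative f (at z) b) \<le> \<bar>B b\<bar> * norm v"
        by (simp add: mult.commute)
    qed
    finally show ?thesis by (simp add: B'_def sum_distrib_right)
  qed
  moreover have "0 \<le> B'" unfolding B'_def by (simp add: sum_nonneg)
  ultimately show ?thesis by blast
qed

lemma smooth_bounded_on_compact:
  assumes "smooth_on D f" "compact C" "C \<subseteq> D"
  shows "\<exists>B\<ge>0. \<forall>z\<in>C. norm (f z) \<le> B"
proof -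
  have "bounded (f ` C)"
    using smooth_on_continuous_on[OF smooth_on_subset[OF assms(1,3)]] assms(2)
    by (metis compact_imp_bounded compact_continuous_image)
  then obtain B where "\<forall>z\<in>C. norm (f z) \<le> B" unfolding bounded_iff by blast
  then show ?thesis by (intro exI[of _ "max B 0"]) (auto simp: le_max_iff_disj)
qed

section \<open>Differentiation under the integral sign\<close>

lemma LIMSEQ_compose_at:
  assumes "(f \<longlongrightarrow> l) (at x)" "\<And>n. X n \<noteq> x" "X \<longlonglongrightarrow> x" shows "(\<lambda>n. f (X n)) \<longlonglongrightarrow> l"
  using assms(1)
  by (rule filterlim_compose) (use assms(2,3) in \<open>simp add: filterlim_at\<close>)

text \<open>By the mean value theorem the bound on the derivative dominates the difference quotients, so that
  their integrals converge. The derivative is measurable in \<open>z\<close> as a limit of difference quotients.\<close>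

lemma has_derivative_integral_dominated:
  fixes f :: "'a::euclidean_space \<Rightarrow> 'z \<Rightarrow> 'c::{banach,second_countable_topology}"
  assumes r: "0 < r"
    and int: "\<And>x. x \<in> ball x0 r \<Longrightarrow> integrable M (f x)"
    and der: "\<And>x z. x \<in> ball x0 r \<Longrightarrow> z \<in> space M \<Longrightarrow> ((\<lambda>x. f x z) has_derivative f' x z) (at x)"
    and bound: "\<And>x z v. x \<in> ball x0 r \<Longrightarrow> z \<in> space M \<Longrightarrow> norm (f' x z v) \<le> m z * norm v"
    and m: "integrable M m"
  shows "((\<lambda>x. \<integral>z. f x z \<partial>M) has_derivative (\<lambda>v. \<integral>z. f' x0 z v \<partial>M)) (at x0)"
proof -
  have x0: "x0 \<in> ball x0 r" using r by simp
  have mpos: "0 \<le> m z" if "z \<in> space M" for z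
  proof -
    obtain b :: 'a where "b \<in> Basis" by (meson nonempty_Basis ex_in_conv)
    then show ?thesis using bound[OF x0 that, of b] norm_ge_zero[of "f' x0 z b"]
      by (simp del: norm_ge_zero)
  qed
  have diff: "norm (f x z - f x0 z) \<le> m z * norm (x - x0)" if "x \<in> ball x0 r" "z \<in> space M" for x z
  proof (rule differentiable_bound[where f'="\<lambda>x. f' x z" and S="ball x0 r"])
    show "((\<lambda>x. f x z) has_derivative f' y z) (at y within ball x0 r)" if "y \<in> ball x0 r" for y
      using der[OF that \<open>z \<in> space M\<close>] by (rule has_derivative_at_withinI)
    show "onorm (f' y z) \<le> m z" if "y \<in> ball x0 r" for y
      using mpos[OF \<open>z \<in> space M\<close>] bound[OF that \<open>z \<in> space M\<close>] by (rule onorm_bound)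
  qed (use that x0 in auto)
  have int': "integrable M (\<lambda>z. f' x0 z v)" for v
  proof (rule Bochner_Integration.integrable_bound)
    show "integrable M (\<lambda>z. m z * norm v)" using m by simp
    show "AE z in M. norm (f' x0 z v) \<le> norm (m z * norm v)"
      using bound[OF x0] mpos by (intro AE_I2) (simp add: abs_mult)
    define s where "s = r / (norm v + 1)"
    have nv: "0 < norm v + 1" using norm_ge_zero[of v] by linarith
    then have s: "0 < s" using r by (simp add: s_def)
    have sv: "s * norm v < r" using r nv by (simp add: s_def field_simps)
    define X where "X = (\<lambda>n. s / real (Suc n))"
    have X: "0 < X n" "X n \<le> s" for n using s by (auto simp: X_def field_simps)
    have Xlim: "X \<longlonglongrightarrow> 0" unfolding X_def by (rule LIMSEQ_Suc[OF lim_const_over_n])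
    show "(\<lambda>z. f' x0 z v) \<in> borel_measurable M"
    proof (rule borel_measurable_LIMSEQ_metric)
      fix n
      have "norm (X n *\<^sub>R v) \<le> s * norm v" using X[of n] by (simp add: mult_right_mono)
      then have "x0 + X n *\<^sub>R v \<in> ball x0 r" using sv by (simp add: dist_norm)
      then have "integrable M (f (x0 + X n *\<^sub>R v))" by (rule int)
      then show "(\<lambda>z. (f (x0 + X n *\<^sub>R v) z - f x0 z) /\<^sub>R X n) \<in> borel_measurable M"
        using int[OF x0] by measurable
    next
      fix z assume z: "z \<in> space M"
      have "((\<lambda>\<tau>. (f (x0 + \<tau> *\<^sub>R v) z - f x0 z) /\<^sub>R \<tau>) \<longlongrightarrow> f' x0 z v) (at 0)"
      proof -
        have "((\<lambda>\<tau>. f (x0 + \<tau> *\<^sub>R v) z) has_derivative (\<lambda>\<tau>. f' x0 z (\<tau> *\<^sub>R v))) (at 0)"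
          using der[OF x0 z]
          by (intro has_derivative_compose[of "\<lambda>\<tau>. x0 + \<tau> *\<^sub>R v" "\<lambda>\<tau>. \<tau> *\<^sub>R v" 0 UNIV "\<lambda>x. f x z"
            "f' x0 z"])
            (auto intro!: derivative_eq_intros)
        moreover have "f' x0 z (\<tau> *\<^sub>R v) = \<tau> *\<^sub>R f' x0 z v" for \<tau>
          using der[OF x0 z] has_derivative_linear linear_scale by blast
        ultimately have "((\<lambda>\<tau>. f (x0 + \<tau> *\<^sub>R v) z) has_vector_derivative f' x0 z v) (at 0)"
          by (simp add: has_vector_derivative_def)
        then have "((\<lambda>\<tau>. norm (f (x0 + \<tau> *\<^sub>R v) z - f x0 z - \<tau> *\<^sub>R f' x0 z v) / norm \<tau>) \<longlongrightarrow> 0) (at 0)"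
          by (simp add: has_vector_derivative_def has_derivative_at)
        moreover have eq: "norm (f (x0 + \<tau> *\<^sub>R v) z - f x0 z - \<tau> *\<^sub>R f' x0 z v) / norm \<tau> =
            norm ((f (x0 + \<tau> *\<^sub>R v) z - f x0 z) /\<^sub>R \<tau> - f' x0 z v)" if "\<tau> \<noteq> 0" for \<tau>
        proof -
          have "(f (x0 + \<tau> *\<^sub>R v) z - f x0 z) /\<^sub>R \<tau> - f' x0 z v =
              (f (x0 + \<tau> *\<^sub>R v) z - f x0 z - \<tau> *\<^sub>R f' x0 z v) /\<^sub>R \<tau>"
            using that by (simp add: scaleR_diff_right)
          then show ?thesis by (simp add: divide_inverse mult.commute)
        qed
        ultimately have "((\<lambda>\<tau>. norm ((f (x0 + \<tau> *\<^sub>R v) z - f x0 z) /\<^sub>R \<tau> - f' x0 z v)) \<longlongrightarrow> 0) (at 0)"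
          using eq by (elim Lim_transform_eventually) (simp add: eventually_at_filter)
        then have "((\<lambda>\<tau>. (f (x0 + \<tau> *\<^sub>R v) z - f x0 z) /\<^sub>R \<tau> - f' x0 z v) \<longlongrightarrow> 0) (at 0)"
          by (rule tendsto_norm_zero_cancel)
        then show ?thesis by (rule LIM_zero_cancel)
      qed
      then show "(\<lambda>n. (f (x0 + X n *\<^sub>R v) z - f x0 z) /\<^sub>R X n) \<longlonglongrightarrow> f' x0 z v"
        using less_imp_neq[OF X(1), symmetric] Xlim by (rule LIMSEQ_compose_at)
    qed
  qed
  show "((\<lambda>x. \<integral>z. f x z \<partial>M) has_derivative (\<lambda>v. \<integral>z. f' x0 z v \<partial>M)) (at x0)"
    unfolding has_derivative_at
  proof
    have lin: "linear (f' x0 z)" if "z \<in> space M" for z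
      using der[OF x0 that] by (rule has_derivative_linear)
    have "linear (\<lambda>v. \<integral>z. f' x0 z v \<partial>M)"
    proof
      show "(\<integral>z. f' x0 z (a + b) \<partial>M) = (\<integral>z. f' x0 z a \<partial>M) + (\<integral>z. f' x0 z b \<partial>M)" for a b
        using linear_add[OF lin]
        by (subst Bochner_Integration.integral_add[OF int' int', symmetric])
          (auto intro: Bochner_Integration.integral_cong)
      show "(\<integral>z. f' x0 z (c *\<^sub>R a) \<partial>M) = c *\<^sub>R (\<integral>z. f' x0 z a \<partial>M)" for a c
      proof -
        have "(\<integral>z. f' x0 z (c *\<^sub>R a) \<partial>M) = (\<integral>z. c *\<^sub>R f' x0 z a \<partial>M)"
          using linear_scale[OF lin] by (intro Bochner_Integration.integral_cong) auto
        then show ?thesis by simp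
      qed
    qed
    then show "bounded_linear (\<lambda>v. \<integral>z. f' x0 z v \<partial>M)"
      by (simp add: linear_conv_bounded_linear)
    show "((\<lambda>h. norm ((\<integral>z. f (x0 + h) z \<partial>M) - (\<integral>z. f x0 z \<partial>M) - (\<integral>z. f' x0 z h \<partial>M)) / norm h)
        \<longlongrightarrow> 0) (at 0)"
      unfolding tendsto_at_iff_sequentially o_def
    proof (intro allI impI)
      fix X :: "nat \<Rightarrow> 'a"
      assume ne: "\<forall>i. X i \<in> UNIV - {0}" and lim: "X \<longlonglongrightarrow> 0"
      obtain N where N: "\<And>n. n \<ge> N \<Longrightarrow> norm (X n) < r"
        using lim r unfolding LIMSEQ_iff by auto
      define Y where "Y = (\<lambda>n. X (n + N))"
      have Y: "Y n \<noteq> 0" "x0 + Y n \<in> ball x0 r" for n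
        using ne N[of "n + N"] by (auto simp: Y_def dist_norm)
      have Ylim: "Y \<longlonglongrightarrow> 0" unfolding Y_def using lim by (rule LIMSEQ_ignore_initial_segment)
      define e where "e = (\<lambda>n z. (f (x0 + Y n) z - f x0 z - f' x0 z (Y n)) /\<^sub>R norm (Y n))"
      have "(\<lambda>n. \<integral>z. e n z \<partial>M) \<longlonglongrightarrow> (\<integral>z. 0 \<partial>M)"
      proof (rule integral_dominated_convergence[where w="\<lambda>z. 2 * m z"])
        show "e n \<in> borel_measurable M" for n
          unfolding e_def using int[OF Y(2)] int[OF x0] int'[of "Y n"] by measurable
        show "AE z in M. (\<lambda>n. e n z) \<longlonglongrightarrow> 0"
        proof (rule AE_I2)
          fix z assume "z \<in> space M"
          from der[OF x0 this] have
            "((\<lambda>h. norm (f (x0 + h) z - f x0 z - f' x0 z h) / norm h) \<longlongrightarrow> 0) (at 0)"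
            unfolding has_derivative_at by blast
          then have "(\<lambda>n. norm (f (x0 + Y n) z - f x0 z - f' x0 z (Y n)) / norm (Y n)) \<longlonglongrightarrow> 0"
            using Y(1) Ylim by (rule LIMSEQ_compose_at)
          then have "(\<lambda>n. norm (e n z)) \<longlonglongrightarrow> 0"
            by (simp add: e_def divide_inverse mult.commute)
          then show "(\<lambda>n. e n z) \<longlonglongrightarrow> 0" by (rule tendsto_norm_zero_cancel)
        qed
        show "AE z in M. norm (e n z) \<le> 2 * m z" for n
        proof (rule AE_I2)
          fix z assume z: "z \<in> space M"
          have "norm (f (x0 + Y n) z - f x0 z - f' x0 z (Y n))
              \<le> norm (f (x0 + Y n) z - f x0 z) + norm (f' x0 z (Y n))"
            by (rule norm_triangle_ineq4)
          also have "\<dots> \<le> m z * norm (Y n) + m z * norm (Y n)"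
            using diff[OF Y(2) z, of n] bound[OF x0 z] by (intro add_mono) auto
          finally have "norm (f (x0 + Y n) z - f x0 z - f' x0 z (Y n)) \<le> 2 * m z * norm (Y n)"
            by simp
          moreover have "norm (e n z) = norm (f (x0 + Y n) z - f x0 z - f' x0 z (Y n)) / norm (Y n)"
            by (simp add: e_def divide_inverse mult.commute)
          ultimately show "norm (e n z) \<le> 2 * m z"
            using Y(1)[of n] by (simp add: pos_divide_le_eq)
        qed
      qed (use m in auto)
      then have "(\<lambda>n. norm (\<integral>z. e n z \<partial>M)) \<longlonglongrightarrow> 0" by (simp add: tendsto_norm_zero)
      moreover have eq: "(\<integral>z. e n z \<partial>M) =
          ((\<integral>z. f (x0 + Y n) z \<partial>M) - (\<integral>z. f x0 z \<partial>M) - (\<integral>z. f' x0 z (Y n) \<partial>M)) /\<^sub>R norm (Y n)" for n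
        unfolding e_def using int[OF Y(2)] int[OF x0] int' by simp
      ultimately have "(\<lambda>n. norm ((\<integral>z. f (x0 + Y n) z \<partial>M) - (\<integral>z. f x0 z \<partial>M)
          - (\<integral>z. f' x0 z (Y n) \<partial>M)) / norm (Y n)) \<longlonglongrightarrow> 0"
        by (simp add: divide_inverse mult.commute)
      then show "(\<lambda>n. norm ((\<integral>z. f (x0 + X n) z \<partial>M) - (\<integral>z. f x0 z \<partial>M)
          - (\<integral>z. f' x0 z (X n) \<partial>M)) / norm (X n)) \<longlonglongrightarrow> 0"
        unfolding Y_def by (rule LIMSEQ_offset)
    qed
  qed
qed

lemma integrable_continuous_compact_support:
  fixes f :: "'a::euclidean_space \<Rightarrow> 'b::{banach,second_countable_topology}"
  assumes "compact K" "continuous_on K f" "\<And>x. x \<notin> K \<Longrightarrow> f x = 0"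
  shows "integrable lborel f"
proof -
  have "(\<lambda>x. indicator K x *\<^sub>R f x) = f" using assms(3) by (auto simp: indicator_def)
  then show ?thesis using borel_integrable_compact[OF assms(1,2)] by simp
qed

lemma integrable_indicator_compact:
  "compact K \<Longrightarrow> integrable lborel (indicator K :: 'a::euclidean_space \<Rightarrow> real)"
  using borel_integrable_compact[of K "\<lambda>_. 1::real"] by simp

text \<open>The integrals of the translates \<open>z \<mapsto> \<Psi> (z + h e)\<close> do not depend on \<open>h\<close>; differentiating at
  \<open>h = 0\<close> under the integral sign gives the claim, and this replaces integration by parts. Derivatives
  are taken only along the lines of direction \<open>e\<close>, as the amplitudes below may be merely continuous in
  the other variables.\<close>

lemma integral_directional_derivative_eq_0:
  fixes \<Psi> :: "'e::euclidean_space \<Rightarrow> 'b::{banach,second_countable_topology}"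
  assumes K: "compact K" "\<And>z. z \<notin> K \<Longrightarrow> \<Psi> z = 0" "\<And>z. z \<notin> K \<Longrightarrow> D z = 0"
    and cont: "continuous_on K \<Psi>" "continuous_on K D"
    and der: "\<And>z h. ((\<lambda>h. \<Psi> (z + h *\<^sub>R e)) has_vector_derivative D (z + h *\<^sub>R e)) (at h)"
  shows "(LINT z|lborel. D z) = 0"
proof -
  obtain B where B: "\<And>z. z \<in> K \<Longrightarrow> norm (D z) \<le> B"
    using compact_imp_bounded[OF compact_continuous_image[OF cont(2) K(1)]]
    by (auto simp: bounded_iff)
  define B' where "B' = max B 0"
  have B': "norm (D z) \<le> B'" "0 \<le> B'" for z
    using B[of z] K(3)[of z] by (cases "z \<in> K"; auto simp: B'_def)+
  define K' where "K' = (\<lambda>(z, h). z - h *\<^sub>R e) ` (K \<times> {-1..1::real})"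
  have K': "compact K'" unfolding K'_def
    unfolding case_prod_beta
    by (intro compact_continuous_image compact_Times K compact_Icc continuous_intros)
  have transl: "(LINT z|lborel. \<Psi> (z + h *\<^sub>R e)) = (LINT z|lborel. \<Psi> z)" for h :: real
  proof -
    have "integrable lborel \<Psi>" using K(1) cont(1) K(2) by (rule integrable_continuous_compact_support)
    then have meas: "\<Psi> \<in> borel_measurable borel" by simp
    have "(LINT z|lborel. \<Psi> z) = (LINT z|distr lborel borel ((+) (h *\<^sub>R e)). \<Psi> z)"
      by (simp add: lborel_distr_plus)
    also have "\<dots> = (LINT z|lborel. \<Psi> (h *\<^sub>R e + z))"
      using meas by (intro integral_distr) auto
    finally show ?thesis by (simp add: add.commute)
  qed
  have "((\<lambda>h::real. LINT z|lborel. \<Psi> (z + h *\<^sub>R e)) has_derivative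
      (\<lambda>v. LINT z|lborel. v *\<^sub>R D (z + 0 *\<^sub>R e))) (at 0)"
  proof (rule has_derivative_integral_dominated[where r=1 and m="\<lambda>z. B' * indicator K' z"])
    fix h :: real
    let ?K = "(\<lambda>z. z - h *\<^sub>R e) ` K"
    show "integrable lborel (\<lambda>z. \<Psi> (z + h *\<^sub>R e))"
    proof (rule integrable_continuous_compact_support)
      show "compact ?K" by (intro compact_continuous_image K continuous_intros)
      show "continuous_on ?K (\<lambda>z. \<Psi> (z + h *\<^sub>R e))"
        by (intro continuous_on_compose2[OF cont(1)] continuous_intros) auto
      show "\<Psi> (z + h *\<^sub>R e) = 0" if "z \<notin> ?K" for z
        using that by (intro K(2)) (auto simp: image_iff)
    qed
    fix z
    show "((\<lambda>h. \<Psi> (z + h *\<^sub>R e)) has_derivative (\<lambda>v. v *\<^sub>R D (z + h *\<^sub>R e))) (at h)"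
      using der by (simp add: has_vector_derivative_def)
    fix v :: real
    assume h: "h \<in> ball 0 1"
    show "norm (v *\<^sub>R D (z + h *\<^sub>R e)) \<le> B' * indicator K' z * norm v"
    proof (cases "z + h *\<^sub>R e \<in> K")
      case True
      then have "z \<in> K'" unfolding K'_def using h
        by (intro image_eqI[of _ _ "(z + h *\<^sub>R e, h)"]) auto
      then show ?thesis using mult_right_mono[OF B'(1)[of "z + h *\<^sub>R e"], of "\<bar>v\<bar>"]
        by (simp add: mult.commute)
    next
      case False
      then show ?thesis using B'(2) by (simp add: K(3))
    qed
  next
    show "integrable lborel (\<lambda>z. B' * indicator K' z)"
      using K' by (intro integrable_mult_right integrable_indicator_compact)
  qed simp
  then have "((\<lambda>h::real. LINT z|lborel. \<Psi> z) has_derivative (\<lambda>v. LINT z|lborel. v *\<^sub>R D z)) (at 0)"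
    by (simp add: transl)
  then have "(\<lambda>v::real. LINT z|lborel. v *\<^sub>R D z) = (\<lambda>v. 0)"
    using has_derivative_unique has_derivative_const by blast
  from fun_cong[OF this, of 1] show ?thesis by simp
qed

section \<open>Cutoff functions\<close>

text \<open>The derivative of \<open>x\<^sup>-\<^sup>k exp (-1/x)\<close> is a combination of functions of the same kind, so the whole
  family is smooth as soon as each member is differentiable at \<open>0\<close> with derivative \<open>0\<close>.\<close>

definition flat :: "nat \<Rightarrow> real \<Rightarrow> real" where
  "flat k x = (if x \<le> 0 then 0 else inverse x ^ k * exp (- inverse x))"

text \<open>One term of the exponential series, \<open>u\<^sup>k\<^sup>+\<^sup>2 / (k + 2)! \<le> exp u\<close> with \<open>u = 1/x\<close>, gives enough decay for
  a vanishing derivative at \<open>0\<close>.\<close>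

lemma flat_le_square: "\<bar>flat k x\<bar> \<le> fact (k + 2) * x\<^sup>2"
proof (cases "x \<le> 0")
  case False
  define u where "u = inverse x"
  have u: "0 < u" using False by (simp add: u_def)
  have "u ^ (k + 2) / fact (k + 2) = (\<Sum>n\<in>{k + 2}. u ^ n /\<^sub>R fact n)"
    by (simp add: divide_inverse mult.commute del: fact_Suc)
  also have "\<dots> \<le> (\<Sum>n. u ^ n /\<^sub>R fact n)"
    using u by (intro sum_le_suminf summable_exp_generic) auto
  also have "\<dots> = exp u" by (simp add: exp_def)
  finally have "u ^ k * exp (- u) \<le> fact (k + 2) * inverse (u\<^sup>2)"
    using u by (simp add: exp_minus field_simps power_add power2_eq_square del: fact_Suc)
  then show ?thesis using False by (simp add: flat_def u_def power_inverse del: fact_Suc)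
qed (simp add: flat_def)

lemma flat_has_derivative:
  "(flat k has_derivative (\<lambda>v. v * (flat (k + 2) x - real k * flat (k + 1) x))) (at x)"
proof -
  consider "x < 0" | "x = 0" | "x > 0" by linarith
  then show ?thesis
  proof cases
    case 1
    have "((\<lambda>_. 0) has_derivative (\<lambda>v. 0)) (at x)" by simp
    then have "(flat k has_derivative (\<lambda>v. 0)) (at x)"
      by (subst has_derivative_cong_open[where S="{..<0}" and g="\<lambda>_. 0"]) (use 1
        in \<open>auto simp: flat_def\<close>)
    then show ?thesis using 1 by (simp add: flat_def)
  next
    case 2
    have "(flat k has_derivative (\<lambda>v. 0)) (at 0)"
      unfolding has_derivative_at
    proof
      have "((\<lambda>h::real. fact (k + 2) * \<bar>h\<bar>) \<longlongrightarrow> fact (k + 2) * \<bar>0\<bar>) (at 0)"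
        by (intro tendsto_intros)
      then have lim: "((\<lambda>h::real. fact (k + 2) * \<bar>h\<bar>) \<longlongrightarrow> 0) (at 0)" by simp
      show "((\<lambda>h. norm (flat k (0 + h) - flat k 0 - 0) / norm h) \<longlongrightarrow> 0) (at 0)"
      proof (rule tendsto_sandwich[OF _ _ tendsto_const lim])
        have "norm (flat k (0 + h) - flat k 0 - 0) / norm h \<le> fact (k + 2) * \<bar>h\<bar>" for h
          using flat_le_square[of k h]
          by (cases "h = 0") (simp_all add: flat_def[of k 0] divide_le_eq power2_eq_square mult.assoc)
        then show "\<forall>\<^sub>F h in at 0. norm (flat k (0 + h) - flat k 0 - 0) / norm h \<le> fact (k + 2) * \<bar>h\<bar>"
          by simp
      qed simp
    qed simp
    then show ?thesis using 2 by (simp add: flat_def)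
  next
    case 3
    have "((\<lambda>x. inverse x ^ k * exp (- inverse x)) has_field_derivative
        flat (k + 2) x - real k * flat (k + 1) x) (at x)"
    proof -
      have "((\<lambda>x. inverse x ^ k * exp (- inverse x)) has_field_derivative
        real k * (- (inverse x ^ Suc (Suc 0)) * inverse x ^ (k - Suc 0)) * exp (- inverse x)
          + exp (- inverse x) * inverse x ^ Suc (Suc 0) * inverse x ^ k) (at x)"
        using 3 by (auto intro!: derivative_eq_intros)
      then show ?thesis using 3 by (cases k) (simp_all add: flat_def algebra_simps)
    qed
    then have "((\<lambda>x. inverse x ^ k * exp (- inverse x)) has_derivative
        (\<lambda>v. v * (flat (k + 2) x - real k * flat (k + 1) x))) (at x)"
      by (rule has_derivative_of_field)
    then show ?thesis
      by (subst has_derivative_cong_open[where S="{0<..}" and g="\<lambda>x. inverse x ^ k * exp (- inverse x)"])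
        (use 3 in \<open>auto simp: flat_def\<close>)
  qed
qed

lemma smooth_on_flat: "smooth_on UNIV (flat k)"
proof -
  have "diff_n n UNIV (flat k)" for n
  proof (induction n arbitrary: k)
    case 0
    show ?case using flat_has_derivative by (auto simp: differentiable_def)
  next
    case (Suc n)
    show ?case
    proof (rule diff_n_SucI[OF _ flat_has_derivative])
      have "diff_n n UNIV (\<lambda>x. flat (k + 2) x + (- real k) * flat (k + 1) x)"
        by (intro diff_n_add diff_n_linear[OF _ bounded_linear_mult_right] Suc) auto
      then show "diff_n n UNIV (\<lambda>x. v * (flat (k + 2) x - real k * flat (k + 1) x))" for v
        by (intro diff_n_linear[OF _ bounded_linear_mult_right]) auto
    qed simp
  qed
  then show ?thesis by (simp add: smooth_on_iff_diff_n)
qed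

lemma cutoff_exists: "\<exists>\<rho>. test_fun UNIV \<rho> \<and> \<rho> (0::real) = 1"
proof -
  define \<rho> :: "real \<Rightarrow> complex" where "\<rho> = (\<lambda>x. complex_of_real (exp 1 * flat 0 (1 - x * x)))"
  have "smooth_on UNIV \<rho>" unfolding \<rho>_def
    by (intro smooth_on_of_real smooth_on_mult smooth_on_const smooth_on_compose[OF _ smooth_on_flat]
      smooth_on_diff smooth_on_id) auto
  moreover have "\<rho> x = 0" if "x \<notin> {-1..1}" for x
  proof -
    have "1 < \<bar>x\<bar>" using that by auto
    then have "1 < x\<^sup>2" by (metis abs_1 abs_square_le_1 linorder_not_le)
    then show ?thesis by (simp add: \<rho>_def flat_def power2_eq_square)
  qed
  moreover have "\<rho> 0 = 1" by (simp add: \<rho>_def flat_def exp_minus)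
  ultimately show ?thesis unfolding test_fun_def
    by (intro exI[of _ \<rho>] conjI exI[of _ "{-1..1}"]) auto
qed

text \<open>For the smooth step \<open>s\<close> from \<open>0\<close> on the negative axis to \<open>1\<close> on \<open>[1, \<infinity>)\<close>, the function
  \<open>x (s x - s (- x))\<close> agrees with \<open>\<bar>x\<bar>\<close> outside the unit interval.\<close>

lemma smooth_abs_exists: "\<exists>h::real \<Rightarrow> real. smooth_on UNIV h \<and> (\<forall>x. 1 \<le> \<bar>x\<bar> \<longrightarrow> h x = \<bar>x\<bar>)"
proof -
  define s where "s x = flat 0 x * inverse (flat 0 x + flat 0 (1 - x))" for x
  define h where "h x = x * (s x - s (- x))" for x
  have pos: "flat 0 x + flat 0 (1 - x) \<noteq> 0" for x
  proof -
    have "0 < flat 0 x + flat 0 (1 - x)"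
      by (cases "x \<le> 0") (auto simp: flat_def intro!: add_pos_pos)
    then show ?thesis by simp
  qed
  have s: "smooth_on UNIV s" unfolding s_def using pos
    by (intro smooth_on_mult smooth_on_flat smooth_on_compose[OF _ smooth_on_inverse] smooth_on_add
      smooth_on_compose[OF _ smooth_on_flat] smooth_on_diff smooth_on_id smooth_on_const) auto
  have "smooth_on UNIV h" unfolding h_def
    by (intro smooth_on_mult smooth_on_id smooth_on_diff s smooth_on_compose[OF _ s]
      smooth_on_minus) auto
  moreover have s01: "x \<le> 0 \<Longrightarrow> s x = 0" "1 \<le> x \<Longrightarrow> s x = 1" for x
    by (auto simp: s_def flat_def)
  have "h x = \<bar>x\<bar>" if "1 \<le> \<bar>x\<bar>" for x
    using that s01[of x] s01[of "- x"] by (cases "x \<ge> 0") (auto simp: h_def)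
  ultimately show ?thesis by blast
qed

section \<open>Symbols of order one\<close>

lemma pderivs_real_identity:
  "pderivs \<beta> (\<lambda>x::real. x) = (case \<beta> of [] \<Rightarrow> (\<lambda>x. x) | d # ds \<Rightarrow> if ds = [] then (\<lambda>x. d) else (\<lambda>x. 0))"
proof (induction \<beta>)
  case (Cons d ds)
  have "frechet_derivative (\<lambda>x::real. x) (at x) = (\<lambda>x. x)" for x
    by (rule frechet_derivative_at[symmetric]) simp
  moreover have "frechet_derivative (\<lambda>x::real. c::real) (at x) = (\<lambda>x. 0)" for c x
    by (rule frechet_derivative_at[symmetric]) simp
  ultimately show ?case using Cons.IH by (auto split: list.splits)
qed simp

text \<open>Outside the unit interval the function is \<open>\<plusminus>x\<close>, with explicit derivatives; on the unit interval
  continuity suffices.\<close>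

lemma smooth_abs_symbol_estimate:
  fixes h :: "real \<Rightarrow> real"
  assumes smooth: "smooth_on UNIV h" and h: "\<And>x. 1 \<le> \<bar>x\<bar> \<Longrightarrow> h x = \<bar>x\<bar>"
  shows "\<exists>C. \<forall>x. \<bar>pderivs \<beta> h x\<bar> \<le> C * (1 + \<bar>x\<bar>) powr (1 - real (length \<beta>))"
proof -
  define P where "P x = (1 + \<bar>x\<bar>) powr (1 - real (length \<beta>))" for x :: real
  have Ppos: "0 < P x" for x by (simp add: P_def)
  define D where "D = (case \<beta> of [] \<Rightarrow> 1 | d # _ \<Rightarrow> \<bar>d\<bar>)"
  have id: "\<bar>pderivs \<beta> (\<lambda>x. x) x\<bar> \<le> D * P x" for x
    by (cases \<beta>) (auto simp: pderivs_real_identity D_def P_def)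
  have out: "\<bar>pderivs \<beta> h x\<bar> \<le> D * P x" if "1 < \<bar>x\<bar>" for x
  proof (cases "x > 0")
    case True
    have "pderivs \<beta> h x = pderivs \<beta> (\<lambda>x. x) x"
      by (rule pderivs_cong_open[of "{1<..}"]) (use True that h in auto)
    then show ?thesis using id by simp
  next
    case False
    have "pderivs \<beta> h x = pderivs \<beta> (\<lambda>x. - x) x"
      by (rule pderivs_cong_open[of "{..<-1}"]) (use False that h in auto)
    also have "\<dots> = - pderivs \<beta> (\<lambda>x. x) x"
      by (rule pderivs_linear[OF open_UNIV bounded_linear_minus[OF bounded_linear_ident]
        smooth_on_id UNIV_I])
    finally show ?thesis using id by simp
  qed
  have "continuous_on {-1..1} (\<lambda>x. pderivs \<beta> h x / P x)"
    unfolding P_def using smooth_on_continuous_on[OF smooth_on_pderivs_smooth[OF open_UNIV smooth, of \<beta>]]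
    by (intro continuous_intros) (auto intro: continuous_on_subset)
  then have "bounded ((\<lambda>x. pderivs \<beta> h x / P x) ` {-1..1})"
    by (intro compact_imp_bounded compact_continuous_image compact_Icc)
  then obtain B where B: "\<And>x. x \<in> {-1..1} \<Longrightarrow> \<bar>pderivs \<beta> h x / P x\<bar> \<le> B"
    unfolding bounded_iff real_norm_def by blast
  have "\<bar>pderivs \<beta> h x\<bar> \<le> max B D * P x" for x
  proof (cases "\<bar>x\<bar> \<le> 1")
    case True
    then have "\<bar>pderivs \<beta> h x\<bar> \<le> B * P x"
      using B[of x] Ppos[of x] by (simp add: abs_le_iff field_simps)
    also have "\<dots> \<le> max B D * P x" using Ppos[of x] by (intro mult_right_mono) auto
    finally show ?thesis .
  next
    case False
    then have "\<bar>pderivs \<beta> h x\<bar> \<le> D * P x" using out[of x] by simp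
    also have "\<dots> \<le> max B D * P x" using Ppos[of x] by (intro mult_right_mono) auto
    finally show ?thesis .
  qed
  then show ?thesis unfolding P_def by blast
qed

lemma frechet_product_of_real:
  fixes P :: "'u::real_normed_vector \<times> 'v::real_normed_vector \<Rightarrow> complex" and g :: "real \<Rightarrow> real"
  assumes "P differentiable (at (u, v))" "g differentiable (at \<theta>)"
  shows "frechet_derivative (\<lambda>(u, v, \<theta>). P (u, v) * complex_of_real (g \<theta>)) (at (u, v, \<theta>)) (b, c, d) =
    P (u, v) * complex_of_real (frechet_derivative g (at \<theta>) d)
      + frechet_derivative P (at (u, v)) (b, c) * complex_of_real (g \<theta>)"
proof -
  have P: "((\<lambda>z. P (fst z, fst (snd z))) has_derivative (\<lambda>z. frechet_derivative P (at (u, v))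
    (fst z, fst (snd z)))) (at (u, v, \<theta>))"
    by (rule has_derivative_compose[of "\<lambda>z. (fst z, fst (snd z))" "\<lambda>z. (fst z, fst (snd z))" "(u, v,
      \<theta>)" UNIV P])
      (use has_derivative_frechet[OF assms(1)] in \<open>auto intro!: has_derivative_Pair
        has_derivative_fst has_derivative_snd has_derivative_ident\<close>)
  have g: "((\<lambda>z. g (snd (snd z))) has_derivative (\<lambda>z. frechet_derivative g (at \<theta>) (snd (snd z))))
    (at (u, v, \<theta>))"
    by (rule has_derivative_compose[of "\<lambda>z. snd (snd z)" "\<lambda>z. snd (snd z)" "(u, v, \<theta>)" UNIV g])
      (use has_derivative_frechet[OF assms(2)] in \<open>auto intro!: has_derivative_snd has_derivative_ident\<close>)
  show ?thesis
    using frechet_derivative_at[OF has_derivative_mult[OF P bounded_linear.has_derivative[OF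
      bounded_linear_of_real g]],
        THEN fun_cong, of "(b, c, d)"]
    by (simp add: case_prod_beta')
qed

text \<open>For an amplitude of product form, derivatives in the frequency and in the base variables
  separate.\<close>

lemma pderivs_product_amplitude:
  fixes P :: "'u::real_normed_vector \<times> 'v::real_normed_vector \<Rightarrow> complex" and h :: "real \<Rightarrow> real"
  assumes D: "open D" and P: "smooth_on D P" and h: "smooth_on UNIV h" and "(u, v) \<in> D"
  shows "pderivs (map (\<lambda>(b, c). (b, c, 0)) \<alpha> @ map (\<lambda>d. (0, 0, d)) \<beta>) (\<lambda>(u, v, \<theta>). P (u, v)
    * complex_of_real (h \<theta>)) (u, v, \<theta>)
    = pderivs \<alpha> P (u, v) * complex_of_real (pderivs \<beta> h \<theta>)"
proof -
  let ?S = "{z. (fst z, fst (snd z)) \<in> D}"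
  have S: "open ?S"
    using open_vimage[OF D, of "\<lambda>z. (fst z, fst (snd z))"] by (simp add: vimage_def continuous_intros)
  have freq: "pderivs (map (\<lambda>d. (0, 0, d)) \<beta>) (\<lambda>(u, v, \<theta>). P (u, v) * complex_of_real (h \<theta>)) z
    = (\<lambda>(u, v, \<theta>). P (u, v) * complex_of_real (pderivs \<beta> h \<theta>)) z" if "z \<in> ?S" for z
    using that
  proof (induction \<beta> arbitrary: z)
    case (Cons d \<beta>)
    obtain u v \<theta> where z: "z = (u, v, \<theta>)" by (metis surj_pair)
    have "linear (frechet_derivative P (at (u, v)))"
      using Cons.prems smooth_on_differentiable[OF P] by (intro linear_frechet_derivative) (simp add: z)
    then have "frechet_derivative P (at (u, v)) (0, 0) = 0" by (simp add: linear_0 flip: zero_prod_def)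
    then show ?case
      using frechet_derivative_cong_open[OF S Cons.prems Cons.IH]
        frechet_product_of_real[OF smooth_on_differentiable[OF P] smooth_on_differentiable[OF
          smooth_on_pderivs_smooth[OF open_UNIV h]],
          of u v \<theta> \<beta> 0 0 d] Cons.prems
      by (simp add: z)
  qed auto
  have base: "pderivs (map (\<lambda>(b, c). (b, c, 0)) \<alpha>) (\<lambda>(u, v, \<theta>). P (u, v) * complex_of_real (g \<theta>)) z
    = (\<lambda>(u, v, \<theta>). pderivs \<alpha> P (u, v) * complex_of_real (g \<theta>)) z"
    if "z \<in> ?S" "\<And>\<theta>. g differentiable (at \<theta>)" for z and g :: "real \<Rightarrow> real"
    using that(1)
  proof (induction \<alpha> arbitrary: z)
    case (Cons bc \<alpha>)
    obtain u v \<theta> where z: "z = (u, v, \<theta>)" by (metis surj_pair)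
    obtain b c where bc: "bc = (b, c)" by (metis surj_pair)
    have uv: "(u, v) \<in> D" using Cons.prems by (simp add: z)
    have "frechet_derivative g (at \<theta>) 0 = 0" using linear_frechet_derivative[OF that(2)] linear_0 by
      blast
    then have prod: "frechet_derivative (\<lambda>(u, v, \<theta>). pderivs \<alpha> P (u, v) * complex_of_real (g \<theta>)) (at
      (u, v, \<theta>)) (b, c, 0)
        = frechet_derivative (pderivs \<alpha> P) (at (u, v)) (b, c) * complex_of_real (g \<theta>)"
      by (simp add: frechet_product_of_real[OF smooth_on_differentiable[OF
        smooth_on_pderivs_smooth[OF D P] uv] that(2)])
    have "frechet_derivative (pderivs (map (\<lambda>(b, c). (b, c, 0)) \<alpha>) (\<lambda>(u, v, \<theta>). P (u, v)
      * complex_of_real (g \<theta>))) (at z)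
        = frechet_derivative (\<lambda>(u, v, \<theta>). pderivs \<alpha> P (u, v) * complex_of_real (g \<theta>)) (at z)"
      by (rule frechet_derivative_cong_open[OF S Cons.prems Cons.IH])
    then show ?case by (simp only: list.map case_prod_conv pderivs.simps z bc prod)
  qed auto
  have "pderivs (map (\<lambda>(b, c). (b, c, 0)) \<alpha> @ map (\<lambda>d. (0, 0, d)) \<beta>) (\<lambda>(u, v, \<theta>). P (u, v)
    * complex_of_real (h \<theta>)) (u, v, \<theta>)
    = pderivs (map (\<lambda>(b, c). (b, c, 0)) \<alpha>) (\<lambda>(u, v, \<theta>). P (u, v) * complex_of_real (pderivs \<beta> h \<theta>))
      (u, v, \<theta>)"
    unfolding pderivs_append using assms(4) by (intro pderivs_cong_open[OF S] freq) auto
  then show ?thesis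
    using base[of "(u, v, \<theta>)" "pderivs \<beta> h"] assms(4) smooth_on_differentiable[OF
      smooth_on_pderivs_smooth[OF open_UNIV h]]
    by simp
qed

lemma symbol_amplitude_product:
  fixes P :: "'u::euclidean_space \<times> 'v::euclidean_space \<Rightarrow> complex" and h :: "real \<Rightarrow> real"
  assumes D: "open D" "U \<times> V \<subseteq> D" and P: "smooth_on D P"
    and h: "smooth_on UNIV h" "\<And>x. 1 \<le> \<bar>x\<bar> \<Longrightarrow> h x = \<bar>x\<bar>"
  shows "symbol_amplitude U V 1 (\<lambda>(u, v, \<theta>). P (u, v) * complex_of_real (h \<theta>))"
  unfolding symbol_amplitude_def
proof (intro conjI allI impI)
  have "smooth_on (U \<times> V \<times> UNIV) (\<lambda>z. P (fst z, fst (snd z)) * complex_of_real (h (snd (snd z))))"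
    by (intro smooth_on_mult smooth_on_of_real smooth_on_compose[OF _ P] smooth_on_compose[OF _ h(1)]
        smooth_on_Pair smooth_on_fst smooth_on_snd smooth_on_id) (use D in auto)
  then show "smooth_on (U \<times> V \<times> UNIV) (\<lambda>(u, v, \<theta>). P (u, v) * complex_of_real (h \<theta>))"
    by (simp add: case_prod_beta')
  fix K :: "('u \<times> 'v) set" and \<alpha> and \<beta> :: "real list"
  assume "compact K \<and> K \<subseteq> U \<times> V"
  then have K: "compact K" "K \<subseteq> D" using D by auto
  obtain B where B: "0 \<le> B" "\<And>z. z \<in> K \<Longrightarrow> norm (pderivs \<alpha> P z) \<le> B"
    using smooth_bounded_on_compact[OF smooth_on_pderivs_smooth[OF D(1) P] K] by blast
  obtain C where C: "\<And>x. \<bar>pderivs \<beta> h x\<bar> \<le> C * (1 + \<bar>x\<bar>) powr (1 - real (length \<beta>))"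
    using smooth_abs_symbol_estimate[OF h] by blast
  show "\<exists>C. \<forall>(u, v)\<in>K. \<forall>\<theta>. norm (pderivs (map (\<lambda>(b, c). (b, c, 0)) \<alpha> @ map (\<lambda>d. (0, 0, d)) \<beta>)
      (\<lambda>(u, v, \<theta>). P (u, v) * complex_of_real (h \<theta>)) (u, v, \<theta>)) \<le> C * (1 + norm \<theta>) powr (1 - real
        (length \<beta>))"
  proof (rule exI[of _ "B * C"], clarify)
    fix u v \<theta> assume uv: "(u, v) \<in> K"
    have "norm (pderivs \<alpha> P (u, v) * complex_of_real (pderivs \<beta> h \<theta>)) \<le> B * (C * (1 + \<bar>\<theta>\<bar>) powr
      (1 - real (length \<beta>)))"
      using B C[of \<theta>] uv by (auto simp: norm_mult intro!: mult_mono)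
    moreover have "(u, v) \<in> D" using uv K by blast
    ultimately show "norm (pderivs (map (\<lambda>(b, c). (b, c, 0)) \<alpha> @ map (\<lambda>d. (0, 0, d)) \<beta>)
      (\<lambda>(u, v, \<theta>). P (u, v) * complex_of_real (h \<theta>)) (u, v, \<theta>)) \<le> B * C * (1 + norm \<theta>) powr
        (1 - real (length \<beta>))"
      by (simp add: pderivs_product_amplitude[OF D(1) P h(1)] mult.assoc)
  qed
qed

section \<open>Oscillatory integrals with phase \<open>\<omega> (t - Q (y, x))\<close>\<close>

text \<open>Test functions with support in a fixed compact set, which makes estimates uniform in the function.\<close>

definition smooth_in :: "'a::euclidean_space set \<Rightarrow> ('a \<Rightarrow> complex) \<Rightarrow> bool" where
  "smooth_in K w \<longleftrightarrow> compact K \<and> smooth_on UNIV w \<and> (\<forall>u. u \<notin> K \<longrightarrow> w u = 0)"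

definition dt :: "('b::euclidean_space \<times> real \<Rightarrow> complex) \<Rightarrow> ('b \<times> real \<Rightarrow> complex)" where
  "dt w = (\<lambda>u. frechet_derivative w (at u) (0, 1))"

text \<open>Up to sign, \<open>dt\<close> acts on \<open>slice\<close> as multiplication by \<open>\<i> \<omega>\<close>; so this operator multiplies it by \<open>1 + \<omega>\<^sup>2\<close>.\<close>

definition one_minus_dt2 :: "('b::euclidean_space \<times> real \<Rightarrow> complex) \<Rightarrow> ('b \<times> real \<Rightarrow> complex)" where
  "one_minus_dt2 w = (\<lambda>u. w u - dt (dt w) u)"

text \<open>The integrand of the oscillatory integral after integration over \<open>(y, t)\<close> at fixed frequency. The
  amplitude is a product of \<open>c (y, x)\<close> and a function of the frequency, which is left out here.\<close>

definition slice ::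
  "('b::euclidean_space \<times> 'a \<Rightarrow> complex) \<Rightarrow> ('b \<times> 'a \<Rightarrow> real) \<Rightarrow> ('b \<times> real \<Rightarrow> complex) \<Rightarrow>
   'a \<Rightarrow> real \<Rightarrow> complex" where
  "slice c Q w x \<omega> = (LINT u|lborel. c (fst u, x) * cis (\<omega> * (snd u - Q (fst u, x))) * w u)"

definition continuous_fibre :: "('b::euclidean_space \<times> real) set \<Rightarrow> ('b \<times> 'a \<Rightarrow> 'c::topological_space)
  \<Rightarrow> 'a \<Rightarrow> bool" where
  "continuous_fibre K c x \<longleftrightarrow> continuous_on (fst ` K) (\<lambda>y. c (y, x))"

lemma smooth_in_outside: "smooth_in K w \<Longrightarrow> u \<notin> K \<Longrightarrow> w u = 0"
  by (simp add: smooth_in_def)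

lemma smooth_in_continuous: "smooth_in K w \<Longrightarrow> continuous_on A w"
  unfolding smooth_in_def using smooth_on_continuous_on continuous_on_subset by blast

lemma frechet_derivative_outside_support:
  assumes "smooth_in K w" "u \<notin> K" shows "frechet_derivative w (at u) v = 0"
proof -
  have "frechet_derivative w (at u) = frechet_derivative (\<lambda>_. 0) (at u)"
    using assms by (intro frechet_derivative_cong_open[of "- K"])
      (auto simp: smooth_in_def compact_imp_closed open_Compl)
  then show ?thesis by simp
qed

lemma smooth_in_dt: "smooth_in K w \<Longrightarrow> smooth_in K (dt w)"
  using smooth_on_frechet[OF open_UNIV, of w] frechet_derivative_outside_support[of K w]
  by (simp add: smooth_in_def dt_def)

lemma smooth_in_add: "smooth_in K w1 \<Longrightarrow> smooth_in K w2 \<Longrightarrow> smooth_in K (\<lambda>u. w1 u + w2 u)"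
  by (simp add: smooth_in_def smooth_on_add)

lemma smooth_in_diff: "smooth_in K w1 \<Longrightarrow> smooth_in K w2 \<Longrightarrow> smooth_in K (\<lambda>u. w1 u - w2 u)"
  by (simp add: smooth_in_def smooth_on_diff)

lemma smooth_in_cmult: "smooth_in K w \<Longrightarrow> smooth_in K (\<lambda>u. a * w u)"
  by (simp add: smooth_in_def smooth_on_mult smooth_on_const)

lemma smooth_in_one_minus_dt2: "smooth_in K w \<Longrightarrow> smooth_in K (one_minus_dt2 w)"
  unfolding one_minus_dt2_def by (intro smooth_in_diff smooth_in_dt)

lemma derivs_bounded_dt:
  assumes "derivs_bounded (Suc N) K w B" shows "derivs_bounded N K (dt w) B"
  unfolding derivs_bounded_def
proof (intro conjI allI ballI impI)
  fix vs :: "('a \<times> real) list" and x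
  assume "x \<in> K" "set vs \<subseteq> Basis \<and> length vs \<le> N"
  then have "norm (pderivs (vs @ [(0, 1)]) w x) \<le> B"
    using assms by (auto simp: derivs_bounded_def Basis_prod_def)
  then show "norm (pderivs vs (dt w) x) \<le> B" by (simp add: pderivs_append dt_def)
qed (use assms in \<open>simp add: derivs_bounded_def\<close>)

lemma derivs_bounded_one_minus_dt2:
  assumes "smooth_in K w" "derivs_bounded (N + 2) K w B"
  shows "derivs_bounded N K (one_minus_dt2 w) (2 * B)"
  unfolding derivs_bounded_def
proof (intro conjI allI ballI impI)
  have dd: "derivs_bounded N K (dt (dt w)) B"
    using assms(2) by (intro derivs_bounded_dt) simp
  fix vs :: "('a \<times> real) list" and x
  assume x: "x \<in> K" and vs: "set vs \<subseteq> Basis \<and> length vs \<le> N"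
  have sm: "smooth_on UNIV w" "smooth_on UNIV (dt (dt w))"
    using assms(1) smooth_in_dt smooth_in_def by blast+
  have "one_minus_dt2 w = (\<lambda>u. w u + - dt (dt w) u)" by (simp add: one_minus_dt2_def)
  then have "pderivs vs (one_minus_dt2 w) x = pderivs vs w x + pderivs vs (\<lambda>u. - dt (dt w) u) x"
    using pderivs_add[OF open_UNIV sm(1) smooth_on_minus[OF sm(2)]] by simp
  also have "\<dots> = pderivs vs w x - pderivs vs (dt (dt w)) x"
    using pderivs_linear[OF open_UNIV bounded_linear_minus[OF bounded_linear_ident] sm(2)] by simp
  also have "norm \<dots> \<le> B + B"
    using x vs assms(2) dd unfolding derivs_bounded_def
    by (intro order_trans[OF norm_triangle_ineq4] add_mono) auto
  finally show "norm (pderivs vs (one_minus_dt2 w) x) \<le> 2 * B" by simp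
qed (use assms in \<open>simp add: derivs_bounded_def\<close>)

lemma derivs_bounded_0: "derivs_bounded N K w B \<Longrightarrow> u \<in> K \<Longrightarrow> norm (w u) \<le> B"
  unfolding derivs_bounded_def by (metis empty_set empty_subsetI le0 list.size(3) pderivs.simps(1))

lemma derivs_bounded_mono: "derivs_bounded N K w B \<Longrightarrow> n \<le> N \<Longrightarrow> derivs_bounded n K w B"
  unfolding derivs_bounded_def by auto

lemma continuous_integrand:
  assumes "continuous_fibre K c x" "continuous_fibre K Q x" "smooth_in K w"
  shows "continuous_on (K \<times> UNIV) (\<lambda>(u, \<omega>). c (fst u, x) * cis (\<omega> * (snd u - Q (fst u, x))) * w u)"
proof -
  have fibre: "continuous_on (K \<times> UNIV) (\<lambda>z. f (fst (fst z), x))" if "continuous_fibre K f x"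
    for f :: "'a \<times> 'b \<Rightarrow> 'z::topological_space"
    by (rule continuous_on_compose2[OF that[unfolded continuous_fibre_def]])
      (auto intro!: continuous_intros)
  have "continuous_on (K \<times> UNIV) (\<lambda>z. w (fst z))"
    by (rule continuous_on_compose2[OF smooth_in_continuous[OF assms(3), of UNIV]])
      (auto intro: continuous_on_fst)
  then show ?thesis unfolding case_prod_beta by (intro continuous_intros fibre assms(1,2))
qed

lemma integrand_integrable:
  assumes "continuous_fibre K c x" "continuous_fibre K Q x" "smooth_in K w"
  shows "integrable lborel (\<lambda>u. c (fst u, x) * cis (\<omega> * (snd u - Q (fst u, x))) * w u)"
proof (rule integrable_continuous_compact_support)
  show "compact K" using assms(3) by (simp add: smooth_in_def)
  have "continuous_on K (\<lambda>u. case (u, \<omega>) of (u, \<omega>) \<Rightarrow> c (fst u, x) * cis (\<omega> * (snd u - Q (fst u, x)))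
    * w u)"
    by (rule continuous_on_compose2[OF continuous_integrand[OF assms]]) (auto intro!: continuous_intros)
  then show "continuous_on K (\<lambda>u. c (fst u, x) * cis (\<omega> * (snd u - Q (fst u, x))) * w u)" by simp
qed (use smooth_in_outside[OF assms(3)] in simp)

lemma slice_measurable:
  assumes "continuous_fibre K c x" "continuous_fibre K Q x" "smooth_in K w"
  shows "slice c Q w x \<in> borel_measurable borel"
proof -
  let ?f = "\<lambda>(u, \<omega>). c (fst u, x) * cis (\<omega> * (snd u - Q (fst u, x))) * w u"
  have "closed K" using assms(3) by (simp add: smooth_in_def compact_imp_closed)
  then have "(\<lambda>z. indicator (K \<times> UNIV) z *\<^sub>R ?f z) \<in> borel_measurable borel"
    by (intro borel_measurable_continuous_on_indicator continuous_integrand assms)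
      (auto intro: closed_Times borel_closed)
  also have "(\<lambda>z. indicator (K \<times> UNIV) z *\<^sub>R ?f z) = ?f"
    using assms(3) by (auto simp: smooth_in_def indicator_def)
  finally have "?f \<in> borel_measurable (borel \<Otimes>\<^sub>M borel)" by (simp only: borel_prod)
  then have "?f \<in> borel_measurable (lborel \<Otimes>\<^sub>M borel)"
    by (simp cong: measurable_cong_sets sets_pair_measure_cong)
  from measurable_pair_swap[OF this]
  have "(\<lambda>(\<omega>, u). c (fst u, x) * cis (\<omega> * (snd u - Q (fst u, x))) * w u)
      \<in> borel_measurable (borel \<Otimes>\<^sub>M lborel)"
    by simp
  then have "(\<lambda>\<omega>. LINT u|lborel. c (fst u, x) * cis (\<omega> * (snd u - Q (fst u, x))) * w u)
    \<in> borel_measurable borel"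
    by (rule lborel.borel_measurable_lebesgue_integral)
  then show ?thesis by (simp add: slice_def[abs_def])
qed

lemma norm_slice_le:
  assumes "continuous_fibre K c x" "continuous_fibre K Q x" "smooth_in K w"
    and c: "\<And>y. y \<in> fst ` K \<Longrightarrow> norm (c (y, x)) \<le> Bc" and w: "\<And>u. u \<in> K \<Longrightarrow> norm (w u) \<le> Bw"
  shows "norm (slice c Q w x \<omega>) \<le> Bc * Bw * measure lborel K"
proof -
  have K: "compact K" using assms(3) by (simp add: smooth_in_def)
  have *: "norm (c (fst u, x) * cis (\<omega> * (snd u - Q (fst u, x))) * w u) \<le> Bc * Bw * indicator K u" for u
  proof (cases "u \<in> K")
    case True
    then show ?thesis using c[of "fst u"] w[of u]
      by (simp add: norm_mult mult_mono')
  qed (use smooth_in_outside[OF assms(3)] in simp)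
  have "norm (slice c Q w x \<omega>) \<le> (LINT u|lborel. Bc * Bw * indicator K u)"
    unfolding slice_def
    by (rule Bochner_Integration.integral_norm_bound_integral)
      (use * integrand_integrable[OF assms(1-3)] K in \<open>auto intro: integrable_indicator_compact\<close>)
  then show ?thesis by simp
qed

lemma slice_add:
  assumes "continuous_fibre K c x" "continuous_fibre K Q x" "smooth_in K w1" "smooth_in K w2"
  shows "slice c Q (\<lambda>u. w1 u + w2 u) x \<omega> = slice c Q w1 x \<omega> + slice c Q w2 x \<omega>"
  unfolding slice_def distrib_left
  using integrand_integrable[OF assms(1,2,3)] integrand_integrable[OF assms(1,2,4)] by simp

lemma slice_cmult: "slice c Q (\<lambda>u. a * w u) x \<omega> = a * slice c Q w x \<omega>"
  unfolding slice_def by (subst integral_mult_right_zero[symmetric]) (simp add: algebra_simps)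

text \<open>Integration by parts in \<open>t\<close>: the total \<open>t\<close>-derivative of the integrand integrates to zero.\<close>

lemma slice_dt:
  assumes "continuous_fibre K c x" "continuous_fibre K Q x" "smooth_in K w"
  shows "slice c Q (dt w) x \<omega> = - (\<i> * \<omega>) * slice c Q w x \<omega>"
proof -
  let ?E = "\<lambda>u. c (fst u, x) * cis (\<omega> * (snd u - Q (fst u, x)))"
  let ?D = "\<lambda>u. ?E u * w u * (\<i> * \<omega>) + ?E u * dt w u"
  note dw = smooth_in_dt[OF assms(3)]
  have contE: "continuous_on K (\<lambda>u. ?E u * w u)" if "smooth_in K w" for w
  proof -
    have "continuous_on K (\<lambda>u. case (u, \<omega>) of (u, \<omega>) \<Rightarrow> c (fst u, x) * cis (\<omega> * (snd u - Q (fst u,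
      x))) * w u)"
      by (rule continuous_on_compose2[OF continuous_integrand[OF assms(1,2) that]])
        (auto intro!: continuous_intros)
    then show ?thesis by simp
  qed
  have "(LINT u|lborel. ?D u) = 0"
  proof (rule integral_directional_derivative_eq_0[where K=K and e="(0, 1)" and \<Psi>="\<lambda>u. ?E u * w u"])
    show "compact K" using assms(3) by (simp add: smooth_in_def)
    show "continuous_on K (\<lambda>u. ?E u * w u)" by (rule contE[OF assms(3)])
    show "continuous_on K ?D" by (intro continuous_intros contE[OF assms(3)] contE[OF dw])
    fix z :: "'a \<times> real" and h :: real
    show "z \<notin> K \<Longrightarrow> ?E z * w z = 0" using smooth_in_outside[OF assms(3)] by simp
    show "z \<notin> K \<Longrightarrow> ?D z = 0" using smooth_in_outside[OF assms(3)] smooth_in_outside[OF dw] by simp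
    have w: "((\<lambda>h. w (z + h *\<^sub>R (0, 1))) has_vector_derivative dt w (z + h *\<^sub>R (0, 1))) (at h)"
    proof -
      have "(w has_derivative frechet_derivative w (at (z + h *\<^sub>R (0, 1)))) (at (z + h *\<^sub>R (0, 1)))"
        using assms(3) by (intro smooth_on_has_derivative[of UNIV]) (auto simp: smooth_in_def)
      then have "((\<lambda>h. w (z + h *\<^sub>R (0, 1))) has_derivative
          (\<lambda>v. frechet_derivative w (at (z + h *\<^sub>R (0, 1))) (v *\<^sub>R (0, 1)))) (at h)"
        by (intro has_derivative_compose[of "\<lambda>h. z + h *\<^sub>R (0, 1)" "\<lambda>v. v *\<^sub>R (0, 1)" h UNIV w])
          (auto intro!: derivative_eq_intros simp del: scaleR_Pair)
      then show ?thesis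
        using linear_scale[OF has_derivative_linear[OF \<open>(w has_derivative _) _\<close>]]
        by (simp add: has_vector_derivative_def dt_def del: scaleR_Pair)
    qed
    have cis: "((\<lambda>h. cis (\<omega> * (snd z + h - Q (fst z, x)))) has_vector_derivative
        \<omega> *\<^sub>R (\<i> * cis (\<omega> * (snd z + h - Q (fst z, x))))) (at h)"
      unfolding has_vector_derivative_def
      by (rule has_derivative_eq_rhs[OF has_derivative_cis])
        (auto intro!: derivative_eq_intros simp: mult.commute)
    show "((\<lambda>h. ?E (z + h *\<^sub>R (0, 1)) * w (z + h *\<^sub>R (0, 1))) has_vector_derivative
        ?D (z + h *\<^sub>R (0, 1))) (at h)"
      using has_vector_derivative_mult[OF has_vector_derivative_mult_right[OF cis, of "c (fst z, x)"] w]
      by (simp add: algebra_simps scaleR_conv_of_real)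
  qed
  also have "(LINT u|lborel. ?D u) = slice c Q w x \<omega> * (\<i> * \<omega>) + slice c Q (dt w) x \<omega>"
    unfolding slice_def
    using integrand_integrable[OF assms, of \<omega>] integrand_integrable[OF assms(1,2) dw, of \<omega>] by simp
  finally show ?thesis by (simp add: algebra_simps eq_neg_iff_add_eq_0)
qed

lemma slice_one_minus_dt2:
  assumes "continuous_fibre K c x" "continuous_fibre K Q x" "smooth_in K w"
  shows "slice c Q (one_minus_dt2 w) x \<omega> = complex_of_real (1 + \<omega>\<^sup>2) * slice c Q w x \<omega>"
proof -
  note dw = smooth_in_dt[OF assms(3)]
  have "slice c Q (one_minus_dt2 w) x \<omega> = slice c Q (\<lambda>u. w u + (- 1) * dt (dt w) u) x \<omega>"
    by (simp add: one_minus_dt2_def)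
  also have "\<dots> = slice c Q w x \<omega> - slice c Q (dt (dt w)) x \<omega>"
    using slice_add[OF assms smooth_in_cmult[OF smooth_in_dt[OF dw], of "-1"], of \<omega>]
    by (simp add: slice_cmult[of _ _ "-1", simplified])
  also have "\<dots> = (1 + \<omega>\<^sup>2) * slice c Q w x \<omega>"
    by (simp add: slice_dt[OF assms(1,2) dw] slice_dt[OF assms] algebra_simps power2_eq_square)
  finally show ?thesis .
qed

text \<open>Two applications of \<open>1 - dt\<^sup>2\<close> give the decay \<open>(1 + \<omega>\<^sup>2)\<^sup>-\<^sup>2\<close>, after which the product with an amplitude of
  linear growth is still integrable.\<close>

lemma slice_decay:
  assumes "continuous_fibre K c x" "continuous_fibre K Q x" "smooth_in K w"
    and c: "\<And>y. y \<in> fst ` K \<Longrightarrow> norm (c (y, x)) \<le> Bc"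
    and w: "\<And>u. u \<in> K \<Longrightarrow> norm (one_minus_dt2 (one_minus_dt2 w) u) \<le> Bw"
  shows "norm (slice c Q w x \<omega>) \<le> Bc * Bw * measure lborel K / (1 + \<omega>\<^sup>2)\<^sup>2"
proof -
  note w1 = smooth_in_one_minus_dt2[OF assms(3)]
  have pos: "0 < 1 + \<omega>\<^sup>2" by (simp add: add_pos_nonneg)
  have "norm (slice c Q (one_minus_dt2 (one_minus_dt2 w)) x \<omega>) \<le> Bc * Bw * measure lborel K"
    by (rule norm_slice_le[OF assms(1,2) smooth_in_one_minus_dt2[OF w1] c w])
  also have "slice c Q (one_minus_dt2 (one_minus_dt2 w)) x \<omega> = complex_of_real ((1 + \<omega>\<^sup>2)\<^sup>2)
    * slice c Q w x \<omega>"
    by (simp add: slice_one_minus_dt2[OF assms(1,2) w1] slice_one_minus_dt2[OF assms(1-3)]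
      power2_eq_square)
  finally show ?thesis using pos by (simp add: norm_mult pos_le_divide_eq mult.commute del:
    of_real_power of_real_add)
qed

text \<open>The frequency factor of the amplitude. Continuity and linear growth suffice for convergence, so
  that \<open>\<bar>\<omega>\<bar>\<close>, its smooth modification and their difference are treated alike.\<close>

definition weight :: "(real \<Rightarrow> complex) \<Rightarrow> bool" where
  "weight H \<longleftrightarrow> continuous_on UNIV H \<and> (\<exists>B. \<forall>\<omega>. norm (H \<omega>) \<le> B * (1 + \<bar>\<omega>\<bar>))"

definition osc ::
  "(real \<Rightarrow> complex) \<Rightarrow> ('b::euclidean_space \<times> 'a \<Rightarrow> real) \<Rightarrow> ('b \<times> 'a \<Rightarrow> complex) \<Rightarrow> ('b \<times> real \<Rightarrow> complex) \<Rightarrow>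
   'a \<Rightarrow> complex" where
  "osc H Q c w x = (LINT \<omega>|lborel. H \<omega> * slice c Q w x \<omega>)"

text \<open>The bound is relative to \<open>1 + \<omega>\<^sup>2\<close>, as this cancels against one factor of the decay of \<open>slice\<close>.\<close>

definition weight_bound :: "(real \<Rightarrow> complex) \<Rightarrow> real" where
  "weight_bound H = (SOME B. 0 \<le> B \<and> (\<forall>\<omega>. norm (H \<omega>) \<le> B * (1 + \<omega>\<^sup>2)))"

lemma weight_bound:
  assumes "weight H"
  shows "0 \<le> weight_bound H" "norm (H \<omega>) \<le> weight_bound H * (1 + \<omega>\<^sup>2)"
proof -
  obtain B where B: "\<And>\<omega>. norm (H \<omega>) \<le> B * (1 + \<bar>\<omega>\<bar>)"
    using assms by (auto simp: weight_def)
  have "norm (H \<omega>) \<le> 2 * \<bar>B\<bar> * (1 + \<omega>\<^sup>2)" for \<omega>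
  proof -
    have "1 + \<bar>\<omega>\<bar> \<le> 2 * (1 + \<omega>\<^sup>2)"
    proof -
      have "2 * \<bar>\<omega>\<bar> \<le> \<omega>\<^sup>2 + 1"
        using zero_le_power2[of "\<bar>\<omega>\<bar> - 1"] by (simp add: power2_diff)
      moreover have "2 * a \<le> s + 1 \<Longrightarrow> 0 \<le> s \<Longrightarrow> 1 + a \<le> 2 * (1 + s)" for a s :: real by simp
      ultimately show ?thesis using zero_le_power2 by blast
    qed
    then have "\<bar>B\<bar> * (1 + \<bar>\<omega>\<bar>) \<le> \<bar>B\<bar> * (2 * (1 + \<omega>\<^sup>2))" by (intro mult_left_mono) auto
    moreover have "B * (1 + \<bar>\<omega>\<bar>) \<le> \<bar>B\<bar> * (1 + \<bar>\<omega>\<bar>)" by (intro mult_right_mono) auto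
    ultimately show ?thesis using B[of \<omega>] by linarith
  qed
  then have "\<exists>B. 0 \<le> B \<and> (\<forall>\<omega>. norm (H \<omega>) \<le> B * (1 + \<omega>\<^sup>2))"
    by (intro exI[of _ "2 * \<bar>B\<bar>"]) auto
  from someI_ex[OF this] show "0 \<le> weight_bound H" "norm (H \<omega>) \<le> weight_bound H * (1 + \<omega>\<^sup>2)"
    by (auto simp: weight_bound_def)
qed

lemma integrable_inverse_square: "integrable lborel (\<lambda>\<omega>::real. C / (1 + \<omega>\<^sup>2))"
  using integrable_inverse_1_plus_square
  by (simp add: set_integrable_def divide_inverse)

lemma weighted_slice_decay:
  assumes "weight H" "continuous_fibre K c x" "continuous_fibre K Q x" "smooth_in K w"
    and "\<And>y. y \<in> fst ` K \<Longrightarrow> norm (c (y, x)) \<le> Bc"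
    and "\<And>u. u \<in> K \<Longrightarrow> norm (one_minus_dt2 (one_minus_dt2 w) u) \<le> Bw"
  shows "norm (H \<omega> * slice c Q w x \<omega>) \<le> weight_bound H * (Bc * Bw * measure lborel K) / (1 + \<omega>\<^sup>2)"
proof -
  have pos: "0 < 1 + \<omega>\<^sup>2" by (simp add: add_pos_nonneg)
  have "norm (H \<omega> * slice c Q w x \<omega>) \<le>
      (weight_bound H * (1 + \<omega>\<^sup>2)) * (Bc * Bw * measure lborel K / (1 + \<omega>\<^sup>2)\<^sup>2)"
    unfolding norm_mult using weight_bound[OF assms(1)] slice_decay[OF assms(2-)] pos
    by (intro mult_mono) auto
  also have "\<dots> = weight_bound H * (Bc * Bw * measure lborel K) / (1 + \<omega>\<^sup>2)"
    using pos by (simp add: power2_eq_square[of "1 + \<omega>\<^sup>2"])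
  finally show ?thesis .
qed

lemma continuous_fibre_bounded:
  fixes c :: "'b::euclidean_space \<times> 'a \<Rightarrow> 'c::real_normed_vector"
  assumes "compact K" "continuous_fibre K c x"
  shows "\<exists>B. \<forall>y\<in>fst ` K. norm (c (y, x)) \<le> B"
proof -
  have "compact (fst ` K)" using assms(1) by (intro compact_continuous_image continuous_on_fst
    continuous_on_id)
  then have "bounded ((\<lambda>y. c (y, x)) ` fst ` K)"
    using assms(2) unfolding continuous_fibre_def
    by (metis compact_imp_bounded compact_continuous_image)
  then show ?thesis unfolding bounded_iff by blast
qed

lemma smooth_in_bounded:
  assumes "smooth_in K w" shows "\<exists>B\<ge>0. \<forall>u. norm (w u) \<le> B"
proof -
  have "bounded (w ` K)" using assms
    by (intro compact_imp_bounded compact_continuous_image smooth_in_continuous[OF assms])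
      (simp add: smooth_in_def)
  then obtain B where B: "\<And>u. u \<in> K \<Longrightarrow> norm (w u) \<le> B" unfolding bounded_iff by blast
  have "norm (w u) \<le> max B 0" for u
    using B[of u] assms by (cases "u \<in> K") (auto simp: smooth_in_def)
  then show ?thesis by (intro exI[of _ "max B 0"]) simp
qed

lemma weighted_slice_integrable:
  assumes "weight H" "continuous_fibre K c x" "continuous_fibre K Q x" "smooth_in K w"
  shows "integrable lborel (\<lambda>\<omega>. H \<omega> * slice c Q w x \<omega>)"
proof -
  have "compact K" using assms(4) by (simp add: smooth_in_def)
  then obtain Bc where Bc: "\<And>y. y \<in> fst ` K \<Longrightarrow> norm (c (y, x)) \<le> Bc"
    using continuous_fibre_bounded[OF _ assms(2)] by blast
  obtain Bw where Bw: "\<And>u. norm (one_minus_dt2 (one_minus_dt2 w) u) \<le> Bw"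
    using smooth_in_bounded[OF smooth_in_one_minus_dt2[OF smooth_in_one_minus_dt2[OF assms(4)]]] by blast
  show ?thesis
  proof (rule Bochner_Integration.integrable_bound[OF integrable_inverse_square])
    show "(\<lambda>\<omega>. H \<omega> * slice c Q w x \<omega>) \<in> borel_measurable lborel"
    proof -
      have "H \<in> borel_measurable borel"
        using assms(1) by (auto simp: weight_def intro: borel_measurable_continuous_onI)
      then show ?thesis using slice_measurable[OF assms(2-4)] by simp
    qed
    show "AE \<omega> in lborel. norm (H \<omega> * slice c Q w x \<omega>) \<le>
        norm (weight_bound H * (Bc * Bw * measure lborel K) / (1 + \<omega>\<^sup>2))"
    proof (rule AE_I2)
      fix \<omega> :: real
      show "norm (H \<omega> * slice c Q w x \<omega>) \<le> norm (weight_bound H * (Bc * Bw * measure lborel K) / (1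
        + \<omega>\<^sup>2))"
        using weighted_slice_decay[OF assms Bc Bw, of \<omega>] unfolding real_norm_def by
          (rule order_trans[OF _ abs_ge_self])
    qed
  qed
qed

definition dx :: "'a::real_normed_vector \<Rightarrow> ('b::real_normed_vector \<times> 'a \<Rightarrow> 'c::real_normed_vector) \<Rightarrow>
  ('b \<times> 'a \<Rightarrow> 'c)" where
  "dx v f = (\<lambda>z. frechet_derivative f (at z) (0, v))"

locale smooth_phase =
  fixes D :: "('b::euclidean_space \<times> 'a::euclidean_space) set"
    and Q :: "'b \<times> 'a \<Rightarrow> real" and K :: "('b \<times> real) set" and W :: "'a set"
  assumes D: "open D" and Q: "smooth_on D Q" and K: "compact K" and W: "open W"
    and KW: "fst ` K \<times> W \<subseteq> D"
begin

lemma continuous_fibre: "smooth_on D c \<Longrightarrow> x \<in> W \<Longrightarrow> continuous_fibre K c x"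
  unfolding continuous_fibre_def
  by (rule continuous_on_compose2[OF smooth_on_continuous_on]) (use KW
    in \<open>auto intro!: continuous_intros\<close>)

lemma smooth_dx: "smooth_on D c \<Longrightarrow> smooth_on D (dx v c)"
  unfolding dx_def by (rule smooth_on_frechet[OF D])

lemma smooth_mult_dx: "smooth_on D c \<Longrightarrow> smooth_on D (\<lambda>z. c z * complex_of_real (dx v Q z))"
  by (intro smooth_on_mult smooth_on_of_real smooth_dx Q)

lemma has_derivative_dx:
  assumes "smooth_on D c" "(y, x) \<in> D"
  shows "((\<lambda>x. c (y, x)) has_derivative (\<lambda>v. dx v c (y, x))) (at x)"
  unfolding dx_def
  by (rule has_derivative_compose[of "\<lambda>x. (y, x)" "\<lambda>v. (0, v)" x UNIV c,
    OF _ smooth_on_has_derivative[OF assms]])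
    (auto intro!: derivative_eq_intros)

lemma compact_cylinder: "compact (fst ` K \<times> cball (x :: 'a) r)"
  using K by (intro compact_Times compact_cball compact_continuous_image continuous_on_fst
    continuous_on_id)

text \<open>Differentiating the exponential in \<open>x\<close> produces \<open>- \<i> \<omega> dx v Q\<close>. The factor \<open>- \<i> \<omega>\<close> is absorbed into a
  \<open>t\<close>-derivative of \<open>w\<close>, so no growth in the frequency appears on the right-hand side.\<close>

lemma slice_has_derivative:
  assumes c: "smooth_on D c" and w: "smooth_in K w" and x: "x \<in> W"
  shows "((\<lambda>x. slice c Q w x \<omega>) has_derivative
    (\<lambda>v. slice (dx v c) Q w x \<omega> + slice (\<lambda>z. c z * complex_of_real (dx v Q z)) Q (dt w) x \<omega>)) (at x)"
proof -
  obtain r where r: "0 < r" "cball x r \<subseteq> W" using W x open_contains_cball by blast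
  let ?C = "fst ` K \<times> cball x r"
  have C: "compact ?C" "?C \<subseteq> D" using compact_cylinder r(2) KW by auto
  have inD: "(fst u, x') \<in> D" if "u \<in> K" "x' \<in> ball x r" for u x'
    using that C(2) by auto
  obtain B0 where B0: "0 \<le> B0" "\<And>z. z \<in> ?C \<Longrightarrow> norm (c z) \<le> B0"
    using smooth_bounded_on_compact[OF c C] by blast
  obtain B1 where B1: "0 \<le> B1" "\<And>z v. z \<in> ?C \<Longrightarrow> norm (frechet_derivative c (at z) v) \<le> B1 * norm v"
    using smooth_derivative_bounded_on_compact[OF D c C] by blast
  obtain BQ where BQ: "0 \<le> BQ" "\<And>z v. z \<in> ?C \<Longrightarrow> norm (frechet_derivative Q (at z) v) \<le> BQ * norm v"
    using smooth_derivative_bounded_on_compact[OF D Q C] by blast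
  obtain Bw where Bw: "0 \<le> Bw" "\<And>u. norm (w u) \<le> Bw" using smooth_in_bounded[OF w] by blast
  let ?E = "\<lambda>x u. cis (\<omega> * (snd u - Q (fst u, x)))"
  let ?f = "\<lambda>x u. c (fst u, x) * ?E x u * w u"
  let ?f' = "\<lambda>x u v. (dx v c (fst u, x) * ?E x u
    - \<i> * complex_of_real \<omega> * (c (fst u, x) * complex_of_real (dx v Q (fst u, x)) * ?E x u)) * w u"
  have "((\<lambda>x. LINT u|lborel. ?f x u) has_derivative (\<lambda>v. LINT u|lborel. ?f' x u v)) (at x)"
  proof (rule has_derivative_integral_dominated[OF r(1),
        where m="\<lambda>u. (B1 + \<bar>\<omega>\<bar> * (B0 * BQ)) * Bw * indicator K u"])
    show "integrable lborel (?f x')" if "x' \<in> ball x r" for x'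
      using that r(2) by (intro integrand_integrable[where K=K] continuous_fibre c w Q) auto
    fix x' u
    assume x': "x' \<in> ball x r"
    show "((\<lambda>x. ?f x u) has_derivative ?f' x' u) (at x')"
    proof (cases "u \<in> K")
      case True
      show ?thesis
        by (rule has_derivative_eq_rhs,
            rule has_derivative_mult_left[OF has_derivative_mult[OF
              has_derivative_dx[OF c inD[OF True x']]
              has_derivative_cis[OF has_derivative_mult_right[OF has_derivative_diff[OF
                has_derivative_const
                has_derivative_dx[OF Q inD[OF True x']]]]]]])
          (simp add: fun_eq_iff scaleR_conv_of_real algebra_simps)
    qed (use smooth_in_outside[OF w] in simp)
    show "norm (?f' x' u v) \<le> (B1 + \<bar>\<omega>\<bar> * (B0 * BQ)) * Bw * indicator K u * norm v" for v
    proof (cases "u \<in> K")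
      case True
      then have z: "(fst u, x') \<in> ?C" using x' by auto
      have 1: "norm (dx v c (fst u, x') * ?E x' u) \<le> B1 * norm v"
        using B1(2)[OF z, of "(0, v)"] by (simp add: dx_def norm_mult)
      have 2: "norm (\<i> * complex_of_real \<omega> * (c (fst u, x') * complex_of_real (dx v Q (fst u, x'))
        * ?E x' u))
          \<le> \<bar>\<omega>\<bar> * (B0 * (BQ * norm v))"
        using B0(2)[OF z] BQ(2)[OF z, of "(0, v)"] B0(1)
        by (simp add: dx_def norm_mult mult_mono mult_left_mono)
      have "norm (?f' x' u v) \<le> (B1 * norm v + \<bar>\<omega>\<bar> * (B0 * (BQ * norm v))) * Bw"
        unfolding norm_mult[of _ "w u"]
        using 1 2 Bw(2)[of u] Bw(1) B0(1) BQ(1) B1(1)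
        by (intro mult_mono order_trans[OF norm_triangle_ineq4] add_mono) auto
      then show ?thesis using True by (simp add: algebra_simps)
    qed (use smooth_in_outside[OF w] in simp)
  next
    show "integrable lborel (\<lambda>u. (B1 + \<bar>\<omega>\<bar> * (B0 * BQ)) * Bw * indicator K u)"
      using K by (intro integrable_mult_right integrable_indicator_compact)
  qed
  moreover have "(LINT u|lborel. ?f' x u v) =
      slice (dx v c) Q w x \<omega> + slice (\<lambda>z. c z * complex_of_real (dx v Q z)) Q (dt w) x \<omega>" for v
  proof -
    note fib = continuous_fibre[OF smooth_dx[OF c] x] continuous_fibre[OF smooth_mult_dx[OF c] x]
      continuous_fibre[OF Q x]
    note int = integrand_integrable[OF fib(1,3) w, of v \<omega>] integrand_integrable[OF fib(2,3) w, of v \<omega>]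
    have "(LINT u|lborel. ?f' x u v) = slice (dx v c) Q w x \<omega>
        - \<i> * complex_of_real \<omega> * slice (\<lambda>z. c z * complex_of_real (dx v Q z)) Q w x \<omega>"
      unfolding slice_def integral_mult_right_zero[symmetric]
      by (subst Bochner_Integration.integral_diff[symmetric])
        (use int in \<open>auto simp: algebra_simps\<close>)
    then show ?thesis using slice_dt[OF fib(2,3) w] by simp
  qed
  ultimately show ?thesis unfolding slice_def by simp
qed

text \<open>Both terms are again of the form \<open>osc\<close>; smoothness and estimates follow by induction.\<close>

lemma osc_has_derivative:
  assumes H: "weight H" and c: "smooth_on D c" and w: "smooth_in K w" and x: "x \<in> W"
  shows "(osc H Q c w has_derivative
    (\<lambda>v. osc H Q (dx v c) w x + osc H Q (\<lambda>z. c z * complex_of_real (dx v Q z)) (dt w) x)) (at x)"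
proof -
  obtain r where r: "0 < r" "cball x r \<subseteq> W" using W x open_contains_cball by blast
  let ?C = "fst ` K \<times> cball x r"
  have C: "compact ?C" "?C \<subseteq> D" using compact_cylinder r(2) KW by auto
  obtain B0 where B0: "0 \<le> B0" "\<And>z. z \<in> ?C \<Longrightarrow> norm (c z) \<le> B0"
    using smooth_bounded_on_compact[OF c C] by blast
  obtain B1 where B1: "0 \<le> B1" "\<And>z v. z \<in> ?C \<Longrightarrow> norm (frechet_derivative c (at z) v) \<le> B1 * norm v"
    using smooth_derivative_bounded_on_compact[OF D c C] by blast
  obtain BQ where BQ: "0 \<le> BQ" "\<And>z v. z \<in> ?C \<Longrightarrow> norm (frechet_derivative Q (at z) v) \<le> BQ * norm v"
    using smooth_derivative_bounded_on_compact[OF D Q C] by blast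
  note dw = smooth_in_dt[OF w]
  let ?L = "\<lambda>w. one_minus_dt2 (one_minus_dt2 w)"
  obtain Bw where Bw: "\<And>u. norm (?L w u) \<le> Bw"
    using smooth_in_bounded[OF smooth_in_one_minus_dt2[OF smooth_in_one_minus_dt2[OF w]]] by blast
  obtain Bd where Bd: "\<And>u. norm (?L (dt w) u) \<le> Bd"
    using smooth_in_bounded[OF smooth_in_one_minus_dt2[OF smooth_in_one_minus_dt2[OF dw]]] by blast
  let ?c' = "\<lambda>v z. c z * complex_of_real (dx v Q z)"
  let ?M = "weight_bound H * (B1 * Bw * measure lborel K) + weight_bound H *
    (B0 * BQ * Bd * measure lborel K)"
  have fib: "continuous_fibre K c x'" "continuous_fibre K (dx v c) x'" "continuous_fibre K (?c' v) x'"
    "continuous_fibre K Q x'" if "x' \<in> W" for x' v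
    using that c Q by (auto intro: continuous_fibre smooth_dx smooth_mult_dx)
  have "((\<lambda>x. LINT \<omega>|lborel. H \<omega> * slice c Q w x \<omega>) has_derivative
      (\<lambda>v. LINT \<omega>|lborel. H \<omega> * (slice (dx v c) Q w x \<omega> + slice (?c' v) Q (dt w) x \<omega>))) (at x)"
  proof (rule has_derivative_integral_dominated[OF r(1), where m="\<lambda>\<omega>. ?M / (1 + \<omega>\<^sup>2)"])
    fix x' assume "x' \<in> ball x r"
    then have x': "x' \<in> cball x r" "x' \<in> W" using r(2) by auto
    show "integrable lborel (\<lambda>\<omega>. H \<omega> * slice c Q w x' \<omega>)"
      using x' by (intro weighted_slice_integrable[where K=K] H fib w) auto
    fix \<omega> :: real
    show "((\<lambda>x. H \<omega> * slice c Q w x \<omega>) has_derivative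
        (\<lambda>v. H \<omega> * (slice (dx v c) Q w x' \<omega> + slice (?c' v) Q (dt w) x' \<omega>))) (at x')"
      using slice_has_derivative[OF c w x'(2)] by (rule has_derivative_mult_right)
    fix v
    have z: "(y, x') \<in> ?C" if "y \<in> fst ` K" for y using that x'(1) by simp
    have "norm (H \<omega> * slice (dx v c) Q w x' \<omega>) \<le>
        weight_bound H * (B1 * norm v * Bw * measure lborel K) / (1 + \<omega>\<^sup>2)"
      using B1(2)[OF z, of _ "(0, v)"] Bw
      by (intro weighted_slice_decay H fib x' w) (auto simp: dx_def)
    moreover have "norm (H \<omega> * slice (?c' v) Q (dt w) x' \<omega>) \<le>
        weight_bound H * (B0 * (BQ * norm v) * Bd * measure lborel K) / (1 + \<omega>\<^sup>2)"
    proof (intro weighted_slice_decay H fib x' dw)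
      show "norm (?c' v (y, x')) \<le> B0 * (BQ * norm v)" if "y \<in> fst ` K" for y
        using B0(1) B0(2)[OF z[OF that]] BQ(2)[OF z[OF that], of "(0, v)"]
        by (simp add: dx_def norm_mult mult_mono)
    qed (use Bd in auto)
    moreover have "weight_bound H * (B1 * norm v * Bw * measure lborel K) / (1 + \<omega>\<^sup>2)
        + weight_bound H * (B0 * (BQ * norm v) * Bd * measure lborel K) / (1 + \<omega>\<^sup>2) = ?M / (1 + \<omega>\<^sup>2)
          * norm v"
      by (simp add: algebra_simps add_divide_distrib)
    ultimately show "norm (H \<omega> * (slice (dx v c) Q w x' \<omega> + slice (?c' v) Q (dt w) x' \<omega>)) \<le> ?M / (1
      + \<omega>\<^sup>2) * norm v"
      unfolding distrib_left by (intro order_trans[OF norm_triangle_ineq]) linarith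
  qed (rule integrable_inverse_square)
  then show ?thesis
    using weighted_slice_integrable[OF H fib(2,4) w] weighted_slice_integrable[OF H fib(3,4) dw] x
    by (simp add: osc_def[abs_def] distrib_left)
qed

lemma smooth_osc:
  assumes H: "weight H" and c: "smooth_on D c" and w: "smooth_in K w"
  shows "smooth_on W (osc H Q c w)"
proof -
  have "diff_n n W (osc H Q c w)" for n using c w
  proof (induction n arbitrary: c w)
    case 0
    then show ?case using osc_has_derivative[OF H] by (auto simp: differentiable_def)
  next
    case (Suc n)
    show ?case
      by (rule diff_n_SucI[OF W osc_has_derivative[OF H Suc.prems]])
        (auto intro!: diff_n_add Suc W smooth_dx smooth_mult_dx smooth_in_dt)
  qed
  then show ?thesis by (simp add: smooth_on_iff_diff_n[OF W])
qed

text \<open>Each derivative in \<open>x\<close> costs at most one derivative of \<open>w\<close>.\<close>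

lemma osc_pderivs_bound:
  assumes H: "weight H" and c: "smooth_on D c" and L: "compact L" "L \<subseteq> W"
  shows "\<exists>N C. 0 \<le> C \<and> (\<forall>w B. smooth_in K w \<and> derivs_bounded N K w B \<longrightarrow>
    (\<forall>x\<in>L. norm (pderivs vs (osc H Q c w) x) \<le> C * B))"
  using c
proof (induction vs arbitrary: c rule: rev_induct)
  case Nil
  have KL: "compact (fst ` K \<times> L)" "fst ` K \<times> L \<subseteq> D"
    using K L KW by (auto intro!: compact_Times compact_continuous_image continuous_on_fst
      continuous_on_id)
  obtain B0 where B0: "0 \<le> B0" "\<And>z. z \<in> fst ` K \<times> L \<Longrightarrow> norm (c z) \<le> B0"
    using smooth_bounded_on_compact[OF Nil KL] by blast
  define J where "J = (LINT \<omega>|lborel. 1 / (1 + \<omega>\<^sup>2 :: real))"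
  have J: "0 \<le> J" unfolding J_def by (intro integral_nonneg_AE AE_I2) (simp add: add_nonneg_nonneg)
  have bound: "norm (osc H Q c w x) \<le> weight_bound H * (B0 * 4 * measure lborel K) * J * B"
    if w: "smooth_in K w" and B: "derivs_bounded 4 K w B" and x: "x \<in> L" for w B x
  proof -
    have "derivs_bounded 2 K (one_minus_dt2 w) (2 * B)"
      by (intro derivs_bounded_one_minus_dt2 w derivs_bounded_mono[OF B]) simp
    then have "derivs_bounded 0 K (one_minus_dt2 (one_minus_dt2 w)) (2 * (2 * B))"
      using derivs_bounded_one_minus_dt2[OF smooth_in_one_minus_dt2[OF w], of 0] by (simp only: add_0)
    then have w4: "norm (one_minus_dt2 (one_minus_dt2 w) u) \<le> 4 * B" if "u \<in> K" for u
      using derivs_bounded_0 that by fastforce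
    have fib: "continuous_fibre K c x" "continuous_fibre K Q x"
      using x L continuous_fibre Nil Q by auto
    have "norm (osc H Q c w x) \<le> (LINT \<omega>|lborel. weight_bound H * (B0 * (4 * B) * measure lborel K)
      / (1 + \<omega>\<^sup>2))"
      unfolding osc_def
    proof (rule Bochner_Integration.integral_norm_bound_integral)
      show "norm (H \<omega> * slice c Q w x \<omega>) \<le> weight_bound H * (B0 * (4 * B) * measure lborel K) / (1
        + \<omega>\<^sup>2)" for \<omega>
        using w4 B0(2) x by (intro weighted_slice_decay H fib w) auto
    qed (use weighted_slice_integrable[OF H fib w] integrable_inverse_square in auto)
    also have "\<dots> = (LINT \<omega>|lborel. weight_bound H * (B0 * (4 * B) * measure lborel K) * (1 / (1 + \<omega>\<^sup>2)))"
      by simp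
    also have "\<dots> = weight_bound H * (B0 * (4 * B) * measure lborel K) * J"
      unfolding J_def by (rule integral_mult_right_zero)
    finally show ?thesis by (simp add: algebra_simps)
  qed
  show ?case
    by (rule exI[of _ 4], rule exI[of _ "weight_bound H * (B0 * 4 * measure lborel K) * J"])
      (use bound J B0(1) weight_bound(1)[OF H] in auto)
next
  case (snoc v vs)
  let ?c' = "\<lambda>z. c z * complex_of_real (dx v Q z)"
  obtain N1 C1 where 1: "0 \<le> C1" "\<And>w B x. smooth_in K w \<Longrightarrow> derivs_bounded N1 K w B \<Longrightarrow> x \<in> L \<Longrightarrow>
      norm (pderivs vs (osc H Q (dx v c) w) x) \<le> C1 * B"
    using snoc.IH[OF smooth_dx[OF snoc.prems]] by meson
  obtain N2 C2 where 2: "0 \<le> C2" "\<And>w B x. smooth_in K w \<Longrightarrow> derivs_bounded N2 K w B \<Longrightarrow> x \<in> L \<Longrightarrow>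
      norm (pderivs vs (osc H Q ?c' w) x) \<le> C2 * B"
    using snoc.IH[OF smooth_mult_dx[OF snoc.prems]] by meson
  have "norm (pderivs (vs @ [v]) (osc H Q c w) x) \<le> (C1 + C2) * B"
    if w: "smooth_in K w" and B: "derivs_bounded (max N1 (Suc N2)) K w B" and x: "x \<in> L" for w B x
  proof -
    have xW: "x \<in> W" using x L by auto
    note dw = smooth_in_dt[OF w]
    have "pderivs (vs @ [v]) (osc H Q c w) x = pderivs vs (\<lambda>x. frechet_derivative (osc H Q c w)
      (at x) v) x"
      by (simp add: pderivs_append)
    also have "\<dots> = pderivs vs (\<lambda>x. osc H Q (dx v c) w x + osc H Q ?c' (dt w) x) x"
    proof (rule pderivs_cong_open[OF W _ xW])
      fix y assume "y \<in> W"
      from frechet_derivative_at[OF osc_has_derivative[OF H snoc.prems w this], THEN fun_cong, of v]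
      show "frechet_derivative (osc H Q c w) (at y) v = osc H Q (dx v c) w y + osc H Q ?c' (dt w)
        y" by simp
    qed
    also have "\<dots> = pderivs vs (osc H Q (dx v c) w) x + pderivs vs (osc H Q ?c' (dt w)) x"
      by (intro pderivs_add[OF W _ _ xW] smooth_osc H smooth_dx smooth_mult_dx snoc.prems w dw)
    also have "norm \<dots> \<le> C1 * B + C2 * B"
      using derivs_bounded_mono[OF B, of N1] derivs_bounded_dt[OF derivs_bounded_mono[OF B, of
        "Suc N2"]] x
      by (intro norm_triangle_mono 1 2 w dw) auto
    finally show ?thesis by (simp add: distrib_right)
  qed
  then show ?case using 1(1) 2(1)
    by (intro exI[of _ "max N1 (Suc N2)"] exI[of _ "C1 + C2"]) auto
qed

lemma osc_derivs_bounded: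
  assumes H: "weight H" and c: "smooth_on D c" and L: "compact L" "L \<subseteq> W"
  shows "\<exists>N C. 0 \<le> C \<and> (\<forall>w B. smooth_in K w \<and> derivs_bounded N K w B \<longrightarrow>
    derivs_bounded n L (osc H Q c w) (C * B))"
proof -
  have "\<exists>N C. \<forall>vs. 0 \<le> C vs \<and> (\<forall>w B. smooth_in K w \<and> derivs_bounded (N vs) K w B \<longrightarrow>
    (\<forall>x\<in>L. norm (pderivs vs (osc H Q c w) x) \<le> C vs * B))"
    using osc_pderivs_bound[OF assms] by metis
  then obtain N C where NC: "\<And>vs. 0 \<le> C vs" "\<And>vs w B x. smooth_in K w \<Longrightarrow> derivs_bounded (N vs)
    K w B \<Longrightarrow> x \<in> L \<Longrightarrow>
    norm (pderivs vs (osc H Q c w) x) \<le> C vs * B"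
    by blast
  define F where "F = {vs :: 'a list. set vs \<subseteq> Basis \<and> length vs \<le> n}"
  have F: "finite F" unfolding F_def by (rule finite_lists_length_le[OF finite_Basis])
  have C: "0 \<le> (\<Sum>vs\<in>F. C vs)" using NC(1) by (simp add: sum_nonneg)
  show ?thesis
  proof (intro exI[of _ "\<Sum>vs\<in>F. N vs"] exI[of _ "\<Sum>vs\<in>F. C vs"] conjI C allI impI)
    fix w B
    assume "smooth_in K w \<and> derivs_bounded (\<Sum>vs\<in>F. N vs) K w B"
    then have w: "smooth_in K w" and B: "derivs_bounded (\<Sum>vs\<in>F. N vs) K w B" by auto
    have B0: "0 \<le> B" using B by (simp add: derivs_bounded_def)
    show "derivs_bounded n L (osc H Q c w) ((\<Sum>vs\<in>F. C vs) * B)"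
      unfolding derivs_bounded_def
    proof (intro conjI allI ballI impI)
      show "0 \<le> (\<Sum>vs\<in>F. C vs) * B" using C B0 by simp
      fix vs :: "'a list" and x assume x: "x \<in> L" and "set vs \<subseteq> Basis \<and> length vs \<le> n"
      then have vs: "vs \<in> F" by (simp add: F_def)
      have "N vs \<le> (\<Sum>vs\<in>F. N vs)" using F vs by (simp add: member_le_sum)
      then have "norm (pderivs vs (osc H Q c w) x) \<le> C vs * B"
        using NC(2)[OF w derivs_bounded_mono[OF B] x] by blast
      also have "\<dots> \<le> (\<Sum>vs\<in>F. C vs) * B"
        using F vs NC(1) B0 by (intro mult_right_mono member_le_sum) auto
      finally show "norm (pderivs vs (osc H Q c w) x) \<le> (\<Sum>vs\<in>F. C vs) * B" .
    qed
  qed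
qed

end


subsection \<open>Evaluation of the regularised integrals\<close>

lemma
  fixes R :: "real \<Rightarrow> complex"
  assumes R: "continuous_on UNIV R" "\<And>\<omega>. \<omega> \<notin> {-M..M} \<Longrightarrow> R \<omega> = 0"
    and c: "continuous_fibre K c x" "continuous_fibre K Q x" "smooth_in K w"
  defines "F \<equiv> \<lambda>u \<omega>. R \<omega> * (c (fst u, x) * cis (\<omega> * (snd u - Q (fst u, x))) * w u)"
  shows integral_frequency_outer: "(LINT z|lborel. F (fst z) (snd z)) =
    (LINT \<omega>|lborel. R \<omega> * slice c Q w x \<omega>)"
    and integral_frequency_inner: "(LINT z|lborel. F (fst z) (snd z)) =
      (LINT u|lborel. LINT \<omega>|lborel. F u \<omega>)"
proof -
  have "compact K" using c(3) by (simp add: smooth_in_def)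
  have "integrable lborel (\<lambda>z. F (fst z) (snd z))"
  proof (rule integrable_continuous_compact_support)
    show "compact (K \<times> {-M..M})" using \<open>compact K\<close> by (intro compact_Times compact_Icc)
    have "continuous_on (K \<times> {-M..M}) (\<lambda>z. case z of (u, \<omega>) \<Rightarrow> c (fst u, x) * cis (\<omega> * (snd u - Q
      (fst u, x))) * w u)"
      by (rule continuous_on_subset[OF continuous_integrand[OF c]]) auto
    moreover have "continuous_on (K \<times> {-M..M}) (\<lambda>z. R (snd z))"
      by (rule continuous_on_compose2[OF R(1)]) (auto intro: continuous_on_snd)
    ultimately show "continuous_on (K \<times> {-M..M}) (\<lambda>z. F (fst z) (snd z))"
      unfolding F_def case_prod_beta by (rule continuous_on_mult[rotated])
    show "F (fst z) (snd z) = 0" if "z \<notin> K \<times> {-M..M}" for z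
      using that R(2)[of "snd z"] smooth_in_outside[OF c(3), of "fst z"]
      by (cases z) (auto simp: F_def)
  qed
  then have int: "integrable (lborel \<Otimes>\<^sub>M lborel) (case_prod F)"
    by (simp add: lborel_prod case_prod_beta')
  have "(LINT z|lborel. F (fst z) (snd z)) = (LINT z|(lborel \<Otimes>\<^sub>M lborel). (case_prod F) z)"
    by (simp add: lborel_prod case_prod_beta')
  moreover have "\<dots> = (LINT \<omega>|lborel. LINT u|lborel. F u \<omega>)"
    using lborel_pair.integral_snd[OF int] by simp
  moreover have "(LINT z|(lborel \<Otimes>\<^sub>M lborel). (case_prod F) z) = (LINT u|lborel. LINT \<omega>|lborel. F u \<omega>)"
    using lborel_pair.integral_fst[OF int] by simp
  moreover have "(LINT u|lborel. F u \<omega>) = R \<omega> * slice c Q w x \<omega>" for \<omega>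
    unfolding F_def slice_def by simp
  ultimately show "(LINT z|lborel. F (fst z) (snd z)) = (LINT \<omega>|lborel. R \<omega> * slice c Q w x \<omega>)"
    "(LINT z|lborel. F (fst z) (snd z)) = (LINT u|lborel. LINT \<omega>|lborel. F u \<omega>)"
    by simp_all
qed

lemma compact_subset_Icc:
  fixes S :: "real set" assumes "compact S" shows "\<exists>M. S \<subseteq> {-M..M}"
proof -
  obtain M where "\<forall>x\<in>S. norm x \<le> M" using compact_imp_bounded[OF assms] unfolding bounded_iff by blast
  then show ?thesis by (intro exI[of _ M]) (auto simp: abs_le_iff)
qed

text \<open>The cutoff makes the integrand compactly supported, so Fubini applies; as the cutoff is removed,
  dominated convergence applies to the integral over the frequency.\<close>

lemma has_osc_integral_osc:
  assumes H: "weight H" and c: "continuous_fibre K c x" "continuous_fibre K Q x" "smooth_in K w"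
  shows "has_osc_integral (\<lambda>(u, \<omega>). H \<omega> * (c (fst u, x) * cis (\<omega> * (snd u - Q (fst u, x))) * w u))
    (osc H Q c w x)"
  unfolding has_osc_integral_def
proof (intro allI impI)
  fix \<rho> :: "real \<Rightarrow> complex"
  assume "test_fun UNIV \<rho> \<and> \<rho> 0 = 1"
  then obtain S where \<rho>: "smooth_on UNIV \<rho>" "\<rho> 0 = 1" and S: "compact S" "\<And>\<omega>. \<omega> \<notin> S \<Longrightarrow> \<rho> \<omega> = 0"
    unfolding test_fun_def by blast
  have \<rho>S: "smooth_in S \<rho>" using \<rho> S by (simp add: smooth_in_def)
  have cont\<rho>: "continuous_on UNIV \<rho>" by (rule smooth_in_continuous[OF \<rho>S])
  obtain B where B: "0 \<le> B" "\<And>\<omega>. norm (\<rho> \<omega>) \<le> B" using smooth_in_bounded[OF \<rho>S] by blast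
  obtain M where M: "S \<subseteq> {-M..M}" using compact_subset_Icc[OF S(1)] by blast
  have contH: "continuous_on UNIV H" using H by (simp add: weight_def)
  let ?F = "\<lambda>(u, \<omega>). H \<omega> * (c (fst u, x) * cis (\<omega> * (snd u - Q (fst u, x))) * w u)"
  have eq: "(LINT z|lborel. \<rho> (\<epsilon> *\<^sub>R snd z) * ?F z) = (LINT \<omega>|lborel. \<rho> (\<epsilon> * \<omega>) *
    (H \<omega> * slice c Q w x \<omega>))"
    if \<epsilon>: "0 < \<epsilon>" for \<epsilon> :: real
  proof -
    have "(LINT z|lborel. (\<rho> (\<epsilon> * snd z) * H (snd z)) *
        (c (fst (fst z), x) * cis (snd z * (snd (fst z) - Q (fst (fst z), x))) * w (fst z)))
      = (LINT \<omega>|lborel. (\<rho> (\<epsilon> * \<omega>) * H \<omega>) * slice c Q w x \<omega>)"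
    proof (rule integral_frequency_outer[where M="M / \<epsilon>", OF _ _ c])
      show "continuous_on UNIV (\<lambda>\<omega>. \<rho> (\<epsilon> * \<omega>) * H \<omega>)"
        by (intro continuous_on_mult contH continuous_on_compose2[OF cont\<rho>] continuous_intros) auto
      show "\<rho> (\<epsilon> * \<omega>) * H \<omega> = 0" if "\<omega> \<notin> {- (M / \<epsilon>)..M / \<epsilon>}" for \<omega>
      proof -
        have "\<epsilon> * \<omega> \<notin> {-M..M}" using that \<epsilon> by (auto simp: field_simps)
        then have "\<epsilon> * \<omega> \<notin> S" using M by blast
        then show ?thesis using S(2) by simp
      qed
    qed
    then show ?thesis by (simp add: case_prod_beta' mult.assoc)
  qed
  show "((\<lambda>\<epsilon>. LINT z|lborel. \<rho> (\<epsilon> *\<^sub>R snd z) * ?F z) \<longlongrightarrow> osc H Q c w x) (at_right 0)"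
    unfolding tendsto_at_iff_sequentially o_def
  proof (intro allI impI)
    fix X :: "nat \<Rightarrow> real"
    assume X: "\<forall>i. X i \<in> {0<..} - {0}" "X \<longlonglongrightarrow> 0"
    have "(\<lambda>i. LINT \<omega>|lborel. \<rho> (X i * \<omega>) * (H \<omega> * slice c Q w x \<omega>)) \<longlonglongrightarrow>
        (LINT \<omega>|lborel. H \<omega> * slice c Q w x \<omega>)"
    proof (rule integral_dominated_convergence[where w="\<lambda>\<omega>. B * norm (H \<omega> * slice c Q w x \<omega>)"])
      note int = weighted_slice_integrable[OF H c]
      show "(\<lambda>\<omega>. H \<omega> * slice c Q w x \<omega>) \<in> borel_measurable lborel" using int by simp
      have "(\<lambda>\<omega>. \<rho> (X i * \<omega>)) \<in> borel_measurable borel" for i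
        by (intro borel_measurable_continuous_onI continuous_on_compose2[OF cont\<rho>]
          continuous_intros) auto
      then show "(\<lambda>\<omega>. \<rho> (X i * \<omega>) * (H \<omega> * slice c Q w x \<omega>)) \<in> borel_measurable lborel" for i
        using borel_measurable_times[of _ lborel, OF _ borel_measurable_integrable[OF int]] by simp
      show "integrable lborel (\<lambda>\<omega>. B * norm (H \<omega> * slice c Q w x \<omega>))"
        using int by (intro integrable_mult_right integrable_norm)
      show "AE \<omega> in lborel. (\<lambda>i. \<rho> (X i * \<omega>) * (H \<omega> * slice c Q w x \<omega>)) \<longlonglongrightarrow> H \<omega> * slice c Q w x \<omega>"
      proof (rule AE_I2)
        fix \<omega> :: real
        have "(\<lambda>i. X i * \<omega>) \<longlonglongrightarrow> 0 * \<omega>" using X(2) by (intro tendsto_intros)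
        moreover have "isCont \<rho> (0 * \<omega>)" using cont\<rho> by (simp add: continuous_on_eq_continuous_at)
        ultimately have "(\<lambda>i. \<rho> (X i * \<omega>)) \<longlonglongrightarrow> \<rho> (0 * \<omega>)" by (rule isCont_tendsto_compose[rotated])
        then have "(\<lambda>i. \<rho> (X i * \<omega>) * (H \<omega> * slice c Q w x \<omega>)) \<longlonglongrightarrow> 1 * (H \<omega> * slice c Q w x \<omega>)"
          using \<rho>(2) by (intro tendsto_mult tendsto_const) simp
        then show "(\<lambda>i. \<rho> (X i * \<omega>) * (H \<omega> * slice c Q w x \<omega>)) \<longlonglongrightarrow> H \<omega> * slice c Q w x \<omega>" by simp
      qed
      show "AE \<omega> in lborel. norm (\<rho> (X i * \<omega>) * (H \<omega> * slice c Q w x \<omega>)) \<le> B * norm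
        (H \<omega> * slice c Q w x \<omega>)" for i
        using B by (intro AE_I2) (simp add: norm_mult mult_right_mono)
    qed
    then show "(\<lambda>i. LINT z|lborel. \<rho> (X i *\<^sub>R snd z) * ?F z) \<longlonglongrightarrow> osc H Q c w x"
      using X(1) by (simp add: eq osc_def del: scaleR_conv_of_real real_scaleR_def)
  qed
qed

text \<open>The value of an oscillatory integral is unique only because there is a cutoff function at all.\<close>

lemma osc_integral_unique:
  fixes F :: "'u::euclidean_space \<times> real \<Rightarrow> complex"
  assumes "has_osc_integral F I" shows "osc_integral F = I"
  unfolding osc_integral_def
proof (rule the_equality, rule assms)
  fix J assume "has_osc_integral F J"
  obtain \<rho> :: "real \<Rightarrow> complex" where "test_fun UNIV \<rho> \<and> \<rho> 0 = 1" using cutoff_exists by blast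
  then have "((\<lambda>\<epsilon>::real. LINT z|lborel. \<rho> (\<epsilon> *\<^sub>R snd z) * F z) \<longlongrightarrow> J) (at_right 0)"
    "((\<lambda>\<epsilon>::real. LINT z|lborel. \<rho> (\<epsilon> *\<^sub>R snd z) * F z) \<longlongrightarrow> I) (at_right 0)"
    using \<open>has_osc_integral F J\<close> assms unfolding has_osc_integral_def by blast+
  then show "J = I" by (rule tendsto_unique[OF trivial_limit_at_right_real])
qed

lemma osc_add:
  assumes "weight H" "continuous_fibre K c x" "continuous_fibre K Q x" "smooth_in K w1" "smooth_in K w2"
  shows "osc H Q c (\<lambda>u. w1 u + w2 u) x = osc H Q c w1 x + osc H Q c w2 x"
  unfolding osc_def slice_add[OF assms(2-)] distrib_left
  using weighted_slice_integrable[OF assms(1-4)] weighted_slice_integrable[OF assms(1-3,5)] by simp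

lemma osc_cmult: "osc H Q c (\<lambda>u. a * w u) x = a * osc H Q c w x"
  unfolding osc_def slice_cmult by (subst integral_mult_right_zero[symmetric]) (simp add: algebra_simps)

lemma osc_add_weight:
  assumes "weight H1" "weight H2" "continuous_fibre K c x" "continuous_fibre K Q x" "smooth_in K w"
  shows "osc (\<lambda>\<omega>. H1 \<omega> + H2 \<omega>) Q c w x = osc H1 Q c w x + osc H2 Q c w x"
  unfolding osc_def distrib_right
  using weighted_slice_integrable[OF assms(1,3-)] weighted_slice_integrable[OF assms(2,3-)] by simp

text \<open>A weight of compact support contributes an integral operator whose kernel involves the (inverse)
  Fourier transform of the weight.\<close>

definition weight_transform :: "(real \<Rightarrow> complex) \<Rightarrow> real \<Rightarrow> complex" where
  "weight_transform R s = (LINT \<omega>|lborel. R \<omega> * cis (\<omega> * s))"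

lemma osc_compact_weight:
  assumes "continuous_on UNIV R" "\<And>\<omega>. \<omega> \<notin> {-M..M} \<Longrightarrow> R \<omega> = 0"
    and "continuous_fibre K c x" "continuous_fibre K Q x" "smooth_in K w"
  shows "(LINT u|lborel. c (fst u, x) * weight_transform R (snd u - Q (fst u, x)) * w u) = osc R Q c w x"
proof -
  have "c (fst u, x) * weight_transform R (snd u - Q (fst u, x)) * w u =
      (LINT \<omega>|lborel. R \<omega> * (c (fst u, x) * cis (\<omega> * (snd u - Q (fst u, x))) * w u))" for u
    unfolding weight_transform_def integral_mult_right_zero[symmetric] integral_mult_left_zero[symmetric]
    by (simp add: algebra_simps)
  then show ?thesis
    using integral_frequency_outer[OF assms] integral_frequency_inner[OF assms] by (simp add: osc_def)
qed

lemma smooth_weight_transform: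
  assumes "continuous_on UNIV R" "\<And>\<omega>. \<omega> \<notin> {-M..M} \<Longrightarrow> R \<omega> = 0"
  shows "smooth_on UNIV (weight_transform R)"
proof -
  have der: "(weight_transform R has_derivative (\<lambda>v. v *\<^sub>R weight_transform
    (\<lambda>\<omega>. \<i> * complex_of_real \<omega> * R \<omega>) s)) (at s)"
    if R: "continuous_on UNIV R" "\<And>\<omega>. \<omega> \<notin> {-M..M} \<Longrightarrow> R \<omega> = 0" for R s
  proof -
    have "((\<lambda>s. LINT \<omega>|lborel. R \<omega> * cis (\<omega> * s)) has_derivative
        (\<lambda>v. LINT \<omega>|lborel. v *\<^sub>R ((\<i> * complex_of_real \<omega> * R \<omega>) * cis (\<omega> * s)))) (at s)"
    proof (rule has_derivative_integral_dominated[OF zero_less_one, where m="\<lambda>\<omega>. norm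
      (complex_of_real \<omega> * R \<omega>)"])
      have contR: "continuous_on A R" for A using R(1) continuous_on_subset by blast
      show "integrable lborel (\<lambda>\<omega>. R \<omega> * cis (\<omega> * s))" for s
        by (rule integrable_continuous_compact_support[of "{-M..M}"])
          (auto intro!: continuous_intros contR simp: R(2))
      show "integrable lborel (\<lambda>\<omega>. norm (complex_of_real \<omega> * R \<omega>))"
        by (rule integrable_norm, rule integrable_continuous_compact_support[of "{-M..M}"])
          (auto intro!: continuous_intros contR simp: R(2))
      fix s \<omega> v :: real
      show "((\<lambda>s. R \<omega> * cis (\<omega> * s)) has_derivative (\<lambda>v. v *\<^sub>R (\<i> * complex_of_real \<omega> * R \<omega> * cis
        (\<omega> * s)))) (at s)"
        by (rule has_derivative_eq_rhs, rule has_derivative_mult_right, rule has_derivative_cis,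
            rule has_derivative_mult_right[OF has_derivative_ident])
          (simp add: fun_eq_iff scaleR_conv_of_real algebra_simps)
      show "norm (v *\<^sub>R (\<i> * complex_of_real \<omega> * R \<omega> * cis (\<omega> * s))) \<le> norm
        (complex_of_real \<omega> * R \<omega>) * norm v"
        by (simp add: norm_mult)
    qed
    then show ?thesis by (simp add: weight_transform_def[abs_def])
  qed
  have "diff_n n UNIV (weight_transform R)" for n
    using assms
  proof (induction n arbitrary: R)
    case 0
    then show ?case using der by (auto simp: differentiable_def)
  next
    case (Suc n)
    have "diff_n n UNIV (weight_transform (\<lambda>\<omega>. \<i> * complex_of_real \<omega> * R \<omega>))"
      by (intro Suc.IH) (use Suc.prems in \<open>auto intro!: continuous_intros\<close>)
    then show ?case
      by (intro diff_n_SucI[OF open_UNIV der] diff_n_linear[OF open_UNIV bounded_linear_scaleR_right])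
        (use Suc.prems in auto)
  qed
  then show ?thesis by (simp add: smooth_on_iff_diff_n)
qed

section \<open>The Radon transform as a Fourier integral operator\<close>

text \<open>Points of the horizontal hyperplane; with the last component \<open>q y\<close> added they form the graph.\<close>

definition embed :: "real^'m \<Rightarrow> real^('m option)" where
  "embed y = (\<chi> i. case i of Some j \<Rightarrow> y $ j | None \<Rightarrow> 0)"

definition graph_tangent :: "(real^'m \<Rightarrow> real) \<Rightarrow> real^'m \<Rightarrow> real^'m \<Rightarrow> real^('m option)" where
  "graph_tangent q y v = embed v + (grad q y \<bullet> v) *\<^sub>R axis None 1"

definition phase_Q :: "real^('m::finite option)^('m option) \<Rightarrow> (real^'m \<Rightarrow> real) \<Rightarrow>
    (real^'m) \<times> (real^('m option)) \<Rightarrow> real" where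
  "phase_Q A q = (\<lambda>(y, x). xT q y x \<bullet> (A *v xT q y x))"

text \<open>The norm of \<open>\<nabla>\<^sub>x\<psi>\<close> without its factor \<open>\<bar>\<omega>\<bar>\<close>.\<close>

definition phase_amplitude :: "real^('m::finite option)^('m option) \<Rightarrow> (real^'m \<Rightarrow> real) \<Rightarrow>
    (real^'m) \<times> (real^('m option)) \<Rightarrow> complex" where
  "phase_amplitude A q = (\<lambda>(y, x). complex_of_real (2 * norm (A *v xT q y x)))"

definition off_graph :: "(real^'m) set \<Rightarrow> (real^'m \<Rightarrow> real) \<Rightarrow> ((real^'m) \<times> (real^('m option))) set" where
  "off_graph \<Omega> q = {(y, x). y \<in> \<Omega> \<and> xT q y x \<noteq> 0}"

lemma bounded_linear_embed: "bounded_linear (embed :: real^'m::finite \<Rightarrow> _)"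
  by (rule linear_conv_bounded_linear[THEN iffD1])
    (auto simp: linear_iff embed_def vec_eq_iff split: option.splits)

lemma graph_tangent_0 [simp]: "graph_tangent q y 0 = 0"
  using linear_0[OF bounded_linear.linear[OF bounded_linear_embed]] by (simp add: graph_tangent_def)

lemma graph_pt_eq: "graph_pt q y = embed y + q y *\<^sub>R axis None 1"
  by (auto simp: graph_pt_def embed_def vec_eq_iff axis_def split: option.splits)

lemma xT_eq_0_iff: "xT q y x = 0 \<longleftrightarrow> x = graph_pt q y"
  by (simp add: xT_def)

lemma sum_UNIV_option: "(\<Sum>i\<in>(UNIV :: 'm::finite option set). f i) = f None + (\<Sum>j\<in>UNIV. f (Some j))"
  by (simp add: UNIV_option_conv sum.reindex)

lemma grad_eqI:
  fixes f :: "'a::euclidean_space \<Rightarrow> real"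
  assumes "(f has_derivative (\<lambda>v. g \<bullet> v)) (at x)" shows "grad f x = g"
  using frechet_derivative_at[OF assms, symmetric] by (simp add: grad_def euclidean_representation)

lemma grad_inner:
  fixes f :: "'a::euclidean_space \<Rightarrow> real"
  assumes "f differentiable (at x)" shows "grad f x \<bullet> v = frechet_derivative f (at x) v"
proof -
  have lin: "linear (frechet_derivative f (at x))" using assms by (rule linear_frechet_derivative)
  have "grad f x \<bullet> v = (\<Sum>b\<in>Basis. (v \<bullet> b) *\<^sub>R frechet_derivative f (at x) b)"
    unfolding grad_def inner_sum_left inner_scaleR_left real_scaleR_def
    by (intro sum.cong refl) (simp add: inner_commute)
  also have "\<dots> = frechet_derivative f (at x) (\<Sum>b\<in>Basis. (v \<bullet> b) *\<^sub>R b)"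
    using lin by (simp add: linear_sum linear_scale)
  also have "\<dots> = frechet_derivative f (at x) v" by (simp only: euclidean_representation)
  finally show ?thesis .
qed

text \<open>The matrix \<open>B\<close> is the transpose of the differential of the graph map.\<close>

lemma B_mat_inner: "(B_mat q y *v p) \<bullet> v = p \<bullet> graph_tangent q y v"
proof -
  have "(B_mat q y *v p) \<bullet> v = (\<Sum>i\<in>UNIV. (p $ Some i + grad q y $ i * p $ None) * v $ i)"
    by (simp add: inner_vec_def matrix_vector_mult_def B_mat_def sum_UNIV_option if_distrib[of
      "\<lambda>x. x * _"] add.commute
        cong: if_cong)
  also have "\<dots> = (\<Sum>i\<in>UNIV. p $ Some i * v $ i) + p $ None * (grad q y \<bullet> v)"
    by (simp add: algebra_simps sum.distrib inner_vec_def sum_distrib_left)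
  also have "\<dots> = p \<bullet> graph_tangent q y v"
    by (simp add: inner_vec_def[of p] sum_UNIV_option graph_tangent_def embed_def axis_def)
  finally show ?thesis .
qed

locale radon_setting =
  fixes \<Omega> :: "(real^'m::finite) set" and q :: "real^'m \<Rightarrow> real" and A :: "real^('m option)^('m option)"
  assumes \<Omega>: "open \<Omega>" and q: "smooth_on \<Omega> q" and sym: "transpose A = A" and pos: "pos_def A"
begin

lemma A_sym: "v \<bullet> (A *v w) = (A *v v) \<bullet> w"
  by (metis dot_lmul_matrix sym vector_transpose_matrix)

lemma quadratic_form_derivative: "z \<bullet> (A *v d) + d \<bullet> (A *v z) = 2 * ((A *v z) \<bullet> d)"
  using A_sym[of z d] inner_commute[of d "A *v z"] by simp

lemma A_eq_0_iff: "A *v z = 0 \<longleftrightarrow> z = 0"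
  using pos unfolding pos_def_def by (metis inner_zero_right less_irrefl matrix_vector_mult_0_right)

lemma A_pos: "z \<noteq> 0 \<Longrightarrow> 0 < z \<bullet> (A *v z)"
  using pos by (simp add: pos_def_def)

lemma q_has_derivative: "y \<in> \<Omega> \<Longrightarrow> (q has_derivative (\<lambda>v. grad q y \<bullet> v)) (at y)"
  using smooth_on_has_derivative[OF q] grad_inner[OF smooth_on_differentiable[OF q]] by simp

lemma smooth_graph_pt: "smooth_on \<Omega> (graph_pt q)"
  unfolding graph_pt_eq[abs_def]
  by (intro smooth_on_add smooth_on_scaleR q smooth_on_const smooth_on_bounded_linear
    bounded_linear_embed)

lemma graph_pt_has_derivative:
  "y \<in> \<Omega> \<Longrightarrow> (graph_pt q has_derivative graph_tangent q y) (at y)"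
  unfolding graph_pt_eq[abs_def] graph_tangent_def[abs_def]
  by (intro has_derivative_add has_derivative_scaleR_left q_has_derivative
    bounded_linear_imp_has_derivative
      bounded_linear_embed)

lemma smooth_xT: "smooth_on (\<Omega> \<times> UNIV) (\<lambda>(y, x). xT q y x)"
  unfolding xT_def case_prod_beta
  by (intro smooth_on_diff smooth_on_snd smooth_on_id smooth_on_compose[OF _ smooth_graph_pt]
    smooth_on_fst) auto

lemma xT_has_derivative:
  assumes "y \<in> \<Omega>"
  shows "((\<lambda>z. xT q (fst z) (snd z)) has_derivative (\<lambda>v. snd v - graph_tangent q y (fst v))) (at (y, x))"
  unfolding xT_def
  by (intro has_derivative_diff has_derivative_snd has_derivative_ident
      has_derivative_compose[of fst fst "(y, x)" UNIV "graph_pt q" "graph_tangent q y"]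
      bounded_linear_imp_has_derivative bounded_linear_fst)
    (use graph_pt_has_derivative[OF assms] in simp)

lemma smooth_phase_Q: "smooth_on (\<Omega> \<times> UNIV) (phase_Q A q)"
proof -
  have "smooth_on (\<Omega> \<times> UNIV) (\<lambda>z. (case z of (y, x) \<Rightarrow> xT q y x) \<bullet> (A *v (case z of (y, x) \<Rightarrow> xT q y x)))"
    by (intro smooth_on_inner smooth_xT smooth_on_linear_comp[OF matrix_vector_mul_bounded_linear])
  then show ?thesis by (simp add: phase_Q_def case_prod_beta')
qed

lemma phase_Q_has_derivative:
  assumes "y \<in> \<Omega>"
  shows "(phase_Q A q has_derivative (\<lambda>v. 2 * ((A *v xT q y x) \<bullet> (snd v - graph_tangent q y
    (fst v))))) (at (y, x))"
proof -
  have "((\<lambda>z. xT q (fst z) (snd z) \<bullet> (A *v xT q (fst z) (snd z))) has_derivative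
     (\<lambda>v. xT q y x \<bullet> (A *v (snd v - graph_tangent q y (fst v))) + (snd v - graph_tangent q y
       (fst v)) \<bullet> (A *v xT q y x))) (at (y, x))"
    using has_derivative_inner[OF xT_has_derivative[OF assms]
      bounded_linear.has_derivative[OF matrix_vector_mul_bounded_linear[of A] xT_has_derivative[OF
        assms]], of x] by simp
  then show ?thesis by (simp add: phase_Q_def case_prod_beta' quadratic_form_derivative)
qed

lemma open_off_graph: "open (off_graph \<Omega> q)"
proof -
  have "open ((\<Omega> \<times> UNIV) \<inter> (\<lambda>(y, x). xT q y x) -` (- {0}))"
    by (rule continuous_open_preimage[OF smooth_on_continuous_on[OF smooth_xT]])
      (use \<Omega> in \<open>auto intro: open_Times\<close>)
  also have "(\<Omega> \<times> UNIV) \<inter> (\<lambda>(y, x). xT q y x) -` (- {0}) = off_graph \<Omega> q"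
    by (auto simp: off_graph_def)
  finally show ?thesis .
qed

lemma smooth_phase_amplitude: "smooth_on (off_graph \<Omega> q) (phase_amplitude A q)"
proof -
  have sub: "off_graph \<Omega> q \<subseteq> \<Omega> \<times> UNIV" by (auto simp: off_graph_def)
  have "smooth_on (off_graph \<Omega> q) (\<lambda>z. complex_of_real (2 * norm (A *v (case z of (y, x) \<Rightarrow> xT q y x))))"
    by (intro smooth_on_of_real smooth_on_mult smooth_on_const smooth_on_norm
        smooth_on_linear_comp[OF matrix_vector_mul_bounded_linear] smooth_on_subset[OF smooth_xT sub])
      (auto simp: off_graph_def A_eq_0_iff)
  then show ?thesis by (simp add: phase_amplitude_def case_prod_beta')
qed

lemma off_graphI: "y \<in> \<Omega> \<Longrightarrow> x \<notin> graph_pt q ` \<Omega> \<Longrightarrow> (y, x) \<in> off_graph \<Omega> q"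
  by (auto simp: off_graph_def xT_eq_0_iff)

subsection \<open>The phase function\<close>

lemma radon_phase_eq: "radon_phase A q ((y, t), x, \<omega>) = \<omega> * (t - phase_Q A q (y, x))"
  by (simp add: radon_phase_def phase_Q_def)

lemma phase_Q_pullback_has_derivative:
  assumes "y \<in> \<Omega>"
  shows "((\<lambda>z. phase_Q A q (fst (fst z), fst (snd z))) has_derivative
     (\<lambda>v. 2 * ((A *v xT q y x) \<bullet> (fst (snd v) - graph_tangent q y (fst (fst v)))))) (at ((y, t), x, \<omega>))"
proof -
  have proj: "((\<lambda>z. (fst (fst z), fst (snd z))) has_derivative (\<lambda>z. (fst (fst z), fst (snd z)))) (at
    ((y, t), x, \<omega>))"
    by (intro has_derivative_Pair has_derivative_fst has_derivative_snd has_derivative_ident)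
  show ?thesis
    using has_derivative_compose[OF proj, of "phase_Q A q"
        "\<lambda>v. 2 * ((A *v xT q y x) \<bullet> (snd v - graph_tangent q y (fst v)))"]
      phase_Q_has_derivative[OF assms, of x] by simp
qed

lemma radon_phase_eq_fun:
  "radon_phase A q = (\<lambda>z. snd (snd z) * (snd (fst z) - phase_Q A q (fst (fst z), fst (snd z))))"
  by (auto simp: fun_eq_iff radon_phase_eq)

lemma radon_phase_has_derivative:
  assumes "y \<in> \<Omega>"
  shows "(radon_phase A q has_derivative (\<lambda>((v, s), u, r).
    r * (t - phase_Q A q (y, x)) + \<omega> * (s - 2 * ((A *v xT q y x) \<bullet> (u - graph_tangent q y v))))) (at
      ((y, t), x, \<omega>))"
proof -
  have "((\<lambda>z. snd (snd z) * (snd (fst z) - phase_Q A q (fst (fst z), fst (snd z)))) has_derivative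
     (\<lambda>v. \<omega> * (snd (fst v) - 2 * ((A *v xT q y x) \<bullet> (fst (snd v) - graph_tangent q y (fst (fst v)))))
       + snd (snd v) * (t - phase_Q A q (y, x)))) (at ((y, t), x, \<omega>))"
    by (rule has_derivative_eq_rhs, rule has_derivative_mult, rule has_derivative_snd, rule
      has_derivative_snd,
        rule has_derivative_ident, rule has_derivative_diff, rule has_derivative_snd, rule
          has_derivative_fst,
        rule has_derivative_ident, rule phase_Q_pullback_has_derivative[OF assms]) simp
  then show ?thesis by (simp add: radon_phase_eq_fun case_prod_beta' add.commute)
qed

lemma
  assumes "y \<in> \<Omega>"
  shows grad_base_radon_phase: "grad (\<lambda>u'. radon_phase A q (u', x, \<omega>)) (y, t)
      = ((2 * \<omega>) *\<^sub>R (B_mat q y *v (A *v xT q y x)), \<omega>)"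
    and grad_frequency_radon_phase: "grad (\<lambda>\<theta>. radon_phase A q ((y, t), x, \<theta>)) \<omega> = t - phase_Q A q
      (y, x)"
proof -
  have "((\<lambda>u'. radon_phase A q (u', x, \<omega>)) has_derivative
      (\<lambda>v. ((2 * \<omega>) *\<^sub>R (B_mat q y *v (A *v xT q y x)), \<omega>) \<bullet> v)) (at (y, t))"
    by (rule has_derivative_eq_rhs[OF has_derivative_compose[where f="\<lambda>u'. (u', x, \<omega>)" and
          f'="\<lambda>v. (v, 0)" and g="radon_phase A q", OF _ radon_phase_has_derivative[OF assms]]])
      (auto intro!: derivative_eq_intros simp: fun_eq_iff zero_prod_def B_mat_inner algebra_simps)
  then show "grad (\<lambda>u'. radon_phase A q (u', x, \<omega>)) (y, t) = ((2 * \<omega>) *\<^sub>R (B_mat q y *v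
    (A *v xT q y x)), \<omega>)"
    by (rule grad_eqI)
  have "((\<lambda>\<theta>. radon_phase A q ((y, t), x, \<theta>)) has_derivative
      (\<lambda>v. (t - phase_Q A q (y, x)) \<bullet> v)) (at \<omega>)"
    unfolding radon_phase_eq by (auto intro!: derivative_eq_intros simp: mult.commute)
  then show "grad (\<lambda>\<theta>. radon_phase A q ((y, t), x, \<theta>)) \<omega> = t - phase_Q A q (y, x)"
    by (rule grad_eqI)
qed

text \<open>The transform takes its amplitude from this gradient over every \<open>y\<close>, also outside \<open>\<Omega>\<close>; the phase is a
  polynomial in \<open>x\<close> there, too.\<close>

lemma grad_space_radon_phase:
  "grad (\<lambda>x'. radon_phase A q ((y, t), x', \<omega>)) x = - ((2 * \<omega>) *\<^sub>R (A *v xT q y x))"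
proof -
  have *: "((\<lambda>x'. xT q y x') has_derivative (\<lambda>v. v)) (at x)"
    unfolding xT_def by (auto intro!: derivative_eq_intros)
  have "((\<lambda>x'. xT q y x' \<bullet> (A *v xT q y x')) has_derivative
      (\<lambda>v. xT q y x \<bullet> (A *v v) + v \<bullet> (A *v xT q y x))) (at x)"
    by (rule has_derivative_inner[OF * bounded_linear.has_derivative[OF
      matrix_vector_mul_bounded_linear *]])
  then have "((\<lambda>x'. \<omega> * (t - xT q y x' \<bullet> (A *v xT q y x'))) has_derivative
      (\<lambda>v. \<omega> * (0 - (xT q y x \<bullet> (A *v v) + v \<bullet> (A *v xT q y x))))) (at x)"
    by (intro has_derivative_mult_right has_derivative_diff has_derivative_const)
  then have "((\<lambda>x'. radon_phase A q ((y, t), x', \<omega>)) has_derivative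
      (\<lambda>v. (- ((2 * \<omega>) *\<^sub>R (A *v xT q y x))) \<bullet> v)) (at x)"
    unfolding quadratic_form_derivative by (simp add: radon_phase_def algebra_simps)
  then show ?thesis by (rule grad_eqI)
qed

lemma smooth_radon_phase: "smooth_on ((\<Omega> \<times> UNIV) \<times> UNIV) (radon_phase A q)"
  unfolding radon_phase_eq_fun
  by (intro smooth_on_mult smooth_on_diff smooth_on_compose[OF _ smooth_phase_Q] smooth_on_Pair
      smooth_on_fst smooth_on_snd smooth_on_id) auto

text \<open>The gradients are controlled by three facts: the \<open>t\<close>-derivative of the phase is \<open>\<omega>\<close>, its \<open>x\<close>-gradient
  is \<open>- 2 \<omega> A x\<^sub>T\<close>, and its mixed derivative in \<open>t\<close> and \<open>\<omega>\<close> is \<open>1\<close>.\<close>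

lemma nondegenerate_radon_phase:
  "nondegenerate_phase (\<Omega> \<times> {0<..}) (- graph_pt q ` \<Omega>) (radon_phase A q)"
  unfolding nondegenerate_phase_def
proof (intro conjI ballI allI impI)
  show "smooth_on ((\<Omega> \<times> {0<..}) \<times> (- graph_pt q ` \<Omega>) \<times> (UNIV - {0})) (radon_phase A q)"
    by (rule smooth_on_subset[OF smooth_radon_phase]) auto
  fix u :: "(real^'m) \<times> real" and v :: "real^('m option)" and \<theta> \<tau> :: real
  assume u: "u \<in> \<Omega> \<times> {0<..}" and v: "v \<in> - graph_pt q ` \<Omega>" and \<theta>: "\<theta> \<noteq> 0"
  obtain y t where yt: "u = (y, t)" "y \<in> \<Omega>" using u by auto
  show "radon_phase A q (u, v, \<tau> *\<^sub>R \<theta>) = \<tau> * radon_phase A q (u, v, \<theta>)"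
    by (simp add: yt radon_phase_eq)
  show "(grad (\<lambda>u'. radon_phase A q (u', v, \<theta>)) u, grad (\<lambda>\<theta>'. radon_phase A q (u, v, \<theta>')) \<theta>) \<noteq> 0"
    using \<theta> by (simp add: yt(1) grad_base_radon_phase[OF yt(2)] zero_prod_def)
  have "xT q y v \<noteq> 0" using v yt(2) by (auto simp: xT_eq_0_iff)
  then show "(grad (\<lambda>v'. radon_phase A q (u, v', \<theta>)) v, grad (\<lambda>\<theta>'. radon_phase A q (u, v, \<theta>')) \<theta>) \<noteq> 0"
    using \<theta> by (simp add: yt(1) grad_space_radon_phase zero_prod_def A_eq_0_iff)
  let ?D = "\<lambda>b. grad (\<lambda>z. frechet_derivative (radon_phase A q) (at z) (0, 0, b)) (u, v, \<theta>)"
  have "?D 1 \<noteq> 0"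
  proof
    assume 0: "?D 1 = 0"
    let ?S = "(\<Omega> \<times> UNIV) \<times> UNIV :: (((real^'m) \<times> real) \<times> (real^('m option)) \<times> real) set"
    have S: "open ?S" using \<Omega> by (intro open_Times) auto
    have sm: "smooth_on ?S (\<lambda>z. frechet_derivative (radon_phase A q) (at z) (0, 0, 1))"
      by (rule smooth_on_frechet[OF S smooth_radon_phase])
    have mem: "(u, v, \<theta>) \<in> ?S" using yt by auto
    have "frechet_derivative (radon_phase A q) (at z) (0, 0, 1) = snd (fst z) - phase_Q A q (fst
      (fst z), fst (snd z))"
      if "z \<in> ?S" for z
    proof -
      obtain y' t' x' \<omega>' where z: "z = ((y', t'), x', \<omega>')" by (metis surj_pair)
      then have y': "y' \<in> \<Omega>" using that by simp
      show ?thesis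
        using frechet_derivative_at[OF radon_phase_has_derivative[OF y'], of t' x' \<omega>',
          THEN fun_cong, of "(0, 0, 1)"]
        by (simp add: z zero_prod_def)
    qed
    then have "frechet_derivative (\<lambda>z. frechet_derivative (radon_phase A q) (at z) (0, 0, 1)) (at
      (u, v, \<theta>))
      = frechet_derivative (\<lambda>z. snd (fst z) - phase_Q A q (fst (fst z), fst (snd z))) (at (u, v, \<theta>))"
      by (rule frechet_derivative_cong_open[OF S mem])
    also have "\<dots> = (\<lambda>w. snd (fst w) - 2 * ((A *v xT q y v) \<bullet> (fst (snd w) - graph_tangent q y (fst
      (fst w)))))"
    proof (rule frechet_derivative_at[symmetric])
      show "((\<lambda>z. snd (fst z) - phase_Q A q (fst (fst z), fst (snd z))) has_derivative
        (\<lambda>w. snd (fst w) - 2 * ((A *v xT q y v) \<bullet> (fst (snd w) - graph_tangent q y (fst (fst w))))))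
          (at (u, v, \<theta>))"
        unfolding yt(1)
        by (intro has_derivative_diff has_derivative_snd has_derivative_fst has_derivative_ident
            phase_Q_pullback_has_derivative yt(2))
    qed
    finally have "?D 1 \<bullet> ((0, 1), 0, 0) = 1"
      using grad_inner[OF smooth_on_differentiable[OF sm mem], of "((0, 1), 0, 0)"]
      by simp
    then show False using 0 by simp
  qed
  then show "let D = ?D in inj_on D Basis \<and> independent (D ` Basis)"
    by (simp add: Let_def)
qed

subsection \<open>Mapping properties\<close>

lemma continuous_on_graph_pt: "Y \<subseteq> \<Omega> \<Longrightarrow> continuous_on Y (graph_pt q)"
  using smooth_on_continuous_on[OF smooth_graph_pt] continuous_on_subset by blast

lemma
  assumes "fst ` K \<subseteq> \<Omega>"
  shows continuous_fibre_Q: "continuous_fibre K (phase_Q A q) x"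
    and continuous_fibre_amplitude: "continuous_fibre K (phase_amplitude A q) x"
proof -
  have z: "continuous_on (fst ` K) (\<lambda>y. xT q y x)"
    unfolding xT_def by (intro continuous_intros continuous_on_graph_pt assms)
  have Az: "continuous_on (fst ` K) (\<lambda>y. A *v xT q y x)"
    by (rule bounded_linear.continuous_on[OF matrix_vector_mul_bounded_linear z])
  show "continuous_fibre K (phase_Q A q) x" "continuous_fibre K (phase_amplitude A q) x"
    unfolding continuous_fibre_def phase_Q_def phase_amplitude_def
    by (auto intro!: continuous_intros z Az)
qed

lemma compact_projection: "compact K \<Longrightarrow> compact (fst ` K)"
  by (intro compact_continuous_image continuous_on_fst continuous_on_id)

text \<open>The complement of the whole graph need not be open, but the complement of the compact part over the
  support of a test function is; all smoothness in \<open>x\<close> is established there.\<close>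

lemma off_graph_phase:
  assumes "compact K" "fst ` K \<subseteq> \<Omega>"
  shows "smooth_phase (off_graph \<Omega> q) (phase_Q A q) K (- graph_pt q ` fst ` K)"
proof
  show "smooth_on (off_graph \<Omega> q) (phase_Q A q)"
    by (rule smooth_on_subset[OF smooth_phase_Q]) (auto simp: off_graph_def)
  show "open (- graph_pt q ` fst ` K)"
    using compact_continuous_image[OF continuous_on_graph_pt compact_projection] assms
    by (intro open_Compl compact_imp_closed) auto
  show "fst ` K \<times> (- graph_pt q ` fst ` K) \<subseteq> off_graph \<Omega> q"
    using assms(2) by (force simp: off_graph_def xT_eq_0_iff)
qed (use assms open_off_graph in auto)

lemma test_fun_smooth_in:
  assumes "test_fun (\<Omega> \<times> {0<..}) w"
  obtains K where "smooth_in K w" "fst ` K \<subseteq> \<Omega>"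
  using assms unfolding test_fun_def smooth_in_def by (metis fst_image_times image_mono order_trans
    empty_subsetI)

lemma osc_operator_radon_phase:
  assumes H: "weight H" and w: "smooth_in K w" "fst ` K \<subseteq> \<Omega>"
    and a: "\<And>y t x \<omega>. a ((y, t), x, \<omega>) = H \<omega> * phase_amplitude A q (y, x)"
  shows "osc_operator (radon_phase A q) a f w = f (osc H (phase_Q A q) (phase_amplitude A q) w)"
proof -
  have "osc_integral (\<lambda>(u, \<theta>). exp (\<i> * complex_of_real (radon_phase A q (u, x, \<theta>))) * a (u, x, \<theta>) * w u)
      = osc H (phase_Q A q) (phase_amplitude A q) w x" for x
  proof (rule osc_integral_unique)
    have "(\<lambda>(u, \<theta>). exp (\<i> * complex_of_real (radon_phase A q (u, x, \<theta>))) * a (u, x, \<theta>) * w u)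
        = (\<lambda>(u, \<omega>). H \<omega> * (phase_amplitude A q (fst u, x) * cis (\<omega> * (snd u - phase_Q A q (fst u,
          x))) * w u))"
      by (auto simp: fun_eq_iff radon_phase_eq a cis_conv_exp)
    then show "has_osc_integral (\<lambda>(u, \<theta>). exp (\<i> * complex_of_real (radon_phase A q (u, x, \<theta>))) * a
      (u, x, \<theta>) * w u)
        (osc H (phase_Q A q) (phase_amplitude A q) w x)"
      using has_osc_integral_osc[OF H continuous_fibre_amplitude continuous_fibre_Q] w by simp
  qed
  then show ?thesis by (simp add: osc_operator_def)
qed

lemma weight_abs: "weight (\<lambda>\<omega>. complex_of_real \<bar>\<omega>\<bar>)"
  unfolding weight_def by (auto intro!: continuous_intros exI[of _ 1])

lemma radon_eq:
  assumes "smooth_in K w" "fst ` K \<subseteq> \<Omega>"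
  shows "radon A q f w = f (osc (\<lambda>\<omega>. complex_of_real \<bar>\<omega>\<bar>) (phase_Q A q) (phase_amplitude A q) w)"
  unfolding radon_def
  by (rule osc_operator_radon_phase[OF weight_abs assms])
    (simp add: grad_space_radon_phase phase_amplitude_def abs_mult)

lemma compact_distribution_functional:
  assumes "compact_distribution (- graph_pt q ` \<Omega>) f" "compact (K :: ((real^'m) \<times> real) set)"
    "fst ` K \<subseteq> \<Omega>"
  shows "cont_functional (- graph_pt q ` fst ` K) f"
proof -
  obtain Kf where "Kf \<subseteq> - graph_pt q ` \<Omega>" "\<forall>W. open W \<and> Kf \<subseteq> W \<longrightarrow> cont_functional W f"
    using assms(1) unfolding compact_distribution_def by blast
  moreover have "open (- graph_pt q ` fst ` K)"
    using off_graph_phase[OF assms(2,3)] by (simp add: smooth_phase_def)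
  ultimately show ?thesis using assms(3) by blast
qed

text \<open>The distribution \<open>f\<close> is continuous in finitely many derivatives on a compact set off the part of the
  graph in question, and these are bounded by derivatives of the test function.\<close>

lemma distribution_radon:
  assumes f: "compact_distribution (- graph_pt q ` \<Omega>) f"
  shows "distribution (\<Omega> \<times> {0<..}) (radon A q f)"
  unfolding distribution_def
proof (intro conjI allI impI)
  let ?G = "osc (\<lambda>\<omega>. complex_of_real \<bar>\<omega>\<bar>) (phase_Q A q) (phase_amplitude A q)"
  {
    fix g h :: "(real^'m) \<times> real \<Rightarrow> complex"
    assume "test_fun (\<Omega> \<times> {0<..}) g \<and> test_fun (\<Omega> \<times> {0<..}) h"
    then obtain Kg Kh where gh: "smooth_in Kg g" "fst ` Kg \<subseteq> \<Omega>" "smooth_in Kh h" "fst ` Kh \<subseteq> \<Omega>"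
      using test_fun_smooth_in by metis
    define K where "K = Kg \<union> Kh"
    have K: "compact K" "fst ` K \<subseteq> \<Omega>" "smooth_in K g" "smooth_in K h"
      using gh by (auto simp: K_def smooth_in_def image_Un)
    interpret ph: smooth_phase "off_graph \<Omega> q" "phase_Q A q" K "- graph_pt q ` fst ` K"
      by (rule off_graph_phase[OF K(1,2)])
    have "?G (\<lambda>u. g u + h u) = (\<lambda>x. ?G g x + ?G h x)"
      by (intro ext osc_add[where K=K] weight_abs continuous_fibre_amplitude continuous_fibre_Q K)
    moreover have "f (\<lambda>x. ?G g x + ?G h x) = f (?G g) + f (?G h)"
      using compact_distribution_functional[OF f K(1,2)]
        ph.smooth_osc[OF weight_abs smooth_phase_amplitude K(3)] ph.smooth_osc[OF weight_abs
          smooth_phase_amplitude K(4)]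
      unfolding cont_functional_def by blast
    ultimately show "radon A q f (\<lambda>u. g u + h u) = radon A q f g + radon A q f h"
      by (simp add: radon_eq[OF K(3,2)] radon_eq[OF K(4,2)] radon_eq[OF smooth_in_add[OF K(3,4)] K(2)])
  next
    fix c and g :: "(real^'m) \<times> real \<Rightarrow> complex"
    assume "test_fun (\<Omega> \<times> {0<..}) g"
    then obtain K where K: "smooth_in K g" "fst ` K \<subseteq> \<Omega>" by (rule test_fun_smooth_in)
    then have cK: "compact K" by (simp add: smooth_in_def)
    interpret ph: smooth_phase "off_graph \<Omega> q" "phase_Q A q" K "- graph_pt q ` fst ` K"
      by (rule off_graph_phase[OF cK K(2)])
    have "?G (\<lambda>u. c * g u) = (\<lambda>x. c * ?G g x)" by (intro ext osc_cmult)
    moreover have "f (\<lambda>x. c * ?G g x) = c * f (?G g)"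
      using compact_distribution_functional[OF f cK K(2)] ph.smooth_osc[OF weight_abs
        smooth_phase_amplitude K(1)]
      unfolding cont_functional_def by blast
    ultimately show "radon A q f (\<lambda>u. c * g u) = c * radon A q f g"
      by (simp add: radon_eq[OF K] radon_eq[OF smooth_in_cmult[OF K(1)] K(2)])
  next
    fix K :: "((real^'m) \<times> real) set" assume "compact K \<and> K \<subseteq> \<Omega> \<times> {0<..}"
    then have K: "compact K" "fst ` K \<subseteq> \<Omega>" by auto
    interpret ph: smooth_phase "off_graph \<Omega> q" "phase_Q A q" K "- graph_pt q ` fst ` K"
      by (rule off_graph_phase[OF K])
    obtain C N L where CNL: "compact L \<and> L \<subseteq> - graph_pt q ` fst ` K \<and>
      (\<forall>g B. smooth_on (- graph_pt q ` fst ` K) g \<and> derivs_bounded N L g B \<longrightarrow> norm (f g) \<le> C * B)"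
      using compact_distribution_functional[OF f K, unfolded cont_functional_def] 
      by (elim conjE exE) (rule that, rule conjI, assumption, rule conjI, assumption, assumption)
    then have L: "compact L" "L \<subseteq> - graph_pt q ` fst ` K" by simp_all
    have C: "norm (f g) \<le> C * B" if "smooth_on (- graph_pt q ` fst ` K) g"
      "derivs_bounded N L g B" for g B
      using CNL that by simp
    obtain N' C' where C': "\<And>w B. smooth_in K w \<Longrightarrow> derivs_bounded N' K w B \<Longrightarrow> derivs_bounded N L
      (?G w) (C' * B)"
      using ph.osc_derivs_bounded[OF weight_abs smooth_phase_amplitude L, of N] by blast
    have "norm (radon A q f g) \<le> (C * C') * B"
      if "test_fun (\<Omega> \<times> {0<..}) g" "\<forall>x. x \<notin> K \<longrightarrow> g x = 0" "derivs_bounded N' K g B" for g B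
    proof -
      have g: "smooth_in K g" using that K by (simp add: smooth_in_def test_fun_def)
      show ?thesis
        using C[OF ph.smooth_osc[OF weight_abs smooth_phase_amplitude g] C'[OF g that(3)]]
        by (simp add: radon_eq[OF g K(2)] mult.assoc)
    qed
    then show "\<exists>C N. \<forall>g B. test_fun (\<Omega> \<times> {0<..}) g \<and> (\<forall>x. x \<notin> K \<longrightarrow> g x = 0) \<and> derivs_bounded N K g B
        \<longrightarrow> norm (radon A q f g) \<le> C * B"
      by blast
  }
qed

text \<open>The remainder \<open>R\<close> of \<open>\<bar>\<omega>\<bar>\<close> after subtracting a smooth \<open>h\<close> has compact support, so its contribution has
  the smooth kernel \<open>k\<close>; \<open>h\<close> itself gives the symbol \<open>a\<close>.\<close>

lemma fourier_integral_operator_radon: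
  "fourier_integral_operator (\<Omega> \<times> {0<..}) (- graph_pt q ` \<Omega>) (radon_phase A q) (radon A q)"
  unfolding fourier_integral_operator_def
proof (intro conjI nondegenerate_radon_phase allI impI distribution_radon)
  let ?U = "\<Omega> \<times> {0::real<..}" and ?V = "- graph_pt q ` \<Omega>"
  let ?Q = "phase_Q A q" and ?c = "phase_amplitude A q"
  obtain h :: "real \<Rightarrow> real" where h: "smooth_on UNIV h" "\<And>x. 1 \<le> \<bar>x\<bar> \<Longrightarrow> h x = \<bar>x\<bar>"
    using smooth_abs_exists by blast
  define R where "R \<omega> = complex_of_real (\<bar>\<omega>\<bar> - h \<omega>)" for \<omega>
  have conth: "continuous_on UNIV h" by (rule smooth_on_continuous_on[OF h(1)])
  have R: "continuous_on UNIV R" "\<And>\<omega>. \<omega> \<notin> {-1..1} \<Longrightarrow> R \<omega> = 0"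
    unfolding R_def using h(2) by (auto intro!: continuous_intros conth)
  obtain B where B: "\<And>\<omega>. \<bar>h \<omega>\<bar> \<le> B * (1 + \<bar>\<omega>\<bar>)"
    using smooth_abs_symbol_estimate[OF h, of "[]"] by auto
  have wh: "weight (\<lambda>\<omega>. complex_of_real (h \<omega>))"
    unfolding weight_def using B by (auto intro!: continuous_intros conth)
  have "norm (R \<omega>) \<le> (1 + B) * (1 + \<bar>\<omega>\<bar>)" for \<omega>
    using B[of \<omega>] abs_triangle_ineq4[of "\<bar>\<omega>\<bar>" "h \<omega>"] by (simp add: R_def algebra_simps flip:
      of_real_diff)
  then have wR: "weight R" using R(1) by (auto simp: weight_def)
  define a where "a = (\<lambda>(u :: (real^'m) \<times> real, x, \<omega>). ?c (fst u, x) * complex_of_real (h \<omega>))"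
  define k where "k = (\<lambda>(u :: (real^'m) \<times> real, x). ?c (fst u, x) * weight_transform R (snd u - ?Q
    (fst u, x)))"
  let ?D = "{z. (fst (fst z), snd z) \<in> off_graph \<Omega> q} :: (((real^'m) \<times> real) \<times> (real^('m option))) set"
  have D: "open ?D" "?U \<times> ?V \<subseteq> ?D"
    using open_vimage[OF open_off_graph, of "\<lambda>z. (fst (fst z), snd z)"] off_graphI
    by (auto simp: vimage_def continuous_intros)
  have cD: "smooth_on ?D (\<lambda>z. ?c (fst (fst z), snd z))"
    by (intro smooth_on_compose[OF _ smooth_phase_amplitude] smooth_on_Pair smooth_on_fst
      smooth_on_snd smooth_on_id) auto
  have "symbol_amplitude ?U ?V 1 a"
    using symbol_amplitude_product[OF D cD h] by (simp add: a_def)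
  moreover have "smooth_on (?U \<times> ?V) k"
  proof -
    have QD: "smooth_on ?D (\<lambda>z. ?Q (fst (fst z), snd z))"
      by (intro smooth_on_compose[OF _ smooth_phase_Q] smooth_on_Pair smooth_on_fst smooth_on_snd
        smooth_on_id)
        (auto simp: off_graph_def)
    have "smooth_on ?D (\<lambda>z. ?c (fst (fst z), snd z) * weight_transform R (snd (fst z) - ?Q (fst
      (fst z), snd z)))"
      by (intro smooth_on_mult cD smooth_on_compose[OF _ smooth_weight_transform[OF R]] smooth_on_diff QD
          smooth_on_snd smooth_on_fst smooth_on_id) auto
    then show ?thesis using smooth_on_subset[OF _ D(2)] by (simp add: k_def case_prod_beta')
  qed
  moreover have "radon A q f w = osc_operator (radon_phase A q) a f w + kernel_operator k f w"
    if f: "compact_distribution ?V f" and w: "test_fun ?U w" for f w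
  proof -
    obtain K where K: "smooth_in K w" "fst ` K \<subseteq> \<Omega>" using w by (rule test_fun_smooth_in)
    then have cK: "compact K" by (simp add: smooth_in_def)
    interpret ph: smooth_phase "off_graph \<Omega> q" ?Q K "- graph_pt q ` fst ` K"
      by (rule off_graph_phase[OF cK K(2)])
    let ?G = "\<lambda>H. osc H ?Q ?c w"
    have op: "osc_operator (radon_phase A q) a f w = f (?G (\<lambda>\<omega>. complex_of_real (h \<omega>)))"
      by (rule osc_operator_radon_phase[OF wh K]) (simp add: a_def)
    have ker: "kernel_operator k f w = f (?G R)"
      unfolding kernel_operator_def k_def
      using osc_compact_weight[OF R continuous_fibre_amplitude[OF K(2)] continuous_fibre_Q[OF K(2)] K(1)]
      by (simp add: case_prod_beta')
    have "?G (\<lambda>\<omega>. complex_of_real \<bar>\<omega>\<bar>) = ?G (\<lambda>\<omega>. complex_of_real (h \<omega>) + R \<omega>)"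
      by (simp add: R_def)
    also have "\<dots> = (\<lambda>x. ?G (\<lambda>\<omega>. complex_of_real (h \<omega>)) x + ?G R x)"
      by (intro ext osc_add_weight[where K=K] wh wR continuous_fibre_amplitude continuous_fibre_Q K)
    finally have "radon A q f w = f (\<lambda>x. ?G (\<lambda>\<omega>. complex_of_real (h \<omega>)) x + ?G R x)"
      by (simp add: radon_eq[OF K])
    also have "\<dots> = f (?G (\<lambda>\<omega>. complex_of_real (h \<omega>))) + f (?G R)"
      using compact_distribution_functional[OF f cK K(2)]
        ph.smooth_osc[OF wh smooth_phase_amplitude K(1)] ph.smooth_osc[OF wR smooth_phase_amplitude K(1)]
      unfolding cont_functional_def by blast
    finally show ?thesis by (simp add: op ker)
  qed
  ultimately show "\<exists>m a k. symbol_amplitude ?U ?V m a \<and> smooth_on (?U \<times> ?V) k \<and>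
      (\<forall>f w. compact_distribution ?V f \<and> test_fun ?U w \<longrightarrow>
        radon A q f w = osc_operator (radon_phase A q) a f w + kernel_operator k f w)"
    by blast
qed

end

section \<open>Determinants and folds\<close>

text \<open>A permutation other than the identity cannot weakly decrease the rank of every index without
  fixing it, because the ranks of all indices add up to the same number after permuting. So only
  the diagonal survives in the Leibniz formula.\<close>

lemma det_triangular:
  fixes M :: "'a::comm_ring_1^'n^'n" and r :: "'n \<Rightarrow> nat"
  assumes tri: "\<And>i j. M $ i $ j \<noteq> 0 \<Longrightarrow> i = j \<or> r j < r i"
  shows "det M = (\<Prod>i\<in>UNIV. M $ i $ i)"
proof -
  have zero: "of_int (sign p) * (\<Prod>i\<in>UNIV. M $ i $ p i) = 0"
    if p: "p \<in> {p. p permutes UNIV} - {id}" for p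
  proof (rule ccontr)
    assume "of_int (sign p) * (\<Prod>i\<in>UNIV. M $ i $ p i) \<noteq> 0"
    then have "(\<Prod>i\<in>UNIV. M $ i $ p i) \<noteq> 0" by auto
    then have nz: "M $ i $ p i \<noteq> 0" for i using prod_zero[of UNIV "\<lambda>i. M $ i $ p i"] by
      (metis UNIV_I finite)
    have le: "r (p i) \<le> r i" for i using tri[OF nz[of i]] by auto
    have "\<exists>i. p i \<noteq> i" using p by (auto simp: fun_eq_iff)
    then obtain i where "p i \<noteq> i" by blast
    then have "r (p i) < r i" using tri[OF nz[of i]] by auto
    then have "(\<Sum>i\<in>UNIV. r (p i)) < (\<Sum>i\<in>UNIV. r i)"
      using le by (intro sum_strict_mono_ex1) auto
    moreover have "(\<Sum>i\<in>UNIV. r (p i)) = (\<Sum>i\<in>UNIV. r i)"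
      using sum.permute[of p UNIV r] p by (simp add: o_def)
    ultimately show False by simp
  qed
  have "det M = (\<Sum>p\<in>{id}. of_int (sign p) * (\<Prod>i\<in>UNIV. M $ i $ p i))"
    unfolding det_def by (rule sum.mono_neutral_right) (use zero in \<open>auto simp: permutes_id\<close>)
  then show ?thesis by simp
qed

text \<open>At a zero of \<open>h\<close> the differential of \<open>\<kappa> h\<close> is \<open>\<kappa> dh\<close>. If it does not vanish on some kernel vector,
  it is not zero, and that vector is transversal to its kernel, which is a hyperplane.\<close>

lemma only_folds_coordI:
  fixes f :: "real^'k \<Rightarrow> real^'k"
  assumes T: "open T" "W \<subseteq> T" and f: "smooth_on T f"
    and jac: "\<And>p. p \<in> T \<Longrightarrow> jac_det f p = \<kappa> p * h p"
    and \<kappa>: "\<And>p. p \<in> W \<Longrightarrow> \<kappa> differentiable (at p)" "\<And>p. p \<in> W \<Longrightarrow> \<kappa> p \<noteq> 0"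
    and h: "\<And>p. p \<in> W \<Longrightarrow> (h has_derivative h' p) (at p)"
    and ker: "\<And>p. p \<in> W \<Longrightarrow> h p = 0 \<Longrightarrow> \<exists>v. frechet_derivative f (at p) v = 0 \<and> h' p v \<noteq> 0"
  shows "only_folds_coord W f"
  unfolding only_folds_coord_def
proof (intro conjI ballI impI)
  show "smooth_on W f" using f T(2) by (rule smooth_on_subset)
  fix p assume p: "p \<in> W" and "jac_det f p = 0"
  then have h0: "h p = 0" using jac[of p] \<kappa>(2)[OF p] T(2) by auto
  obtain v where v: "frechet_derivative f (at p) v = 0" "h' p v \<noteq> 0" using ker[OF p h0] by blast
  have "((\<lambda>p. \<kappa> p * h p) has_derivative (\<lambda>v. \<kappa> p * h' p v + frechet_derivative \<kappa> (at p) v * h p)) (at p)"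
    by (intro has_derivative_mult has_derivative_frechet \<kappa>(1) h p)
  then have "(jac_det f has_derivative (\<lambda>v. \<kappa> p * h' p v)) (at p)"
    using has_derivative_cong_open[OF T(1), of p "jac_det f" "\<lambda>p. \<kappa> p * h p"] jac p T(2) h0 by auto
  then have D: "frechet_derivative (jac_det f) (at p) = (\<lambda>v. \<kappa> p * h' p v)"
    by (rule frechet_derivative_at[symmetric])
  have Dv: "\<kappa> p * h' p v \<noteq> 0" using v(2) \<kappa>(2)[OF p] by simp
  then show "p \<in> S1 W f"
    using p \<open>jac_det f p = 0\<close> by (auto simp: S1_def D dest: fun_cong[of _ _ v])
  have lin: "linear (h' p)" using h[OF p] by (rule has_derivative_linear)
  have linf: "linear (frechet_derivative f (at p))"
    using smooth_on_differentiable[OF f] p T(2) by (intro linear_frechet_derivative) auto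
  show "{v + w |v w. frechet_derivative f (at p) v = 0 \<and> w \<in> S1_tangent f p} = UNIV"
  proof (intro set_eqI iffI UNIV_I)
    fix u :: "real^'k"
    define a where "a = h' p u / h' p v"
    have "u = a *\<^sub>R v + (u - a *\<^sub>R v)" by simp
    moreover have "frechet_derivative f (at p) (a *\<^sub>R v) = 0"
      using v(1) linear_scale[OF linf] by simp
    moreover have "u - a *\<^sub>R v \<in> S1_tangent f p"
      using v(2) by (simp add: S1_tangent_def D linear_diff[OF lin] linear_scale[OF lin] a_def)
    ultimately show "u \<in> {v + w |v w. frechet_derivative f (at p) v = 0 \<and> w \<in> S1_tangent f p}" by blast
  qed
qed

lemma jac_det_eq:
  "(f has_derivative f') (at p) \<Longrightarrow> jac_det f p = det (matrix f')"
  by (simp add: jac_det_def jacobian_def frechet_derivative_at[symmetric])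

lemma matrix_entry: "matrix L $ i $ j = L (axis j 1) $ i"
  by (simp add: matrix_def)

lemma prod_UNIV_parameters:
  "(\<Prod>i\<in>(UNIV :: ('m::finite + ('m option + unit)) set). f i) =
    (\<Prod>j\<in>UNIV. f (Inl j)) * ((\<Prod>j\<in>UNIV. f (Inr (Inl j))) * f (Inr (Inr ())))"
proof -
  have "(\<Prod>i\<in>UNIV. f i) = (\<Prod>i\<in>UNIV <+> (UNIV <+> UNIV). f i)"
    by (simp only: UNIV_Plus_UNIV)
  then show ?thesis by (simp add: prod.Plus o_def UNIV_unit del: UNIV_Plus_UNIV)
qed

lemma prod_UNIV_option: "(\<Prod>i\<in>(UNIV :: 'm::finite option set). f i) = f None * (\<Prod>j\<in>UNIV. f (Some j))"
  by (simp add: UNIV_option_conv prod.reindex)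

section \<open>Coordinates on the canonical relation and its targets\<close>

definition restr :: "real^('m option) \<Rightarrow> real^'m" where
  "restr v = (\<chi> j. v $ Some j)"

definition glue :: "(real^'m) \<times> real \<Rightarrow> real^('m option)" where
  "glue = (\<lambda>(v, t). \<chi> i. case i of Some j \<Rightarrow> v $ j | None \<Rightarrow> t)"

definition params :: "(real^'m::finite) \<times> (real^('m option)) \<times> real \<Rightarrow> real^('m + ('m option
  + unit))" where
  "params = (\<lambda>(y, x, \<omega>). \<chi> i. case i of Inl j \<Rightarrow> y $ j | Inr k \<Rightarrow> (case k of Inl j \<Rightarrow> x $ j | Inr _ \<Rightarrow> \<omega>))"

lemma glue_nth [simp]: "glue (v, t) $ Some j = v $ j" "glue (v, t) $ None = t"
  by (simp_all add: glue_def)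

lemma restr_nth [simp]: "restr v $ j = v $ Some j"
  by (simp add: restr_def)

lemma vec_option_eqI: "restr v = restr w \<Longrightarrow> v $ None = w $ None \<Longrightarrow> v = w"
  by (simp add: vec_eq_iff) (metis not_Some_eq)

lemma restr_glue [simp]: "restr (glue (v, t)) = v"
  by (simp add: vec_eq_iff)

lemma glue_restr [simp]: "glue (restr v, v $ None) = v"
  by (rule vec_option_eqI) simp_all

lemma params_nth [simp]:
  "params (y, x, \<omega>) $ Inl j = y $ j" "params (y, x, \<omega>) $ Inr (Inl k) = x $ k" "params (y, x, \<omega>)
    $ Inr (Inr u) = \<omega>"
  by (simp_all add: params_def)

lemma par_params [simp]: "par_y (params (y, x, \<omega>)) = y" "par_x (params (y, x, \<omega>)) = x" "par_\<omega>
  (params (y, x, \<omega>)) = \<omega>"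
  by (simp_all add: par_y_def par_x_def par_\<omega>_def vec_eq_iff)

lemma params_par [simp]: "params (par_y p, par_x p, par_\<omega> p) = p"
  by (auto simp: params_def par_y_def par_x_def par_\<omega>_def vec_eq_iff split: sum.split)

lemma par_axis [simp]:
  "par_y (axis (Inl j) 1) = axis j 1" "par_x (axis (Inl j) 1) = 0" "par_\<omega> (axis (Inl j) 1) = 0"
  "par_y (axis (Inr (Inl k)) 1) = 0" "par_x (axis (Inr (Inl k)) 1) = axis k 1" "par_\<omega> (axis (Inr
    (Inl k)) 1) = 0"
  "par_y (axis (Inr (Inr u)) 1) = 0" "par_x (axis (Inr (Inr u)) 1) = 0" "par_\<omega> (axis (Inr (Inr u))
    1) = 1"
  by (simp_all add: par_y_def par_x_def par_\<omega>_def vec_eq_iff axis_def)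

lemma bounded_linear_par:
  "bounded_linear par_y" "bounded_linear par_x" "bounded_linear par_\<omega>"
  by (rule linear_conv_bounded_linear[THEN iffD1];
      simp add: linear_iff par_y_def par_x_def par_\<omega>_def vec_eq_iff)+

lemma bounded_linear_restr: "bounded_linear restr"
  by (rule linear_conv_bounded_linear[THEN iffD1]) (simp add: linear_iff vec_eq_iff)

lemma bounded_linear_glue: "bounded_linear glue"
  by (rule linear_conv_bounded_linear[THEN iffD1])
    (auto simp: linear_iff glue_def vec_eq_iff split: option.splits)

lemma bounded_linear_params: "bounded_linear params"
  by (rule linear_conv_bounded_linear[THEN iffD1])
    (auto simp: linear_iff params_def vec_eq_iff split: sum.splits)

lemma graph_pt_None [simp]: "graph_pt q y $ None = q y"
  by (simp add: graph_pt_def)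

lemma restr_xT: "restr (xT q y x) = restr x - y" "xT q y x $ None = x $ None - q y"
  by (simp_all add: xT_def vec_eq_iff graph_pt_def)

lemma inner_option: "v \<bullet> w = restr v \<bullet> restr w + v $ None * w $ None" for v w ::
  "real^('m::finite option)"
  by (simp add: inner_vec_def sum_UNIV_option)

lemma B_mat_eq: "B_mat q y *v v = restr v + v $ None *\<^sub>R grad q y"
  by (simp add: vec_eq_iff matrix_vector_mult_def B_mat_def sum_UNIV_option
      if_distrib[of "\<lambda>x. x * _"] cong: if_cong)

text \<open>Up to sign and a positive factor, this is the distance of \<open>x\<close> from the tangent plane of the graph at
  the point over \<open>y\<close>.\<close>

definition tangency :: "(real^'m::finite \<Rightarrow> real) \<Rightarrow> real^('m + ('m option + unit)) \<Rightarrow> real" where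
  "tangency q p = par_x p $ None - q (par_y p) - grad q (par_y p) \<bullet> (restr (par_x p) - par_y p)"


context radon_setting
begin

lemma smooth_grad: "smooth_on \<Omega> (grad q)"
  unfolding grad_def[abs_def]
  by (intro smooth_on_sum smooth_on_scaleR smooth_on_frechet \<Omega> q smooth_on_const)

abbreviation grad' :: "real^'m \<Rightarrow> real^'m \<Rightarrow> real^'m" where
  "grad' y \<equiv> frechet_derivative (grad q) (at y)"

lemma grad_has_derivative: "y \<in> \<Omega> \<Longrightarrow> (grad q has_derivative grad' y) (at y)"
  by (rule smooth_on_has_derivative[OF smooth_grad])

lemma grad_nth: "y \<in> \<Omega> \<Longrightarrow> grad q y $ j = frechet_derivative q (at y) (axis j 1)"
  using grad_inner[OF smooth_on_differentiable[OF q], of y "axis j 1"] by (simp add: inner_axis)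

lemma grad'_nth: "y \<in> \<Omega> \<Longrightarrow> grad' y (axis i 1) $ j = hessian q y $ i $ j"
proof -
  assume y: "y \<in> \<Omega>"
  have "((\<lambda>y. grad q y $ j) has_derivative (\<lambda>v. grad' y v $ j)) (at y)"
    by (rule bounded_linear.has_derivative[OF bounded_linear_vec_nth grad_has_derivative[OF y]])
  then have "(\<lambda>v. grad' y v $ j) = frechet_derivative (\<lambda>y. grad q y $ j) (at y)"
    by (rule frechet_derivative_at)
  also have "\<dots> = frechet_derivative (\<lambda>y. frechet_derivative q (at y) (axis j 1)) (at y)"
    by (rule frechet_derivative_cong_open[OF \<Omega> y grad_nth])
  finally show ?thesis by (simp add: hessian_def fun_eq_iff)
qed

lemma grad'_hessian: "y \<in> \<Omega> \<Longrightarrow> grad' y v \<bullet> w = v \<bullet> (hessian q y *v w)"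
proof -
  assume y: "y \<in> \<Omega>"
  have lin: "linear (grad' y)" using grad_has_derivative[OF y] by (rule has_derivative_linear)
  have v: "v = (\<Sum>i\<in>UNIV. v $ i *\<^sub>R axis i 1)"
    using basis_expansion[of v] by (simp add: scalar_mult_eq_scaleR)
  have "grad' y (\<Sum>i\<in>UNIV. v $ i *\<^sub>R axis i 1) \<bullet> w = (\<Sum>i\<in>UNIV. v $ i * (grad' y (axis i 1) \<bullet> w))"
    using lin by (simp add: linear_sum linear_scale inner_sum_left)
  also have "\<dots> = v \<bullet> (hessian q y *v w)"
    by (simp add: inner_vec_def grad'_nth[OF y] matrix_vector_mult_def)
  finally show ?thesis using v by simp
qed

lemma tangency_xT: "tangency q p = xT q (par_y p) (par_x p) $ None - grad q (par_y p) \<bullet> restr (xT q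
  (par_y p) (par_x p))"
  by (simp add: tangency_def restr_xT)

lemma has_derivative_par:
  "(par_y has_derivative par_y) (at p)" "(par_x has_derivative par_x) (at p)" "(par_\<omega>
    has_derivative par_\<omega>) (at p)"
  using bounded_linear_par by (auto intro: bounded_linear_imp_has_derivative)

lemma par_y_compose_has_derivative:
  "(f has_derivative f') (at (par_y p)) \<Longrightarrow> ((\<lambda>p. f (par_y p)) has_derivative (\<lambda>v. f' (par_y v))) (at p)"
  by (rule has_derivative_compose[OF has_derivative_par(1)])

lemma tangency_has_derivative:
  assumes "par_y p \<in> \<Omega>"
  shows "(tangency q has_derivative (\<lambda>v. par_x v $ None - grad q (par_y p) \<bullet> restr (par_x v)
    - grad' (par_y p) (par_y v) \<bullet> restr (xT q (par_y p) (par_x p)))) (at p)"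
proof -
  have "((\<lambda>p. par_x p $ None) has_derivative (\<lambda>v. par_x v $ None)) (at p)"
    by (rule bounded_linear.has_derivative[OF bounded_linear_vec_nth has_derivative_par(2)])
  moreover have "((\<lambda>p. restr (par_x p)) has_derivative (\<lambda>v. restr (par_x v))) (at p)"
    by (rule bounded_linear.has_derivative[OF bounded_linear_restr has_derivative_par(2)])
  ultimately have "(tangency q has_derivative (\<lambda>v. par_x v $ None - grad q (par_y p) \<bullet> par_y v -
      (grad q (par_y p) \<bullet> (restr (par_x v) - par_y v) + grad' (par_y p) (par_y v) \<bullet> (restr (par_x p)
        - par_y p)))) (at p)"
    unfolding tangency_def[abs_def]
    using par_y_compose_has_derivative[OF q_has_derivative[OF assms]]
      par_y_compose_has_derivative[OF grad_has_derivative[OF assms]]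
    by (intro has_derivative_diff has_derivative_inner has_derivative_par(1))
  then show ?thesis by (simp add: restr_xT inner_diff_right algebra_simps)
qed

lemma open_par_domain: "open {p. par_y p \<in> \<Omega> \<and> par_\<omega> p \<noteq> 0}"
proof -
  have "open (par_y -` \<Omega> \<inter> par_\<omega> -` (- {0}))"
    by (intro open_Int open_vimage \<Omega> linear_continuous_on bounded_linear_par) auto
  then show ?thesis by (simp add: vimage_def Collect_conj_eq)
qed

lemma smooth_par:
  "smooth_on S par_y" "smooth_on S par_x" "smooth_on S par_\<omega>"
  by (rule smooth_on_bounded_linear, rule bounded_linear_par)+

lemma smooth_xT_par: "smooth_on {p. par_y p \<in> \<Omega>} (\<lambda>p. xT q (par_y p) (par_x p))"
  unfolding xT_def by (intro smooth_on_diff smooth_par smooth_on_compose[OF _ smooth_graph_pt]) auto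

lemma xT_par_has_derivative:
  assumes "par_y p \<in> \<Omega>"
  shows "((\<lambda>p. xT q (par_y p) (par_x p)) has_derivative (\<lambda>v. par_x v - graph_tangent q (par_y p)
    (par_y v))) (at p)"
  unfolding xT_def
  by (intro has_derivative_diff has_derivative_par par_y_compose_has_derivative
    graph_pt_has_derivative assms)

lemma xT_par_nonzero: "p \<in> param_domain \<Omega> q \<Longrightarrow> xT q (par_y p) (par_x p) \<noteq> 0"
  by (auto simp: param_domain_def xT_eq_0_iff)

text \<open>If the tangency function vanishes, the last component of \<open>x\<^sub>T\<close> is a linear function of the others;
  so these cannot all be zero.\<close>

lemma restr_xT_nonzero:
  assumes "p \<in> param_domain \<Omega> q" "tangency q p = 0" shows "restr (xT q (par_y p) (par_x p)) \<noteq> 0"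
proof
  assume 0: "restr (xT q (par_y p) (par_x p)) = 0"
  then have "xT q (par_y p) (par_x p) $ None = 0" using assms(2) by (simp add: tangency_xT)
  then have "xT q (par_y p) (par_x p) = 0" using 0 by (intro vec_option_eqI) (simp_all add: vec_eq_iff)
  then show False using xT_par_nonzero[OF assms(1)] by simp
qed

lemma matrix_inv_A: "A *v (matrix_inv A *v v) = v" "matrix_inv A *v (A *v v) = v"
proof -
  have "inj ((*v) A)"
    by (rule injI) (metis A_eq_0_iff matrix_vector_mult_diff_distrib eq_iff_diff_eq_0)
  then have "invertible A" using matrix_left_invertible_injective[of A] invertible_left_inverse[of
    A] by blast
  then have "A ** matrix_inv A = mat 1" "matrix_inv A ** A = mat 1"
    using someI_ex[of "\<lambda>B. A ** B = mat 1 \<and> B ** A = mat 1"] by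
      (auto simp: invertible_def matrix_inv_def)
  then show "A *v (matrix_inv A *v v) = v" "matrix_inv A *v (A *v v) = v"
    by (simp_all add: matrix_vector_mul_assoc)
qed

end

section \<open>The two projections\<close>

lemma axis_component: "axis j a $ i = (if i = j then a else 0)"
  by (simp add: axis_def)

lemma restr_0 [simp]: "restr 0 = 0"
  by (simp add: vec_eq_iff)

lemma par_nth: "par_y p $ i = p $ Inl i" "par_x p $ k = p $ Inr (Inl k)" "par_\<omega> p = p $ Inr (Inr ())"
  by (simp_all add: par_y_def par_x_def par_\<omega>_def)

lemma glue_0 [simp]: "glue (0, 0) = 0"
  using linear_0[OF bounded_linear.linear[OF bounded_linear_glue]] by (simp add: zero_prod_def)

lemma params_0 [simp]: "params (0, 0, 0) = 0"
  using linear_0[OF bounded_linear.linear[OF bounded_linear_params]] by (simp add: zero_prod_def)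

lemma restr_scaleR: "restr (c *\<^sub>R v) = c *\<^sub>R restr v"
  by (simp add: vec_eq_iff)

text \<open>Linear coordinates on the targets, which order the components so that the Jacobian matrices are close
  to triangular. On the right, the covector is also freed from \<open>2 A\<close>, which leaves \<open>\<omega> x\<^sub>T\<close>.\<close>

definition target_coord_R :: "real^('m::finite option)^('m option) \<Rightarrow>
    (real^('m option)) \<times> (real^('m option)) \<Rightarrow> real^('m + ('m option + unit))" where
  "target_coord_R A = (\<lambda>(x, \<xi>). params (restr ((1/2) *\<^sub>R (matrix_inv A *v \<xi>)), x, ((1/2) *\<^sub>R
    (matrix_inv A *v \<xi>)) $ None))"

definition target_coord_L :: "((real^'m::finite) \<times> real) \<times> ((real^'m) \<times> real) \<Rightarrow> real^('m +
  ('m option + unit))" where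
  "target_coord_L = (\<lambda>((y, t), (\<eta>, \<omega>)). params (y, glue (\<eta>, t), \<omega>))"

lemma linear_bij_target_coord_L: "linear target_coord_L" "bij target_coord_L"
proof -
  have "bounded_linear (\<lambda>z. params (fst (fst z), glue (fst (snd z), snd (fst z)), snd (snd z)))"
    by (intro bounded_linear_compose[OF bounded_linear_params] bounded_linear_Pair
      bounded_linear_compose[OF bounded_linear_glue] bounded_linear_compose[OF bounded_linear_fst]
      bounded_linear_compose[OF bounded_linear_snd] bounded_linear_fst bounded_linear_snd)
  from bounded_linear.linear[OF this] show "linear target_coord_L"
    by (simp add: target_coord_L_def case_prod_beta')
  let ?g = "\<lambda>p. ((par_y p, par_x p $ None), (restr (par_x p), par_\<omega> p))"
  have "?g (target_coord_L z) = z" for z by (auto simp: target_coord_L_def split: prod.split)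
  moreover have "target_coord_L (?g p) = p" for p by (simp add: target_coord_L_def)
  ultimately show "bij target_coord_L" by (intro o_bij[of ?g]) (auto simp: fun_eq_iff)
qed

text \<open>Row operations of determinant \<open>1\<close> that make the Jacobian matrices triangular.\<close>

definition shear_R :: "real^'m::finite \<Rightarrow> real^('m + ('m option + unit)) \<Rightarrow> real^('m + ('m option
  + unit))" where
  "shear_R g v = params (par_y v, par_x v, par_\<omega> v - g \<bullet> par_y v)"

lemma linear_shear_R: "linear (shear_R g)"
proof -
  have "bounded_linear (\<lambda>v. params (par_y v, par_x v, par_\<omega> v - g \<bullet> par_y v))"
    by (intro bounded_linear_compose[OF bounded_linear_params] bounded_linear_Pair bounded_linear_par
        bounded_linear_sub bounded_linear_compose[OF bounded_linear_inner_right])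
  then show ?thesis by (simp add: shear_R_def[abs_def] bounded_linear.linear)
qed

lemma det_shear_R: "det (matrix (shear_R (g :: real^'m::finite))) = 1"
proof -
  let ?r = "\<lambda>i :: 'm + ('m option + unit). case i of Inl _ \<Rightarrow> 0 | Inr k \<Rightarrow>
    (case k of Inl _ \<Rightarrow> 0 | Inr _ \<Rightarrow> (1 :: nat))"
  have "det (matrix (shear_R g)) = (\<Prod>i\<in>UNIV. matrix (shear_R g) $ i $ i)"
  proof (rule det_triangular[where r="?r"])
    fix i j :: "'m + ('m option + unit)"
    assume "matrix (shear_R g) $ i $ j \<noteq> 0"
    then show "i = j \<or> ?r j < ?r i"
      by (cases i; cases j) (auto simp: matrix_entry shear_R_def par_nth axis_component split:
        sum.splits if_splits)
  qed
  also have "\<dots> = 1" by (simp add: prod_UNIV_parameters matrix_entry shear_R_def)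
  finally show ?thesis .
qed

definition shear_L :: "real^'m::finite \<Rightarrow> real^('m + ('m option + unit)) \<Rightarrow> real^('m + ('m option
  + unit))" where
  "shear_L g v = params (par_y v, glue (restr (par_x v), par_x v $ None - g \<bullet> restr (par_x v)), par_\<omega> v)"

lemma linear_shear_L: "linear (shear_L g)"
proof -
  have "bounded_linear (\<lambda>v. params (par_y v, glue (restr (par_x v), par_x v $ None - g \<bullet> restr
    (par_x v)), par_\<omega> v))"
    by (intro bounded_linear_compose[OF bounded_linear_params] bounded_linear_Pair bounded_linear_par
        bounded_linear_compose[OF bounded_linear_glue] bounded_linear_compose[OF bounded_linear_restr]
        bounded_linear_compose[OF bounded_linear_vec_nth]
        bounded_linear_sub bounded_linear_compose[OF bounded_linear_inner_right])
  then show ?thesis by (simp add: shear_L_def[abs_def] bounded_linear.linear)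
qed

lemma det_shear_L: "det (matrix (shear_L (g :: real^'m::finite))) = 1"
proof -
  let ?r = "\<lambda>i :: 'm + ('m option + unit). case i of Inr (Inl None) \<Rightarrow> 1 | _ \<Rightarrow> (0 :: nat)"
  have "det (matrix (shear_L g)) = (\<Prod>i\<in>UNIV. matrix (shear_L g) $ i $ i)"
  proof (rule det_triangular[where r="?r"])
    fix i j :: "'m + ('m option + unit)"
    assume "matrix (shear_L g) $ i $ j \<noteq> 0"
    then show "i = j \<or> ?r j < ?r i"
      by (cases i; cases j)
        (auto simp: matrix_entry shear_L_def par_nth axis_component glue_def split: sum.splits
          option.splits if_splits)
  qed
  also have "\<dots> = 1"
    by (simp add: prod_UNIV_parameters prod_UNIV_option matrix_entry shear_L_def inner_vec_def
      axis_component)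
  finally show ?thesis .
qed

context radon_setting
begin

lemma linear_bij_target_coord_R: "linear (target_coord_R A)" "bij (target_coord_R A)"
proof -
  have "bounded_linear (\<lambda>z. params (restr ((1/2) *\<^sub>R (matrix_inv A *v snd z)), fst z, ((1/2) *\<^sub>R
    (matrix_inv A *v snd z)) $ None))"
    by (intro bounded_linear_compose[OF bounded_linear_params] bounded_linear_Pair
      bounded_linear_compose[OF bounded_linear_restr] bounded_linear_compose[OF bounded_linear_vec_nth]
      bounded_linear_compose[OF bounded_linear_scaleR_right]
      bounded_linear_compose[OF matrix_vector_mul_bounded_linear] bounded_linear_fst bounded_linear_snd)
  from bounded_linear.linear[OF this] show "linear (target_coord_R A)"
    by (simp add: target_coord_R_def case_prod_beta')
  let ?g = "\<lambda>p. (par_x p, A *v (2 *\<^sub>R glue (par_y p, par_\<omega> p)))"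
  have "?g (target_coord_R A z) = z" for z
    using glue_restr[of "(1/2) *\<^sub>R (matrix_inv A *v snd z)"]
    by (cases z) (simp add: target_coord_R_def matrix_inv_A)
  moreover have "target_coord_R A (?g p) = p" for p
    by (simp add: target_coord_R_def matrix_inv_A)
  ultimately show "bij (target_coord_R A)" by (intro o_bij[of ?g]) (auto simp: fun_eq_iff)
qed

lemma target_coord_R_\<pi>R:
  "target_coord_R A (\<pi>R A q p) = params (par_\<omega> p *\<^sub>R restr (xT q (par_y p) (par_x p)), par_x p,
     par_\<omega> p * xT q (par_y p) (par_x p) $ None)"
  by (simp add: target_coord_R_def \<pi>R_def Let_def matrix_vector_mult_scaleR matrix_inv_A restr_scaleR)

lemma target_coord_L_\<pi>L:
  "target_coord_L (\<pi>L A q p) = (let z = xT q (par_y p) (par_x p) in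
     params (par_y p, glue ((2 * par_\<omega> p) *\<^sub>R (restr (A *v z) + (A *v z) $ None *\<^sub>R grad q
       (par_y p)), z \<bullet> (A *v z)), par_\<omega> p))"
  by (simp add: target_coord_L_def \<pi>L_def Let_def B_mat_eq)

lemma has_derivative_params:
  assumes "(a has_derivative a') (at p)" "(b has_derivative b') (at p)" "(c has_derivative c') (at p)"
  shows "((\<lambda>p. params (a p, b p, c p)) has_derivative (\<lambda>v. params (a' v, b' v, c' v))) (at p)"
  by (rule bounded_linear.has_derivative[OF bounded_linear_params has_derivative_Pair[OF assms(1)
    has_derivative_Pair[OF assms(2,3)]]])

lemma restr_xT_has_derivative:
  "((\<lambda>p. restr (xT q (par_y p) (par_x p))) has_derivative (\<lambda>v. restr (par_x v) - par_y v)) (at p)"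
proof -
  have "((\<lambda>p. restr (par_x p) - par_y p) has_derivative (\<lambda>v. restr (par_x v) - par_y v)) (at p)"
    by (intro has_derivative_diff has_derivative_par bounded_linear.has_derivative[OF
      bounded_linear_restr has_derivative_par(2)])
  then show ?thesis by (simp add: restr_xT)
qed

lemma None_xT_has_derivative:
  assumes "par_y p \<in> \<Omega>"
  shows "((\<lambda>p. xT q (par_y p) (par_x p) $ None) has_derivative (\<lambda>v. par_x v $ None - grad q
    (par_y p) \<bullet> par_y v)) (at p)"
proof -
  have "((\<lambda>p. par_x p $ None - q (par_y p)) has_derivative (\<lambda>v. par_x v $ None - grad q (par_y p)
    \<bullet> par_y v)) (at p)"
    by (intro has_derivative_diff bounded_linear.has_derivative[OF bounded_linear_vec_nth
      has_derivative_par(2)]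
        par_y_compose_has_derivative q_has_derivative assms)
  then show ?thesis by (simp add: restr_xT)
qed

subsection \<open>The right projection\<close>

lemma \<pi>R_coord_has_derivative:
  assumes "par_y p \<in> \<Omega>"
  defines "z \<equiv> xT q (par_y p) (par_x p)"
  shows "((\<lambda>p. target_coord_R A (\<pi>R A q p)) has_derivative (\<lambda>v. params (
    par_\<omega> p *\<^sub>R (restr (par_x v) - par_y v) + par_\<omega> v *\<^sub>R restr z, par_x v,
    par_\<omega> p * (par_x v $ None - grad q (par_y p) \<bullet> par_y v) + par_\<omega> v * z $ None))) (at p)"
  unfolding target_coord_R_\<pi>R z_def
  by (intro has_derivative_params has_derivative_scaleR has_derivative_mult has_derivative_par
      restr_xT_has_derivative None_xT_has_derivative assms(1))

lemma jac_det_\<pi>R: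
  assumes "par_y p \<in> \<Omega>"
  shows "jac_det (\<lambda>p. target_coord_R A (\<pi>R A q p)) p = (- par_\<omega> p) ^ CARD('m) * tangency q p"
proof -
  define z where "z = xT q (par_y p) (par_x p)"
  define L where "L = (\<lambda>v. params (
    par_\<omega> p *\<^sub>R (restr (par_x v) - par_y v) + par_\<omega> v *\<^sub>R restr z, par_x v,
    par_\<omega> p * (par_x v $ None - grad q (par_y p) \<bullet> par_y v) + par_\<omega> v * z $ None))"
  note D = \<pi>R_coord_has_derivative[OF assms, folded z_def, folded L_def]
  have L: "linear L" using D by (rule has_derivative_linear)
  \<comment> \<open>Subtracting \<open>\<nabla>q\<close> times the first rows from the last one clears its derivative in \<open>y\<close>.\<close>
  let ?S = "shear_R (grad q (par_y p))"
  have h: "tangency q p = z $ None - grad q (par_y p) \<bullet> restr z" by (simp add: tangency_xT z_def)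
  have SL: "(?S \<circ> L) v = params (par_\<omega> p *\<^sub>R (restr (par_x v) - par_y v) + par_\<omega> v *\<^sub>R restr z, par_x v,
      par_\<omega> p * (par_x v $ None - grad q (par_y p) \<bullet> restr (par_x v)) + par_\<omega> v * tangency q p)" for v
    unfolding h by (simp add: L_def shear_R_def inner_diff_right inner_add_right algebra_simps)
  let ?r = "\<lambda>i :: 'm + ('m option + unit). case i of Inl _ \<Rightarrow> 2 | Inr k \<Rightarrow>
    (case k of Inl _ \<Rightarrow> 0 | Inr _ \<Rightarrow> (1 :: nat))"
  have "det (matrix (?S \<circ> L)) = (\<Prod>i\<in>UNIV. matrix (?S \<circ> L) $ i $ i)"
  proof (rule det_triangular[where r="?r"])
    fix i j :: "'m + ('m option + unit)"
    assume "matrix (?S \<circ> L) $ i $ j \<noteq> 0"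
    then show "i = j \<or> ?r j < ?r i"
      unfolding matrix_entry SL
      by (cases i; cases j) (auto simp: axis_component split: sum.splits if_splits)
  qed
  also have "\<dots> = (- par_\<omega> p) ^ CARD('m) * tangency q p"
    unfolding matrix_entry SL by (simp add: prod_UNIV_parameters)
  also have "det (matrix (?S \<circ> L)) = det (matrix ?S) * det (matrix L)"
    by (simp add: matrix_compose[OF L linear_shear_R] det_mul)
  finally show ?thesis using jac_det_eq[OF D] by (simp add: det_shear_R)
qed

text \<open>The kernel vector moves the base point with velocity \<open>x'\<^sub>T\<close> and the frequency with velocity \<open>\<omega>\<close>. Where
  the tangency function vanishes, \<open>\<omega> x\<^sub>T\<close> stays fixed to first order. The tangency function then changes at
  the rate \<open>- x'\<^sub>T \<bullet> Hess q x'\<^sub>T\<close>, which is where definiteness of the Hessian enters.\<close>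

lemma \<pi>R_kernel:
  assumes p: "p \<in> param_domain \<Omega> q" and h: "tangency q p = 0"
    and hess: "pos_def (hessian q (par_y p)) \<or> neg_def (hessian q (par_y p))"
  defines "z \<equiv> xT q (par_y p) (par_x p)"
  shows "\<exists>v. frechet_derivative (\<lambda>p. target_coord_R A (\<pi>R A q p)) (at p) v = 0 \<and>
    par_x v $ None - grad q (par_y p) \<bullet> restr (par_x v) - grad' (par_y p) (par_y v) \<bullet> restr z \<noteq> 0"
proof (intro exI conjI)
  have y: "par_y p \<in> \<Omega>" using p by (simp add: param_domain_def)
  let ?v = "params (restr z, 0, par_\<omega> p)"
  have zN: "z $ None = grad q (par_y p) \<bullet> restr z" using h by (simp add: tangency_xT z_def)
  show "frechet_derivative (\<lambda>p. target_coord_R A (\<pi>R A q p)) (at p) ?v = 0"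
    unfolding frechet_derivative_at[OF \<pi>R_coord_has_derivative[OF y], symmetric]
    by (simp add: zN flip: z_def)
  have "restr z \<noteq> 0" unfolding z_def by (rule restr_xT_nonzero[OF p h])
  then have "restr z \<bullet> (hessian q (par_y p) *v restr z) \<noteq> 0"
    using hess by (auto simp: pos_def_def neg_def_def)
  then show "par_x ?v $ None - grad q (par_y p) \<bullet> restr (par_x ?v) - grad' (par_y p) (par_y ?v)
    \<bullet> restr z \<noteq> 0"
    by (simp add: grad'_hessian[OF y])
qed

lemma smooth_\<pi>R: "smooth_on {p. par_y p \<in> \<Omega>} (\<pi>R A q)"
  unfolding \<pi>R_def[abs_def] Let_def
  by (intro smooth_on_Pair smooth_par smooth_on_scaleR smooth_on_mult smooth_on_const
      smooth_on_linear_comp[OF matrix_vector_mul_bounded_linear] smooth_xT_par)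

lemma only_folds_\<pi>R:
  assumes "\<forall>y\<in>\<Omega>. pos_def (hessian q y) \<or> neg_def (hessian q y)"
  shows "only_folds (param_domain \<Omega> q) (\<pi>R A q)"
  unfolding only_folds_def
proof (intro exI[of _ "target_coord_R A"] conjI linear_bij_target_coord_R)
  show "only_folds_coord (param_domain \<Omega> q) (target_coord_R A \<circ> \<pi>R A q)"
    unfolding o_def
  proof (rule only_folds_coordI[where \<kappa>="\<lambda>p. (- par_\<omega> p) ^ CARD('m)" and h="tangency q",
    OF open_par_domain])
    fix p assume "p \<in> {p. par_y p \<in> \<Omega> \<and> par_\<omega> p \<noteq> 0}"
    then show "jac_det (\<lambda>p. target_coord_R A (\<pi>R A q p)) p = (- par_\<omega> p) ^ CARD('m) * tangency q p"
      by (simp add: jac_det_\<pi>R)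
  next
    show "smooth_on {p. par_y p \<in> \<Omega> \<and> par_\<omega> p \<noteq> 0} (\<lambda>p. target_coord_R A (\<pi>R A q p))"
      using linear_bij_target_coord_R(1)
      by (intro smooth_on_linear_comp[OF _ smooth_on_subset[OF smooth_\<pi>R]])
        (auto simp: linear_conv_bounded_linear)
  next
    fix p assume p: "p \<in> param_domain \<Omega> q"
    then have y: "par_y p \<in> \<Omega>" and w: "par_\<omega> p \<noteq> 0" by (auto simp: param_domain_def)
    show "(\<lambda>p. (- par_\<omega> p) ^ CARD('m)) differentiable (at p)"
      using has_derivative_power[OF has_derivative_minus[OF has_derivative_par(3)]] by
        (rule differentiableI)
    show "(- par_\<omega> p) ^ CARD('m) \<noteq> 0" using w by simp
    show "(tangency q has_derivative (\<lambda>v. par_x v $ None - grad q (par_y p) \<bullet> restr (par_x v)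
        - grad' (par_y p) (par_y v) \<bullet> restr (xT q (par_y p) (par_x p)))) (at p)"
      by (rule tangency_has_derivative[OF y])
    show "\<exists>v. frechet_derivative (\<lambda>p. target_coord_R A (\<pi>R A q p)) (at p) v = 0 \<and>
        par_x v $ None - grad q (par_y p) \<bullet> restr (par_x v)
        - grad' (par_y p) (par_y v) \<bullet> restr (xT q (par_y p) (par_x p)) \<noteq> 0" if "tangency q p = 0"
      using \<pi>R_kernel[OF p that] assms y by blast
  qed (auto simp: param_domain_def)
qed

subsection \<open>The left projection\<close>

lemma \<pi>L_coord_has_derivative:
  assumes "par_y p \<in> \<Omega>"
  defines "z \<equiv> xT q (par_y p) (par_x p)"
  defines "dz \<equiv> \<lambda>v. par_x v - graph_tangent q (par_y p) (par_y v)"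
  shows "((\<lambda>p. target_coord_L (\<pi>L A q p)) has_derivative (\<lambda>v. params (par_y v,
    glue ((2 * par_\<omega> p) *\<^sub>R (restr (A *v dz v) + ((A *v z) $ None *\<^sub>R grad' (par_y p) (par_y v) +
      (A *v dz v) $ None *\<^sub>R grad q (par_y p)))
       + (2 * par_\<omega> v) *\<^sub>R (restr (A *v z) + (A *v z) $ None *\<^sub>R grad q (par_y p)),
     2 * ((A *v z) \<bullet> dz v)), par_\<omega> v))) (at p)"
proof -
  have dz: "((\<lambda>p. xT q (par_y p) (par_x p)) has_derivative dz) (at p)"
    unfolding dz_def by (rule xT_par_has_derivative[OF assms(1)])
  have Adz: "((\<lambda>p. A *v xT q (par_y p) (par_x p)) has_derivative (\<lambda>v. A *v dz v)) (at p)"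
    by (rule bounded_linear.has_derivative[OF matrix_vector_mul_bounded_linear dz])
  have quad: "((\<lambda>p. xT q (par_y p) (par_x p) \<bullet> (A *v xT q (par_y p) (par_x p))) has_derivative
      (\<lambda>v. 2 * ((A *v z) \<bullet> dz v))) (at p)"
    using has_derivative_inner[OF dz Adz] by (simp add: quadratic_form_derivative z_def)
  show ?thesis
    unfolding target_coord_L_\<pi>L Let_def z_def
    by (intro has_derivative_params has_derivative_par bounded_linear.has_derivative[OF
      bounded_linear_glue]
        has_derivative_Pair quad[unfolded z_def] has_derivative_scaleR has_derivative_mult_right
          has_derivative_add
        bounded_linear.has_derivative[OF bounded_linear_restr Adz]
        bounded_linear.has_derivative[OF bounded_linear_vec_nth Adz]
        par_y_compose_has_derivative[OF grad_has_derivative[OF assms(1)]])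
qed

text \<open>In the coordinate \<open>\<zeta> = A x\<close> on the source, the derivative of the left projection contains \<open>A\<close> only in
  entries that do not affect the determinant.\<close>

definition source_coord :: "real^('m + ('m option + unit)) \<Rightarrow> real^('m + ('m option + unit))" where
  "source_coord v = params (par_y v, matrix_inv A *v par_x v, par_\<omega> v)"

lemma linear_source_coord: "linear source_coord"
proof -
  have "bounded_linear (\<lambda>v. params (par_y v, matrix_inv A *v par_x v, par_\<omega> v))"
    by (intro bounded_linear_compose[OF bounded_linear_params] bounded_linear_Pair bounded_linear_par
        bounded_linear_compose[OF matrix_vector_mul_bounded_linear])
  then show ?thesis by (simp add: source_coord_def[abs_def] bounded_linear.linear)
qed

lemma det_source_coord: "det (matrix source_coord) \<noteq> 0"
proof -
  have "inj source_coord"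
  proof (rule injI)
    fix v w assume "source_coord v = source_coord w"
    then have "par_y v = par_y w" "matrix_inv A *v par_x v = matrix_inv A *v par_x w" "par_\<omega> v = par_\<omega> w"
      unfolding source_coord_def by (metis par_params)+
    then show "v = w" by (metis matrix_inv_A(1) params_par)
  qed
  then show ?thesis using det_nz_iff_inj[OF linear_source_coord] by simp
qed

lemma jac_det_\<pi>L:
  assumes y: "par_y p \<in> \<Omega>" and w: "par_\<omega> p \<noteq> 0"
  shows "jac_det (\<lambda>p. target_coord_L (\<pi>L A q p)) p * det (matrix source_coord)
    = 2 * (2 * par_\<omega> p) ^ CARD('m) * tangency q p"
proof -
  define z where "z = xT q (par_y p) (par_x p)"
  define dz where "dz = (\<lambda>v. par_x v - graph_tangent q (par_y p) (par_y v))"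
  define L where "L = (\<lambda>v. params (par_y v,
    glue ((2 * par_\<omega> p) *\<^sub>R (restr (A *v dz v) + ((A *v z) $ None *\<^sub>R grad' (par_y p) (par_y v) +
      (A *v dz v) $ None *\<^sub>R grad q (par_y p)))
       + (2 * par_\<omega> v) *\<^sub>R (restr (A *v z) + (A *v z) $ None *\<^sub>R grad q (par_y p)),
     2 * ((A *v z) \<bullet> dz v)), par_\<omega> v))"
  have D: "((\<lambda>p. target_coord_L (\<pi>L A q p)) has_derivative L) (at p)"
    unfolding L_def dz_def z_def by (rule \<pi>L_coord_has_derivative[OF y])
  have L: "linear L" using D by (rule has_derivative_linear)
  \<comment> \<open>The row of \<open>t\<close> is the derivative of \<open>x\<^sub>T \<bullet> A x\<^sub>T\<close>. Subtracting \<open>x'\<^sub>T / \<omega>\<close> times the rows of \<open>\<eta>\<close> leaves, among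
    the columns of \<open>\<zeta>\<close>, only the last entry, which is twice the tangency function.\<close>
  let ?S = "shear_L ((1 / par_\<omega> p) *\<^sub>R restr z)"
  let ?M = "?S \<circ> (L \<circ> source_coord)"
  have h: "tangency q p = z $ None - grad q (par_y p) \<bullet> restr z" by (simp add: tangency_xT z_def)
  have grad'0: "grad' (par_y p) 0 = 0"
    using linear_0[OF has_derivative_linear[OF grad_has_derivative[OF y]]] .
  have col: "?M (axis (Inr (Inl k)) 1) = params (0,
      glue ((2 * par_\<omega> p) *\<^sub>R (restr (axis k 1) + axis k 1 $ None *\<^sub>R grad q (par_y p)),
        2 * tangency q p * axis k 1 $ None), 0)" for k
  proof -
    have "(A *v z) \<bullet> (matrix_inv A *v a) = z \<bullet> a" for a
      using A_sym[of z "matrix_inv A *v a"] by (simp add: matrix_inv_A)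
    then have "?M (axis (Inr (Inl k)) 1) = params (0,
      glue ((2 * par_\<omega> p) *\<^sub>R (restr (axis k 1) + axis k 1 $ None *\<^sub>R grad q (par_y p)),
        2 * (z \<bullet> axis k 1) - ((1 / par_\<omega> p) *\<^sub>R restr z) \<bullet> ((2 * par_\<omega> p) *\<^sub>R (restr (axis k 1)
          + axis k 1 $ None *\<^sub>R grad q (par_y p)))), 0)"
      by (simp add: source_coord_def L_def dz_def shear_L_def matrix_inv_A grad'0)
    also have "2 * (z \<bullet> axis k 1) - ((1 / par_\<omega> p) *\<^sub>R restr z) \<bullet> ((2 * par_\<omega> p) *\<^sub>R (restr
      (axis k 1) + axis k 1 $ None *\<^sub>R grad q (par_y p)))
        = 2 * tangency q p * axis k 1 $ None"
      using w by (simp add: h inner_option[of z] inner_add_right inner_commute algebra_simps)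
    finally show ?thesis .
  qed
  have y_row: "?M v $ Inl i = par_y v $ i" and \<omega>_row: "?M v $ Inr (Inr u) = par_\<omega> v" for v i u
    by (simp_all add: source_coord_def L_def shear_L_def)
  let ?r = "\<lambda>i :: 'm + ('m option + unit). case i of Inr (Inl None) \<Rightarrow> 1 | Inr (Inl (Some _))
    \<Rightarrow> 2 | _ \<Rightarrow> (0 :: nat)"
  have "det (matrix ?M) = (\<Prod>i\<in>UNIV. matrix ?M $ i $ i)"
  proof (rule det_triangular[where r="?r"])
    fix i j :: "'m + ('m option + unit)"
    assume nz: "matrix ?M $ i $ j \<noteq> 0"
    consider k where "i = Inl k" | k where "i = Inr (Inr k)" | k l where "i = Inr (Inl k)" "j = Inr
      (Inl l)"
      | k where "i = Inr (Inl k)" "\<And>l. j \<noteq> Inr (Inl l)"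
      by (metis sum.exhaust)
    then show "i = j \<or> ?r j < ?r i"
    proof cases
      case 1
      show ?thesis using nz unfolding 1 matrix_entry y_row
        by (simp add: par_nth axis_component split: if_splits)
    next
      case 2
      show ?thesis using nz unfolding 2 matrix_entry \<omega>_row
        by (simp add: par_nth axis_component split: if_splits)
    next
      case 3
      then show ?thesis using nz unfolding matrix_entry 3 col
        by (auto simp: axis_component glue_def split: option.splits if_splits)
    next
      case 4
      then show ?thesis by (cases j) (auto split: sum.splits option.splits)
    qed
  qed
  also have "\<dots> = 2 * (2 * par_\<omega> p) ^ CARD('m) * tangency q p"
    unfolding matrix_entry prod_UNIV_parameters prod_UNIV_option y_row \<omega>_row col by
      (simp add: axis_component)
  also have "det (matrix ?M) = det (matrix ?S) * (det (matrix L) * det (matrix source_coord))"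
    by (simp add: matrix_compose[OF linear_compose[OF linear_source_coord L] linear_shear_L]
        matrix_compose[OF linear_source_coord L] det_mul)
  finally show ?thesis using jac_det_eq[OF D] by (simp add: det_shear_L)
qed

text \<open>The covector \<open>\<nu>\<close> is conormal to the graph. Moving \<open>x\<close> with velocity \<open>A\<^sup>-\<^sup>1 \<nu>\<close> changes \<open>A x\<^sub>T\<close> by a
  conormal vector, which \<open>B\<close> annihilates, and changes \<open>t\<close> at the rate \<open>2 x\<^sub>T \<bullet> \<nu>\<close>, which is twice the
  tangency function.\<close>

lemma \<pi>L_kernel:
  assumes p: "p \<in> param_domain \<Omega> q" and h: "tangency q p = 0"
  shows "\<exists>v. frechet_derivative (\<lambda>p. target_coord_L (\<pi>L A q p)) (at p) v = 0 \<and>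
    par_x v $ None - grad q (par_y p) \<bullet> restr (par_x v)
      - grad' (par_y p) (par_y v) \<bullet> restr (xT q (par_y p) (par_x p)) \<noteq> 0"
proof (intro exI conjI)
  define z where "z = xT q (par_y p) (par_x p)"
  have y: "par_y p \<in> \<Omega>" using p by (simp add: param_domain_def)
  define \<nu> where "\<nu> = glue (- grad q (par_y p), 1)"
  define u where "u = matrix_inv A *v \<nu>"
  have Au: "A *v u = \<nu>" by (simp add: u_def matrix_inv_A)
  let ?v = "params (0, u, 0)"
  have grad'0: "grad' (par_y p) 0 = 0"
    using linear_0[OF has_derivative_linear[OF grad_has_derivative[OF y]]] .
  have Az: "(A *v z) \<bullet> u = 0"
  proof -
    have "(A *v z) \<bullet> u = z \<bullet> \<nu>" using A_sym[of z u] by (simp add: Au)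
    also have "\<dots> = restr z \<bullet> restr \<nu> + z $ None * \<nu> $ None" by (rule inner_option)
    also have "\<dots> = tangency q p" by (simp add: \<nu>_def tangency_xT z_def inner_commute)
    finally show ?thesis using h by simp
  qed
  show "frechet_derivative (\<lambda>p. target_coord_L (\<pi>L A q p)) (at p) ?v = 0"
    unfolding frechet_derivative_at[OF \<pi>L_coord_has_derivative[OF y], symmetric]
    by (simp add: grad'0 Au Az flip: z_def) (simp add: \<nu>_def)
  have "u \<noteq> 0"
  proof
    assume "u = 0"
    then have "\<nu> = 0" using Au by simp
    then have "\<nu> $ None = 0" by simp
    then show False by (simp add: \<nu>_def)
  qed
  then have "0 < u \<bullet> \<nu>" using A_pos[of u] by (simp add: Au)
  also have "u \<bullet> \<nu> = restr u \<bullet> restr \<nu> + u $ None * \<nu> $ None" by (rule inner_option)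
  also have "\<dots> = u $ None - grad q (par_y p) \<bullet> restr u" by (simp add: \<nu>_def inner_commute)
  finally show "par_x ?v $ None - grad q (par_y p) \<bullet> restr (par_x ?v)
      - grad' (par_y p) (par_y ?v) \<bullet> restr (xT q (par_y p) (par_x p)) \<noteq> 0"
    by (simp add: grad'0)
qed

lemma smooth_\<pi>L: "smooth_on {p. par_y p \<in> \<Omega>} (\<pi>L A q)"
  unfolding \<pi>L_def[abs_def] Let_def B_mat_eq
  by (intro smooth_on_Pair smooth_par smooth_on_scaleR smooth_on_mult smooth_on_const
    smooth_on_inner smooth_on_add
      smooth_on_linear_comp[OF matrix_vector_mul_bounded_linear] smooth_on_linear_comp[OF
        bounded_linear_restr]
      smooth_on_linear_comp[OF bounded_linear_vec_nth] smooth_xT_par smooth_on_compose[OF _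
        smooth_grad]) auto

lemma only_folds_\<pi>L: "only_folds (param_domain \<Omega> q) (\<pi>L A q)"
  unfolding only_folds_def
proof (intro exI[of _ "target_coord_L"] conjI linear_bij_target_coord_L)
  let ?d = "det (matrix source_coord)"
  show "only_folds_coord (param_domain \<Omega> q) (target_coord_L \<circ> \<pi>L A q)"
    unfolding o_def
  proof (rule only_folds_coordI[where \<kappa>="\<lambda>p. (2 / ?d) * (2 * par_\<omega> p)
    ^ CARD('m)" and h="tangency q", OF open_par_domain])
    fix p assume "p \<in> {p. par_y p \<in> \<Omega> \<and> par_\<omega> p \<noteq> 0}"
    then show "jac_det (\<lambda>p. target_coord_L (\<pi>L A q p)) p = (2 / ?d) * (2 * par_\<omega> p) ^ CARD('m)
      * tangency q p"
      using jac_det_\<pi>L[of p] det_source_coord by (simp add: field_simps)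
  next
    show "smooth_on {p. par_y p \<in> \<Omega> \<and> par_\<omega> p \<noteq> 0} (\<lambda>p. target_coord_L (\<pi>L A q p))"
      using linear_bij_target_coord_L(1)
      by (intro smooth_on_linear_comp[OF _ smooth_on_subset[OF smooth_\<pi>L]])
        (auto simp: linear_conv_bounded_linear)
  next
    fix p assume p: "p \<in> param_domain \<Omega> q"
    then have y: "par_y p \<in> \<Omega>" and w: "par_\<omega> p \<noteq> 0" by (auto simp: param_domain_def)
    show "(\<lambda>p. (2 / ?d) * (2 * par_\<omega> p) ^ CARD('m)) differentiable (at p)"
      using has_derivative_mult_right[OF has_derivative_power[OF has_derivative_mult_right[OF
        has_derivative_par(3)]]]
      by (rule differentiableI)
    show "(2 / ?d) * (2 * par_\<omega> p) ^ CARD('m) \<noteq> 0" using w det_source_coord by simp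
    show "(tangency q has_derivative (\<lambda>v. par_x v $ None - grad q (par_y p) \<bullet> restr (par_x v)
        - grad' (par_y p) (par_y v) \<bullet> restr (xT q (par_y p) (par_x p)))) (at p)"
      by (rule tangency_has_derivative[OF y])
    show "\<exists>v. frechet_derivative (\<lambda>p. target_coord_L (\<pi>L A q p)) (at p) v = 0 \<and>
        par_x v $ None - grad q (par_y p) \<bullet> restr (par_x v)
        - grad' (par_y p) (par_y v) \<bullet> restr (xT q (par_y p) (par_x p)) \<noteq> 0" if "tangency q p = 0"
      by (rule \<pi>L_kernel[OF p that])
  qed (auto simp: param_domain_def)
qed

subsection \<open>The parametrization of the canonical relation\<close>

text \<open>The equation \<open>d\<^sub>\<omega>\<psi> = 0\<close> reads \<open>t = Q (y, x)\<close> and so eliminates \<open>t\<close>; positivity of \<open>t\<close> is automatic because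
  \<open>A\<close> is positive definite and \<open>x\<close> is off the graph.\<close>

lemma canonical_relation_eq_image:
  "canonical_relation (\<Omega> \<times> {0<..}) (- graph_pt q ` \<Omega>) (radon_phase A q) = (\<lambda>p. (\<pi>L A q p, \<pi>R A q p))
    ` param_domain \<Omega> q"
  (is "?C = ?\<gamma> ` ?W")
proof
  have point: "?\<gamma> (params (y, x, \<omega>)) = (((y, phase_Q A q (y, x)), ((2 * \<omega>) *\<^sub>R (B_mat q y *v
    (A *v xT q y x)), \<omega>)), (x, (2 * \<omega>) *\<^sub>R (A *v xT q y x)))" for y x \<omega>
    by (simp add: \<pi>L_def \<pi>R_def Let_def phase_Q_def)
  have elem: "((u, grad (\<lambda>u'. radon_phase A q (u', v, \<theta>)) u), (v, - grad (\<lambda>v'. radon_phase A q (u,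
    v', \<theta>)) v)) = ?\<gamma> (params (fst u, v, \<theta>))"
    if "u \<in> \<Omega> \<times> {0<..}" "grad (\<lambda>\<theta>'. radon_phase A q (u, v, \<theta>')) \<theta> = 0" for u v \<theta>
    using that unfolding point
    by (cases u) (simp add: grad_base_radon_phase grad_space_radon_phase grad_frequency_radon_phase)
  show "?C \<subseteq> ?\<gamma> ` ?W"
  proof
    fix c assume "c \<in> ?C"
    then obtain u v \<theta> where c: "c = ((u, grad (\<lambda>u'. radon_phase A q (u', v, \<theta>)) u), (v, - grad
      (\<lambda>v'. radon_phase A q (u, v', \<theta>)) v))"
      and *: "u \<in> \<Omega> \<times> {0<..}" "v \<in> - graph_pt q ` \<Omega>" "\<theta> \<noteq> 0" "grad (\<lambda>\<theta>'. radon_phase A q (u, v, \<theta>'))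
        \<theta> = 0"
      unfolding canonical_relation_def by blast
    have "c = ?\<gamma> (params (fst u, v, \<theta>))" unfolding c by (rule elem[OF *(1,4)])
    moreover have "params (fst u, v, \<theta>) \<in> ?W" using * by (auto simp: param_domain_def)
    ultimately show "c \<in> ?\<gamma> ` ?W" by blast
  qed
  show "?\<gamma> ` ?W \<subseteq> ?C"
  proof
    fix c assume "c \<in> ?\<gamma> ` ?W"
    then obtain p where p: "p \<in> ?W" "c = ?\<gamma> p" by blast
    define y x \<omega> where "y = par_y p" and "x = par_x p" and "\<omega> = par_\<omega> p"
    have pW: "y \<in> \<Omega>" "x \<in> - graph_pt q ` \<Omega>" "\<omega> \<noteq> 0" using p(1) by
      (auto simp: param_domain_def y_def x_def \<omega>_def)
    have "xT q y x \<noteq> 0" using pW by (auto simp: xT_eq_0_iff)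
    then have t: "0 < phase_Q A q (y, x)" using A_pos by (simp add: phase_Q_def)
    let ?u = "(y, phase_Q A q (y, x))"
    have u: "?u \<in> \<Omega> \<times> {0<..}" "grad (\<lambda>\<theta>'. radon_phase A q (?u, x, \<theta>')) \<omega> = 0"
      using pW t by (auto simp: grad_frequency_radon_phase)
    have "c = ((?u, grad (\<lambda>u'. radon_phase A q (u', x, \<omega>)) ?u), (x, - grad (\<lambda>v'. radon_phase A q
      (?u, v', \<omega>)) x))"
      using elem[OF u] by (simp add: p(2) y_def x_def \<omega>_def)
    then show "c \<in> ?C" unfolding canonical_relation_def using u pW by blast
  qed
qed

text \<open>The parameters \<open>(y, x, \<omega>)\<close> are components of the parametrized point, so the inverse is the restriction of
  a linear map; this also makes the derivative injective.\<close>

lemma global_parametrization_canonical_relation: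
  "global_parametrization (param_domain \<Omega> q) (\<lambda>p. (\<pi>L A q p, \<pi>R A q p))
    (canonical_relation (\<Omega> \<times> {0<..}) (- graph_pt q ` \<Omega>) (radon_phase A q))"
  unfolding global_parametrization_def
proof (intro conjI ballI exI)
  let ?\<gamma> = "\<lambda>p. (\<pi>L A q p, \<pi>R A q p)" and ?W = "param_domain \<Omega> q"
  define g :: "(((real^'m) \<times> real) \<times> ((real^'m) \<times> real)) \<times> ((real^('m option)) \<times> (real^('m option)))
    \<Rightarrow> real^('m + ('m option + unit))"
    where "g c = params (fst (fst (fst c)), fst (snd c), snd (snd (fst c)))" for c
  have g\<gamma>: "g (?\<gamma> p) = p" for p by (simp add: g_def \<pi>L_def \<pi>R_def Let_def)
  have g: "bounded_linear g"
    unfolding g_def[abs_def]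
    by (intro bounded_linear_compose[OF bounded_linear_params] bounded_linear_Pair
        bounded_linear_compose[OF bounded_linear_fst] bounded_linear_compose[OF bounded_linear_snd]
          bounded_linear_fst bounded_linear_snd)
  show sm: "smooth_on ?W ?\<gamma>"
    by (rule smooth_on_subset[OF smooth_on_Pair[OF smooth_\<pi>L smooth_\<pi>R]]) (auto simp: param_domain_def)
  show "homeomorphism ?W (canonical_relation (\<Omega> \<times> {0<..}) (- graph_pt q ` \<Omega>) (radon_phase A q)) ?\<gamma> g"
    unfolding homeomorphism_def canonical_relation_eq_image
    using g\<gamma> smooth_on_continuous_on[OF sm] linear_continuous_on[OF g] by (auto simp: image_image)
  fix p assume p: "p \<in> ?W"
  have "((\<lambda>p. g (?\<gamma> p)) has_derivative (\<lambda>v. g (frechet_derivative ?\<gamma> (at p) v))) (at p)"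
    by (rule bounded_linear.has_derivative[OF g smooth_on_has_derivative[OF sm p]])
  then have "((\<lambda>p. p) has_derivative (\<lambda>v. g (frechet_derivative ?\<gamma> (at p) v))) (at p)" by (simp add: g\<gamma>)
  then have "(\<lambda>v. g (frechet_derivative ?\<gamma> (at p) v)) = (\<lambda>v. v)"
    using has_derivative_unique has_derivative_ident by blast
  from fun_cong[OF this] have "g (frechet_derivative ?\<gamma> (at p) v) = v" for v .
  then show "inj (frechet_derivative ?\<gamma> (at p))" by (rule inj_on_inverseI)
qed

end

theorem theorem4p1:
  fixes \<Omega> :: "(real^'m::finite) set"
    and q :: "real^'m \<Rightarrow> real"
    and A :: "real^('m option)^('m option)"
  assumes "open \<Omega>"
    and "smooth_on \<Omega> q"
    and "connected (graph_pt q ` \<Omega>)"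
    and "transpose A = A" and "invertible A" and "pos_def A"
    and "\<forall>y\<in>\<Omega>. pos_def (hessian q y) \<or> neg_def (hessian q y)"
  shows "fourier_integral_operator (\<Omega> \<times> {0<..}) (- graph_pt q ` \<Omega>) (radon_phase A q) (radon A q)
    \<and> two_sided_fold (param_domain \<Omega> q) (\<lambda>p. (\<pi>L A q p, \<pi>R A q p))
        (canonical_relation (\<Omega> \<times> {0<..}) (- graph_pt q ` \<Omega>) (radon_phase A q))"
proof -
  interpret radon_setting \<Omega> q A
    by standard (fact assms)+
  show ?thesis
    unfolding two_sided_fold_def
    using fourier_integral_operator_radon global_parametrization_canonical_relation
      only_folds_\<pi>L only_folds_\<pi>R[OF assms(7)]
    by (simp add: o_def)
qed

end
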